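(* Let $1\le r<n$ and let $i,j$ be integers with $1\le i\le n-r$ and $1\le j\le r$. Set $a:=\min(n-r-i,\,r-j)$ and $b:=\min(i,j)$. Let $\Lambda$ be the ring of symmetric functions with integer coefficients, $I_{r,n-r}$ the $\mathbb Z$-span of the Schur functions $s_\lambda$ with $\lambda\not\subseteq (n-r)^r$ (an ideal), and let $J$ be the ideal of $\Lambda/I_{r,n-r}$ which is the $\mathbb Z$-span of the images of $s_\mu$ with $i^j\subseteq\mu\subseteq(n-r)^r$. Then $J$ is generated as an ideal of $\Lambda/I_{r,n-r}$ by $\{s_\mu: i^j\subseteq\mu\subseteq((i+a)^b,i^{j-b})\}$. Alternatively, $J$ is generated by $\{s_\mu: i^j\subseteq\mu\subseteq(i^j,b^a)\}$.
   Context: Partitions are identified with Young diagrams; $\lambda\subseteq\mu$ means $\lambda_k\le\mu_k$ for all $k$. $c^d$ denotes the rectangular partition with $d$ parts equal to $c$; $((i+a)^b,i^{j-b})$ is the partition with $b$ parts equal to $i+a$ followed by $j-b$ parts equal to $i$; $(i^j,b^a)$ is $j$ parts equal to $i$ followed by $a$ parts equal to $b$. Geometric meaning: $\Lambda/I_{r,n-r}\cong H^\star(\mathrm{Gr}(r,\mathbb C^n),\mathbb Z)$, and for the bigrassmannian $v=v_{r,s,t,n}\in S_n$ (with $i=s-t+1$, $j=r-t+1$, Schubert polynomial $s_{i^j}(x_1,\ldots,x_r)$), $J$ is the ideal $J_v=\mathbb Z$-span$\{\sigma_u:u\ge v\}$ intersected with this Grassmannian cohomology. *)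

theory Defs
  imports
    "HOL-Library.Poly_Mapping"
    "HOL-Library.More_List"
    "HOL-Library.FuncSet"
    "HOL-Algebra.QuotRing"
    "HOL-Algebra.Generated_Groups"
begin

text \<open>
  A monomial in the variables \<open>x\<^sub>0, x\<^sub>1, \<dots>\<close> is an exponent vector of type
  \<^typ>\<open>nat \<Rightarrow>\<^sub>0 nat\<close>; an integral formal power series in these variables is its coefficient
  function. Symmetric functions are the power series of bounded degree that are invariant under
  permutations of the variables.
\<close>

type_synonym monomial = "nat \<Rightarrow>\<^sub>0 nat"

type_synonym power_series = "monomial \<Rightarrow> int"

definition monomial_degree :: "monomial \<Rightarrow> nat" where
  "monomial_degree m = (\<Sum>k\<in>Poly_Mapping.keys m. Poly_Mapping.lookup m k)"

definition bounded_degree :: "power_series \<Rightarrow> bool" where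
  "bounded_degree f \<longleftrightarrow> (\<exists>d. \<forall>m. f m \<noteq> 0 \<longrightarrow> monomial_degree m \<le> d)"

definition symmetric_series :: "power_series \<Rightarrow> bool" where
  "symmetric_series f \<longleftrightarrow> (\<forall>\<pi> m. bij \<pi> \<longrightarrow> f (Poly_Mapping.map_key \<pi> m) = f m)"

definition Symm :: "power_series ring" where
  "Symm =
    \<lparr>carrier = {f. symmetric_series f \<and> bounded_degree f},
     mult = (\<lambda>f g m. \<Sum>(p, q) | p + q = m. f p * g q),
     one = (\<lambda>m. if m = 0 then 1 else 0),
     zero = (\<lambda>m. 0),
     add = (\<lambda>f g m. f m + g m)\<rparr>"

lemma finite_add_pairs: "finite {(p, q). p + q = (m :: monomial)}"
proof -
  let ?K = "Poly_Mapping.keys m"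
  let ?F = "{f. \<forall>x. (x \<in> ?K \<longrightarrow> f x \<in> {.. Max (insert 0 (Poly_Mapping.lookup m ` ?K))}) \<and>
    (x \<notin> ?K \<longrightarrow> f x = (0 :: nat))}"
  have "finite ?F"
    by (rule finite_set_of_finite_funs) auto
  have "Poly_Mapping.lookup ` {p. \<exists>q. p + q = m} \<subseteq> ?F"
  proof (clarsimp, intro conjI impI)
    fix p q :: monomial and x :: nat
    show "x \<in> Poly_Mapping.keys (p + q) \<Longrightarrow> Poly_Mapping.lookup p x \<le>
      Max (insert 0 (Poly_Mapping.lookup (p + q) ` Poly_Mapping.keys (p + q)))"
      by (rule order.trans[OF _ Max_ge[of _ "Poly_Mapping.lookup (p + q) x"]])
        (auto simp: lookup_add)
    show "x \<notin> Poly_Mapping.keys (p + q) \<Longrightarrow> Poly_Mapping.lookup p x = 0"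
      by (simp add: in_keys_iff lookup_add)
  qed
  then have "finite (Poly_Mapping.lookup ` {p. \<exists>q. p + q = m})"
    using \<open>finite ?F\<close> by (rule finite_subset)
  then have fin: "finite {p. \<exists>q. p + q = m}"
    by (rule finite_imageD) (simp add: inj_on_def)
  have "{(p, q). p + q = m} \<subseteq> (\<lambda>p. (p, m - p)) ` {p. \<exists>q. p + q = m}"
    by auto
  then show ?thesis
    using finite_imageI[OF fin] by (rule finite_subset)
qed

lemma monomial_degree_eq:
  assumes "finite A" "Poly_Mapping.keys m \<subseteq> A"
  shows "monomial_degree m = (\<Sum>k\<in>A. Poly_Mapping.lookup m k)"
  unfolding monomial_degree_def
  by (rule sum.mono_neutral_left) (use assms in \<open>auto simp: in_keys_iff\<close>)

lemma monomial_degree_add: "monomial_degree (p + q) = monomial_degree p + monomial_degree q"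
proof -
  let ?A = "Poly_Mapping.keys p \<union> Poly_Mapping.keys q"
  have "monomial_degree (p + q) = (\<Sum>k\<in>?A. Poly_Mapping.lookup (p + q) k)"
    by (rule monomial_degree_eq) (use keys_add[of p q] in auto)
  then show ?thesis
    by (simp add: lookup_add sum.distrib monomial_degree_eq[of ?A p] monomial_degree_eq[of ?A q])
qed

abbreviation series_mult :: "power_series \<Rightarrow> power_series \<Rightarrow> power_series" where
  "series_mult f g m \<equiv> \<Sum>(p, q) | p + q = m. f p * g q"

lemma series_mult_assoc: "series_mult (series_mult f g) h m = series_mult f (series_mult g h) m"
proof -
  have "series_mult (series_mult f g) h m =
      (\<Sum>z\<in>{(p, q). p + q = m}. \<Sum>w\<in>{(u, v). u + v = fst z}. f (fst w) * g (snd w) * h (snd z))"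
    by (simp add: case_prod_unfold sum_distrib_right)
  also have "\<dots> = (\<Sum>(z, w)\<in>(SIGMA z:{(p, q). p + q = m}. {(u, v). u + v = fst z}).
      f (fst w) * g (snd w) * h (snd z))"
    by (rule sum.Sigma) (auto simp: finite_add_pairs)
  also have "\<dots> = (\<Sum>(z, w)\<in>(SIGMA z:{(p, q). p + q = m}. {(u, v). u + v = snd z}).
      f (fst z) * (g (fst w) * h (snd w)))"
    by (rule sum.reindex_bij_witness[where
        j = "\<lambda>((p, q), (u, v)). ((u, v + q), (v, q))" and
        i = "\<lambda>((p, q), (u, v)). ((p + u, v), (p, u))"]) (auto simp: add.assoc mult.assoc)
  also have "\<dots> =
      (\<Sum>z\<in>{(p, q). p + q = m}. \<Sum>w\<in>{(u, v). u + v = snd z}. f (fst z) * (g (fst w) * h (snd w)))"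
    by (rule sum.Sigma[symmetric]) (auto simp: finite_add_pairs)
  also have "\<dots> = series_mult f (series_mult g h) m"
    by (simp add: case_prod_unfold sum_distrib_left)
  finally show ?thesis .
qed

lemma series_mult_commute: "series_mult f g m = series_mult g f m"
  by (rule sum.reindex_bij_witness[where j = prod.swap and i = prod.swap])
    (auto simp: add.commute mult.commute)

lemma series_mult_one: "series_mult (\<lambda>m. if m = 0 then 1 else 0) f m = f m"
proof -
  have "series_mult (\<lambda>m. if m = 0 then 1 else 0) f m = (\<Sum>(p, q)\<in>{(0 :: monomial, m)}. f m)"
    by (rule sum.mono_neutral_cong_right) (auto simp: finite_add_pairs split: if_splits)
  then show ?thesis
    by simp
qed

lemma series_mult_add: "series_mult (\<lambda>m. f m + g m) h m = series_mult f h m + series_mult g h m"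
  by (simp add: case_prod_unfold sum.distrib distrib_right)

lemma symmetric_series_mult:
  assumes "symmetric_series f" "symmetric_series g"
  shows "symmetric_series (series_mult f g)"
  unfolding symmetric_series_def
proof (intro allI impI)
  fix \<pi> :: "nat \<Rightarrow> nat" and m :: monomial
  assume \<pi>: "bij \<pi>"
  then have inj: "inj \<pi>" "inj (inv_into UNIV \<pi>)"
    by (auto simp: bij_is_inj bij_imp_bij_inv)
  have inv: "Poly_Mapping.map_key \<pi> (Poly_Mapping.map_key (inv_into UNIV \<pi>) p) = p"
    "Poly_Mapping.map_key (inv_into UNIV \<pi>) (Poly_Mapping.map_key \<pi> p) = p" for p :: monomial
    using \<pi> inj by (auto simp: poly_mapping_eq_iff map_key.rep_eq fun_eq_iff
        bij_is_inj bij_is_surj surj_f_inv_f)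
  show "series_mult f g (Poly_Mapping.map_key \<pi> m) = series_mult f g m"
  proof (rule sum.reindex_bij_witness[where
        i = "map_prod (Poly_Mapping.map_key \<pi>) (Poly_Mapping.map_key \<pi>)" and
        j = "map_prod (Poly_Mapping.map_key (inv_into UNIV \<pi>)) (Poly_Mapping.map_key (inv_into UNIV \<pi>))"], goal_cases)
    case (2 a)
    then show ?case
      using inv by (auto simp: map_key_plus[OF inj(2), symmetric])
  next
    case (4 b)
    then show ?case
      by (auto simp: map_key_plus[OF inj(1)])
  next
    case (5 a)
    have "f (Poly_Mapping.map_key (inv_into UNIV \<pi>) p) = f p"
      "g (Poly_Mapping.map_key (inv_into UNIV \<pi>) p) = g p" for p
      using assms \<pi> by (simp_all add: symmetric_series_def bij_imp_bij_inv)
    then show ?case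
      by (simp add: case_prod_unfold)
  qed (auto simp: inv)
qed

lemma bounded_degree_mult:
  assumes "bounded_degree f" "bounded_degree g"
  shows "bounded_degree (series_mult f g)"
proof -
  obtain d e where d: "\<And>m. f m \<noteq> 0 \<Longrightarrow> monomial_degree m \<le> d"
    and e: "\<And>m. g m \<noteq> 0 \<Longrightarrow> monomial_degree m \<le> e"
    using assms unfolding bounded_degree_def by blast
  have "monomial_degree m \<le> d + e" if nz: "series_mult f g m \<noteq> 0" for m
  proof -
    obtain z where "z \<in> {(p, q). p + q = m}" "(case z of (p, q) \<Rightarrow> f p * g q) \<noteq> 0"
      using nz by (rule sum.not_neutral_contains_not_neutral)
    then show ?thesis
      using d e by (auto simp: monomial_degree_add intro!: add_mono)
  qed
  then show ?thesis
    unfolding bounded_degree_def by blast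
qed

lemma bounded_degree_add:
  assumes "bounded_degree f" "bounded_degree g"
  shows "bounded_degree (\<lambda>m. f m + g m)"
proof -
  obtain d e where d: "\<And>m. f m \<noteq> 0 \<Longrightarrow> monomial_degree m \<le> d"
    and e: "\<And>m. g m \<noteq> 0 \<Longrightarrow> monomial_degree m \<le> e"
    using assms unfolding bounded_degree_def by blast
  have "monomial_degree m \<le> max d e" if "f m + g m \<noteq> 0" for m
    using that d[of m] e[of m] by (cases "f m = 0") (auto simp: max_def)
  then show ?thesis
    unfolding bounded_degree_def by blast
qed

lemma symmetric_series_one: "symmetric_series (\<lambda>m. if m = 0 then 1 else 0)"
proof -
  have "Poly_Mapping.map_key \<pi> m = 0 \<longleftrightarrow> m = 0" if "bij \<pi>" for \<pi> :: "nat \<Rightarrow> nat" and m :: monomial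
  proof -
    have "Poly_Mapping.lookup (Poly_Mapping.map_key \<pi> m) = Poly_Mapping.lookup m \<circ> \<pi>"
      using that by (simp add: map_key.rep_eq bij_is_inj)
    moreover have "(\<forall>k. Poly_Mapping.lookup m (\<pi> k) = 0) \<longleftrightarrow> (\<forall>k. Poly_Mapping.lookup m k = 0)"
      using that by (metis bij_is_surj surjD)
    ultimately show ?thesis
      by (simp add: poly_mapping_eq_iff fun_eq_iff)
  qed
  then show ?thesis
    by (simp add: symmetric_series_def)
qed

lemma Symm_cring: "cring Symm"
proof (rule cringI)
  show "abelian_group Symm"
  proof (rule abelian_groupI)
    fix f assume "f \<in> carrier Symm"
    then show "\<exists>g\<in>carrier Symm. g \<oplus>\<^bsub>Symm\<^esub> f = \<zero>\<^bsub>Symm\<^esub>"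
      by (intro bexI[of _ "\<lambda>m. - f m"])
        (auto simp: Symm_def symmetric_series_def bounded_degree_def)
  qed (simp_all add: Symm_def bounded_degree_add symmetric_series_def,
      simp_all add: bounded_degree_def ac_simps)
  show "Group.comm_monoid Symm"
  proof (rule comm_monoidI, goal_cases)
    case (1 f g)
    then show ?case
      by (simp add: Symm_def symmetric_series_mult bounded_degree_mult)
  next
    case 2
    show ?case
      by (auto simp: Symm_def symmetric_series_one bounded_degree_def)
  next
    case (3 f g h)
    then show ?case
      by (simp add: Symm_def, intro ext) (rule series_mult_assoc)
  next
    case (4 f)
    then show ?case
      by (simp add: Symm_def series_mult_one)
  next
    case (5 f g)
    then show ?case
      by (simp add: Symm_def, intro ext) (rule series_mult_commute)
  qed
qed (simp add: Symm_def series_mult_add)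

text \<open>
  A partition is the sequence of its parts (indexed from 0, padded with zeros), so that
  containment of Young diagrams is the pointwise order on \<^typ>\<open>nat \<Rightarrow> nat\<close>. The partition with
  list of parts \<open>xs\<close> is \<^term>\<open>nth_default 0 xs\<close>.
\<close>

definition is_partition :: "(nat \<Rightarrow> nat) \<Rightarrow> bool" where
  "is_partition \<nu> \<longleftrightarrow> antimono \<nu> \<and> finite {k. \<nu> k \<noteq> 0}"

abbreviation parts :: "nat list \<Rightarrow> nat \<Rightarrow> nat" where
  "parts \<equiv> nth_default 0"

definition rect :: "nat \<Rightarrow> nat \<Rightarrow> nat \<Rightarrow> nat" where
  "rect c d = parts (replicate d c)"

definition young_diagram :: "(nat \<Rightarrow> nat) \<Rightarrow> (nat \<times> nat) set" where
  "young_diagram \<nu> = {(p, q). q < \<nu> p}"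

text \<open>Tableaux are extensional so that fillings of the same diagram are not counted repeatedly.\<close>

definition ssyt :: "(nat \<Rightarrow> nat) \<Rightarrow> (nat \<times> nat \<Rightarrow> nat) set" where
  "ssyt \<nu> = {T \<in> extensional (young_diagram \<nu>).
     (\<forall>p q q'. q < q' \<and> (p, q') \<in> young_diagram \<nu> \<longrightarrow> T (p, q) \<le> T (p, q')) \<and>
     (\<forall>p p' q. p < p' \<and> (p', q) \<in> young_diagram \<nu> \<longrightarrow> T (p, q) < T (p', q))}"

text \<open>The coefficient of \<open>x\<^sup>m\<close> is the number of semistandard tableaux of content \<open>m\<close>.\<close>

definition schur :: "(nat \<Rightarrow> nat) \<Rightarrow> power_series" where
  "schur \<nu> m = int (card {T \<in> ssyt \<nu>.
     \<forall>k. card {c \<in> young_diagram \<nu>. T c = k} = Poly_Mapping.lookup m k})"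

definition int_span :: "('a, 'b) ring_scheme \<Rightarrow> 'a set \<Rightarrow> 'a set" where
  "int_span R S = generate (add_monoid R) S"

definition schur_ideal :: "nat \<Rightarrow> nat \<Rightarrow> power_series set" where
  "schur_ideal r s = int_span Symm {schur \<nu> |\<nu>. is_partition \<nu> \<and> \<not> \<nu> \<le> rect s r}"

definition grass_ring :: "nat \<Rightarrow> nat \<Rightarrow> power_series set ring" where
  "grass_ring r s = Symm Quot schur_ideal r s"

definition schur_class :: "nat \<Rightarrow> nat \<Rightarrow> (nat \<Rightarrow> nat) \<Rightarrow> power_series set" where
  "schur_class r s \<mu> = schur_ideal r s +>\<^bsub>Symm\<^esub> schur \<mu>"

definition schur_classes ::
    "nat \<Rightarrow> nat \<Rightarrow> (nat \<Rightarrow> nat) \<Rightarrow> (nat \<Rightarrow> nat) \<Rightarrow> power_series set set" where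
  "schur_classes r s \<alpha> \<beta> = {schur_class r s \<mu> |\<mu>. is_partition \<mu> \<and> \<alpha> \<le> \<mu> \<and> \<mu> \<le> \<beta>}"

definition rect_ideal :: "nat \<Rightarrow> nat \<Rightarrow> nat \<Rightarrow> nat \<Rightarrow> power_series set set" where
  "rect_ideal r s i j = int_span (grass_ring r s) (schur_classes r s (rect i j) (rect s r))"

end

theory Submission
  imports Defs "Jordan_Normal_Form.Determinant"
begin

text \<open>
  Let \<open>i\<^sup>j\<close> denote the rectangle. Peeling off last columns with the dual Pieri rule reduces any
  \<open>s\<^sub>\<mu>\<close> with \<open>i\<^sup>j \<subseteq> \<mu>\<close> to shapes \<open>(i\<^sup>j, \<beta>)\<close> with \<open>\<beta>\<close> of at most \<open>i\<close> columns and, modulo the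
  Schur functions outside the large rectangle, at most \<open>r - j\<close> rows. Write such an \<open>s\<close> as the
  \<open>r \<times> r\<close> Jacobi--Trudi determinant in the complete functions and expand it along its last
  \<open>r - j\<close> rows: the minors of the first \<open>j\<close> rows are themselves Schur functions
  \<open>s\<close> of \<open>i\<^sup>j + \<alpha>\<close> with \<open>\<alpha>\<^sub>1 \<le> r - j\<close>, and since the first \<open>j - i\<close> columns vanish in the
  lower rows, only \<open>\<alpha>\<close> with at most \<open>min i j\<close> rows occur. This is the first generating set.
  Conjugation of partitions preserves the Pieri rules and exchanges the two generating sets, so
  the second one needs no separate argument.
  The Pieri rule comes from the branching of tableaux and an exchange of
  horizontal strips; its dual and the Jacobi--Trudi formula are formal consequences of it.
\<close>

subsection \<open>Partitions and strips\<close>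

text \<open>The generator statement is proved for an arbitrary additive subgroup \<open>K\<close> of
  a commutative ring that absorbs Schur functions and contains the prescribed ones; only at the end
  is \<open>K\<close> taken to be the preimage of the generated ideal. Determinants and Pieri sums
  then live in a type of class \<open>comm_ring_1\<close>, here that of all power series, of which
  the symmetric functions form a subring. The two terms of the constant a have different origins:
  \<open>r - j\<close> is the room for \<open>j\<close> increasing column indices among
  \<open>r\<close>, which is why the Jacobi-Trudi matrix has size \<open>r\<close> even for shorter
  shapes, while \<open>n - r - i\<close> comes from discarding shapes that leave the large
  rectangle. That I and J are ideals takes more than the Pieri rule, which only handles
  multiplication by complete functions: Jacobi-Trudi extends it to all Schur functions, and
  unitriangularity of the Kostka numbers shows that these span the symmetric functions. Jacobi-Trudi
  also yields the symmetry of \<open>schur\<close>, in place of a content-permuting bijection on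
  tableaux.\<close>

definition psize :: "(nat \<Rightarrow> nat) \<Rightarrow> nat" where
  "psize \<nu> = sum \<nu> {k. \<nu> k \<noteq> 0}"

lemma psize_lessThan:
  assumes "\<And>k. k \<ge> N \<Longrightarrow> \<nu> k = 0"
  shows "psize \<nu> = sum \<nu> {..<N}"
proof -
  have "k < N" if "\<nu> k \<noteq> 0" for k
    using assms[of k] that by (cases "k < N") auto
  then show ?thesis
    unfolding psize_def by (intro sum.mono_neutral_left) auto
qed

lemma is_partition_antimono: "is_partition \<nu> \<Longrightarrow> p \<le> q \<Longrightarrow> \<nu> q \<le> \<nu> p"
  by (simp add: is_partition_def antimono_def)

lemma is_partition_Suc_le: "is_partition \<nu> \<Longrightarrow> \<nu> (Suc p) \<le> \<nu> p"
  by (simp add: is_partition_antimono)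

lemma is_partition_obtain_length:
  assumes "is_partition \<nu>"
  obtains N where "\<And>k. k \<ge> N \<Longrightarrow> \<nu> k = 0"
proof -
  have "finite {k. \<nu> k \<noteq> 0}"
    using assms by (simp add: is_partition_def)
  then obtain N where "\<forall>k\<in>{k. \<nu> k \<noteq> 0}. k < N"
    by (metis finite_nat_set_iff_bounded)
  then show ?thesis
    using that[of N] by force
qed

lemma is_partitionI:
  assumes "\<And>p. \<nu> (Suc p) \<le> \<nu> p" "\<And>k. k \<ge> N \<Longrightarrow> \<nu> k = 0"
  shows "is_partition \<nu>"
proof -
  have "k < N" if "\<nu> k \<noteq> 0" for k
    using assms(2)[of k] that by (cases "k < N") auto
  then have "{k. \<nu> k \<noteq> 0} \<subseteq> {..<N}"
    by auto
  then show ?thesis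
    using assms(1) by (auto simp: is_partition_def antimono_iff_le_Suc intro: finite_subset)
qed

lemma is_partition_le:
  assumes "is_partition \<nu>" "\<kappa> \<le> \<nu>" "\<And>p. \<kappa> (Suc p) \<le> \<kappa> p"
  shows "is_partition \<kappa>"
proof -
  obtain N where "\<And>k. k \<ge> N \<Longrightarrow> \<nu> k = 0"
    using is_partition_obtain_length[OF assms(1)] by blast
  then show ?thesis
    using assms(2,3) by (intro is_partitionI[of \<kappa> N]) (auto simp: le_fun_def, metis le_zero_eq)
qed

lemma part_le_psize:
  assumes "is_partition \<nu>"
  shows "\<nu> k \<le> psize \<nu>"
proof (cases "\<nu> k = 0")
  case False
  then show ?thesis
    using assms unfolding psize_def is_partition_def by (intro member_le_sum) auto
qed simp

lemma part_eq_0: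
  assumes "is_partition \<nu>" "psize \<nu> \<le> k"
  shows "\<nu> k = 0"
proof (rule ccontr)
  assume nz: "\<nu> k \<noteq> 0"
  have fin: "finite {k. \<nu> k \<noteq> 0}"
    using assms(1) by (simp add: is_partition_def)
  have ge: "1 \<le> \<nu> p" if "p \<le> k" for p
    using is_partition_antimono[OF assms(1) that] nz by linarith
  have "Suc k = sum (\<lambda>_. 1) {..k}"
    by simp
  also have "\<dots> \<le> sum \<nu> {..k}"
    using ge by (intro sum_mono) auto
  also have "\<dots> \<le> psize \<nu>"
    unfolding psize_def using ge by (intro sum_mono2[OF fin]) force+
  finally show False
    using assms(2) by simp
qed

lemma psize_mono:
  assumes "is_partition \<nu>" "\<kappa> \<le> \<nu>"
  shows "psize \<kappa> \<le> psize \<nu>"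
proof -
  obtain N where N: "\<And>k. k \<ge> N \<Longrightarrow> \<nu> k = 0"
    using is_partition_obtain_length[OF assms(1)] by blast
  then have "\<And>k. k \<ge> N \<Longrightarrow> \<kappa> k = 0"
    using assms(2) by (metis le_fun_def le_zero_eq)
  then show ?thesis
    using N assms(2) by (simp add: psize_lessThan[of N] sum_mono le_funD)
qed

lemma psize_eqD:
  assumes "is_partition \<nu>" "\<kappa> \<le> \<nu>" "psize \<nu> \<le> psize \<kappa>"
  shows "\<kappa> = \<nu>"
proof
  fix p
  obtain N where N: "\<And>k. k \<ge> N \<Longrightarrow> \<nu> k = 0"
    using is_partition_obtain_length[OF assms(1)] by blast
  then have N': "\<And>k. k \<ge> N \<Longrightarrow> \<kappa> k = 0"
    using assms(2) by (metis le_fun_def le_zero_eq)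
  have "sum \<kappa> {..<N} = sum \<nu> {..<N}"
    using psize_mono[OF assms(1,2)] assms(3) N N' by (simp add: psize_lessThan[of N])
  then have "p < N \<Longrightarrow> \<kappa> p = \<nu> p"
    using sum_mono_inv[of \<kappa> "{..<N}" \<nu> p] assms(2) by (simp add: le_fun_def)
  then show "\<kappa> p = \<nu> p"
    using N N' by (cases "p < N") auto
qed

lemma finite_partitions_le: "finite {\<nu>. is_partition \<nu> \<and> psize \<nu> \<le> n}"
proof -
  have "\<nu> x \<le> n \<and> (n \<le> x \<longrightarrow> \<nu> x = 0)" if "is_partition \<nu>" "psize \<nu> \<le> n" for \<nu> x
    using that part_le_psize[of \<nu> x] part_eq_0[of \<nu> x] by auto
  then have "{\<nu>. is_partition \<nu> \<and> psize \<nu> \<le> n} \<subseteq>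
      {f. \<forall>x. (x \<in> {..<n} \<longrightarrow> f x \<in> {..n}) \<and> (x \<notin> {..<n} \<longrightarrow> f x = 0)}"
    by auto
  then show ?thesis
    by (rule finite_subset) (rule finite_set_of_finite_funs; simp)
qed

lemma is_partition_zero [simp]: "is_partition (\<lambda>_. 0)"
  by (simp add: is_partition_def antimono_def)

lemma psize_zero [simp]: "psize (\<lambda>_. 0) = 0"
  by (simp add: psize_def)

lemma psize_eq_0_iff: "is_partition \<nu> \<Longrightarrow> psize \<nu> = 0 \<longleftrightarrow> \<nu> = (\<lambda>_. 0)"
  by (metis ext le_zero_eq part_eq_0 psize_zero zero_le)

definition row_part :: "nat \<Rightarrow> nat \<Rightarrow> nat" where
  "row_part k = (\<lambda>p. if p = 0 then k else 0)"

definition col_part :: "nat \<Rightarrow> nat \<Rightarrow> nat" where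
  "col_part k = (\<lambda>p. if p < k then 1 else 0)"

lemma is_partition_row [simp]: "is_partition (row_part k)"
  by (rule is_partitionI[of _ 1]) (auto simp: row_part_def)

lemma is_partition_col [simp]: "is_partition (col_part k)"
  by (rule is_partitionI[of _ k]) (auto simp: col_part_def)

lemma psize_row [simp]: "psize (row_part k) = k"
  by (simp add: psize_lessThan[of 1] row_part_def)

lemma psize_col [simp]: "psize (col_part k) = k"
  by (simp add: psize_lessThan[of k] col_part_def)

lemma row_part_0: "row_part 0 = (\<lambda>_. 0)"
  by (auto simp: row_part_def)

text \<open>Horizontal strips as interlacing: \<open>\<nu> (Suc p) \<le> \<kappa> p\<close> forbids
  two new boxes in one column.\<close>

definition hstrip :: "(nat \<Rightarrow> nat) \<Rightarrow> (nat \<Rightarrow> nat) \<Rightarrow> bool" where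
  "hstrip \<kappa> \<nu> \<longleftrightarrow> is_partition \<kappa> \<and> is_partition \<nu> \<and> (\<forall>p. \<kappa> p \<le> \<nu> p \<and> \<nu> (Suc p) \<le> \<kappa> p)"

definition vstrip :: "(nat \<Rightarrow> nat) \<Rightarrow> (nat \<Rightarrow> nat) \<Rightarrow> bool" where
  "vstrip \<kappa> \<nu> \<longleftrightarrow> is_partition \<kappa> \<and> is_partition \<nu> \<and> (\<forall>p. \<kappa> p \<le> \<nu> p \<and> \<nu> p \<le> Suc (\<kappa> p))"

lemma hstripD:
  assumes "hstrip \<kappa> \<nu>"
  shows "is_partition \<kappa>" "is_partition \<nu>" "\<kappa> p \<le> \<nu> p" "\<nu> (Suc p) \<le> \<kappa> p" "\<kappa> \<le> \<nu>" "psize \<kappa> \<le> psize \<nu>"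
  using assms psize_mono[of \<nu> \<kappa>] by (auto simp: hstrip_def le_fun_def)

lemma vstripD:
  assumes "vstrip \<kappa> \<nu>"
  shows "is_partition \<kappa>" "is_partition \<nu>" "\<kappa> p \<le> \<nu> p" "\<nu> p \<le> Suc (\<kappa> p)" "\<kappa> \<le> \<nu>" "psize \<kappa> \<le> psize \<nu>"
  using assms psize_mono[of \<nu> \<kappa>] by (auto simp: vstrip_def le_fun_def)

lemma finite_hstrips_above [simp]: "finite {\<nu>. hstrip \<kappa> \<nu> \<and> psize \<nu> = n}"
  by (rule finite_subset[OF _ finite_partitions_le[of n]]) (auto dest: hstripD)

lemma finite_hstrips_below [simp]: "finite {\<kappa>. hstrip \<kappa> \<nu> \<and> P \<kappa>}"
  by (rule finite_subset[OF _ finite_partitions_le[of "psize \<nu>"]]) (auto dest: hstripD)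

subsection \<open>Exchange of horizontal strips\<close>

text \<open>Summing the last identity over all rows recovers the sizes because
  \<open>min x y + max x y = x + y\<close>; row 0 of \<open>\<nu>\<close> is not covered by it and
  carries the surplus \<open>d\<close>.\<close>

lemma psize_exchange:
  assumes "is_partition \<rho>" "is_partition \<mu>" "is_partition \<nu>" "is_partition \<kappa>"
    and "\<nu> 0 = max (\<rho> 0) (\<mu> 0) + d"
    and "\<And>p. \<kappa> p + \<nu> (Suc p) = min (\<rho> p) (\<mu> p) + max (\<rho> (Suc p)) (\<mu> (Suc p))"
  shows "psize \<kappa> + psize \<nu> = psize \<rho> + psize \<mu> + d"
proof -
  obtain N1 N2 N3 N4 where N: "\<And>k. k \<ge> N1 \<Longrightarrow> \<rho> k = 0" "\<And>k. k \<ge> N2 \<Longrightarrow> \<mu> k = 0"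
    "\<And>k. k \<ge> N3 \<Longrightarrow> \<nu> k = 0" "\<And>k. k \<ge> N4 \<Longrightarrow> \<kappa> k = 0"
    using assms(1-4) is_partition_obtain_length by metis
  define N where "N = N1 + N2 + N3 + N4"
  have size: "psize \<rho> = sum \<rho> {..<Suc N}" "psize \<mu> = sum \<mu> {..<Suc N}" "psize \<nu> = sum \<nu> {..<Suc N}"
    "psize \<kappa> = sum \<kappa> {..<N}"
    using N by (auto intro!: psize_lessThan simp: N_def)
  have "psize \<kappa> + psize \<nu> = \<nu> 0 + (\<Sum>p<N. \<kappa> p + \<nu> (Suc p))"
    by (simp add: size sum.lessThan_Suc_shift sum.distrib del: sum.lessThan_Suc)
  also have "\<dots> = d + ((\<Sum>p<N. min (\<rho> p) (\<mu> p)) + (\<Sum>p<Suc N. max (\<rho> p) (\<mu> p)))"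
    by (simp add: assms(5,6) sum.lessThan_Suc_shift sum.distrib del: sum.lessThan_Suc)
  also have "(\<Sum>p<N. min (\<rho> p) (\<mu> p)) = (\<Sum>p<Suc N. min (\<rho> p) (\<mu> p))"
    using N by (simp add: N_def)
  also have "\<dots> + (\<Sum>p<Suc N. max (\<rho> p) (\<mu> p)) = (\<Sum>p<Suc N. \<rho> p + \<mu> p)"
    unfolding sum.distrib[symmetric] by (intro sum.cong) (auto simp: min_def max_def)
  finally show ?thesis
    by (simp add: size sum.distrib)
qed

text \<open>In operator terms, removing a strip of size \<open>c\<close> after adding one of size
  \<open>k\<close> equals the sum over \<open>d\<close> of adding \<open>k - d\<close> after
  removing \<open>c - d\<close>. For fixed \<open>\<rho>\<close> and \<open>\<mu>\<close>, both
  \<open>\<kappa> p\<close> and \<open>\<nu> (Suc p)\<close> range over the interval from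
  \<open>max (\<rho> (Suc p)) (\<mu> (Suc p))\<close> to \<open>min (\<rho> p) (\<mu> p)\<close>;
  reflecting each interval matches the two sides, and \<open>d\<close> records the free excess of
  \<open>\<nu> 0\<close>.\<close>

lemma hstrip_exchange_sum:
  fixes f :: "(nat \<Rightarrow> nat) \<Rightarrow> 'a::comm_monoid_add"
  assumes \<rho>: "is_partition \<rho>"
  shows "(\<Sum>\<nu> | hstrip \<rho> \<nu> \<and> psize \<nu> = psize \<rho> + k. \<Sum>\<mu> | hstrip \<mu> \<nu> \<and> psize \<nu> = psize \<mu> + c. f \<mu>) =
    (\<Sum>d\<le>min k c. \<Sum>\<kappa> | hstrip \<kappa> \<rho> \<and> psize \<rho> = psize \<kappa> + (c - d).
      \<Sum>\<mu> | hstrip \<kappa> \<mu> \<and> psize \<mu> = psize \<kappa> + (k - d). f \<mu>)"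
proof -
  let ?A = "SIGMA \<nu>:{\<nu>. hstrip \<rho> \<nu> \<and> psize \<nu> = psize \<rho> + k}. {\<mu>. hstrip \<mu> \<nu> \<and> psize \<nu> = psize \<mu> + c}"
  let ?B = "SIGMA z:(SIGMA d:{..min k c}. {\<kappa>. hstrip \<kappa> \<rho> \<and> psize \<rho> = psize \<kappa> + (c - d)}).
    {\<mu>. hstrip (snd z) \<mu> \<and> psize \<mu> = psize (snd z) + (k - fst z)}"
  let ?low = "\<lambda>\<nu> \<mu> p. min (\<rho> p) (\<mu> p) + max (\<rho> (Suc p)) (\<mu> (Suc p)) - \<nu> (Suc p)"
  let ?up = "\<lambda>d \<kappa> \<mu> p. case p of 0 \<Rightarrow> max (\<rho> 0) (\<mu> 0) + d
    | Suc q \<Rightarrow> min (\<rho> q) (\<mu> q) + max (\<rho> (Suc q)) (\<mu> (Suc q)) - \<kappa> q"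
  have down: "?low \<nu> \<mu> p + \<nu> (Suc p) = min (\<rho> p) (\<mu> p) + max (\<rho> (Suc p)) (\<mu> (Suc p))"
    "max (\<rho> 0) (\<mu> 0) \<le> \<nu> 0"
    "hstrip (?low \<nu> \<mu>) \<rho>" "hstrip (?low \<nu> \<mu>) \<mu>"
    "psize (?low \<nu> \<mu>) + psize \<nu> = psize \<rho> + psize \<mu> + (\<nu> 0 - max (\<rho> 0) (\<mu> 0))"
    if "hstrip \<rho> \<nu>" "hstrip \<mu> \<nu>" for \<nu> \<mu> p
  proof -
    have b: "\<nu> (Suc p) \<le> min (\<rho> p) (\<mu> p)" "max (\<rho> p) (\<mu> p) \<le> \<nu> p" for p
      using hstripD(3,4)[OF that(1), of p] hstripD(3,4)[OF that(2), of p] by auto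
    show id: "?low \<nu> \<mu> p + \<nu> (Suc p) = min (\<rho> p) (\<mu> p) + max (\<rho> (Suc p)) (\<mu> (Suc p))" for p
      using b(1)[of p] by linarith
    show b0: "max (\<rho> 0) (\<mu> 0) \<le> \<nu> 0"
      by (rule b(2))
    have c: "?low \<nu> \<mu> p \<le> min (\<rho> p) (\<mu> p)" "max (\<rho> (Suc p)) (\<mu> (Suc p)) \<le> ?low \<nu> \<mu> p" for p
      using b(2)[of "Suc p"] b(1)[of p] by linarith+
    have part: "is_partition (?low \<nu> \<mu>)"
    proof (rule is_partition_le[OF \<rho>])
      show "?low \<nu> \<mu> \<le> \<rho>"
        using c(1) by (auto simp: le_fun_def)
      show "?low \<nu> \<mu> (Suc p) \<le> ?low \<nu> \<mu> p" for p
        using c(1)[of "Suc p"] c(2)[of p] by linarith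
    qed
    show "hstrip (?low \<nu> \<mu>) \<rho>" "hstrip (?low \<nu> \<mu>) \<mu>"
      using c part \<rho> hstripD(1)[OF that(2)] unfolding hstrip_def by auto
    show "psize (?low \<nu> \<mu>) + psize \<nu> = psize \<rho> + psize \<mu> + (\<nu> 0 - max (\<rho> 0) (\<mu> 0))"
      by (rule psize_exchange) (use part \<rho> hstripD(1,2)[OF that(2)] id b0 in auto)
  qed
  have up: "\<kappa> p + ?up d \<kappa> \<mu> (Suc p) = min (\<rho> p) (\<mu> p) + max (\<rho> (Suc p)) (\<mu> (Suc p))"
    "hstrip \<rho> (?up d \<kappa> \<mu>)" "hstrip \<mu> (?up d \<kappa> \<mu>)"
    "psize \<kappa> + psize (?up d \<kappa> \<mu>) = psize \<rho> + psize \<mu> + d"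
    if "hstrip \<kappa> \<rho>" "hstrip \<kappa> \<mu>" for \<kappa> \<mu> d p
  proof -
    have b: "\<kappa> p \<le> min (\<rho> p) (\<mu> p)" "max (\<rho> (Suc p)) (\<mu> (Suc p)) \<le> \<kappa> p" for p
      using hstripD(3,4)[OF that(1), of p] hstripD(3,4)[OF that(2), of p] by auto
    show id: "\<kappa> p + ?up d \<kappa> \<mu> (Suc p) = min (\<rho> p) (\<mu> p) + max (\<rho> (Suc p)) (\<mu> (Suc p))" for p
      using le_trans[OF b(1)[of p] le_add1] by (simp only: nat.case le_add_diff_inverse)
    have c: "?up d \<kappa> \<mu> (Suc p) \<le> min (\<rho> p) (\<mu> p)" "max (\<rho> p) (\<mu> p) \<le> ?up d \<kappa> \<mu> p" for p
      using b(2)[of p] b(1)[of "p - 1"] by (auto split: nat.split)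
    obtain N where N: "\<And>k. k \<ge> N \<Longrightarrow> \<rho> k = 0"
      using is_partition_obtain_length[OF \<rho>] by blast
    have part: "is_partition (?up d \<kappa> \<mu>)"
    proof (rule is_partitionI[of _ "Suc N"])
      show "?up d \<kappa> \<mu> (Suc p) \<le> ?up d \<kappa> \<mu> p" for p
        using c(1)[of p] c(2)[of p] by linarith
      show "?up d \<kappa> \<mu> k = 0" if "k \<ge> Suc N" for k
        using that c(1)[of "k - 1"] N[of "k - 1"] by (cases k) auto
    qed
    show "hstrip \<rho> (?up d \<kappa> \<mu>)" "hstrip \<mu> (?up d \<kappa> \<mu>)"
      using c part \<rho> hstripD(2)[OF that(2)] unfolding hstrip_def by auto
    show "psize \<kappa> + psize (?up d \<kappa> \<mu>) = psize \<rho> + psize \<mu> + d"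
      by (rule psize_exchange) (use part \<rho> hstripD(1,2)[OF that(2)] id in auto)
  qed
  have "(\<Sum>\<nu> | hstrip \<rho> \<nu> \<and> psize \<nu> = psize \<rho> + k. \<Sum>\<mu> | hstrip \<mu> \<nu> \<and> psize \<nu> = psize \<mu> + c. f \<mu>) =
      (\<Sum>(\<nu>, \<mu>)\<in>?A. f \<mu>)"
    by (subst sum.Sigma) auto
  also have "\<dots> = (\<Sum>(z, \<mu>)\<in>?B. f \<mu>)"
  proof (rule sum.reindex_bij_witness[where
      j = "\<lambda>z. ((fst z 0 - max (\<rho> 0) (snd z 0), ?low (fst z) (snd z)), snd z)" and
      i = "\<lambda>z. (?up (fst (fst z)) (snd (fst z)) (snd z), snd z)"], goal_cases)
    case (1 z)
    then obtain \<nu> \<mu> where z: "z = (\<nu>, \<mu>)" "hstrip \<rho> \<nu>" "hstrip \<mu> \<nu>"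
      by auto
    have "?up (\<nu> 0 - max (\<rho> 0) (\<mu> 0)) (?low \<nu> \<mu>) \<mu> p = \<nu> p" for p
    proof (cases p)
      case 0
      then show ?thesis
        using down(2)[OF z(2,3)] by (simp only: nat.case le_add_diff_inverse)
    next
      case (Suc q)
      have "a + b = c \<Longrightarrow> c - a = b" for a b c :: nat
        by simp
      then show ?thesis
        unfolding Suc nat.case by this (rule down(1)[OF z(2,3)])
    qed
    then show ?case
      unfolding z fst_conv snd_conv by blast
  next
    case (2 z)
    then obtain \<nu> \<mu> where z: "z = (\<nu>, \<mu>)" "hstrip \<rho> \<nu>" "hstrip \<mu> \<nu>"
      and sz: "psize \<nu> = psize \<rho> + k" "psize \<nu> = psize \<mu> + c"
      by auto
    note d = down(3,4,5)[OF z(2,3)]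
    \<comment> \<open>With \<open>\<kappa>\<close> for the lower shape and \<open>d\<close> for the
      excess in row 0, the size identity reads \<open>psize \<kappa> + k = psize \<mu> + d\<close>
      and \<open>psize \<kappa> + c = psize \<rho> + d\<close>. As \<open>\<kappa>\<close> lies in
      both shapes, \<open>d\<close> is at most \<open>k\<close> and \<open>c\<close>, so no
      subtraction truncates.\<close>
    have "\<nu> 0 - max (\<rho> 0) (\<mu> 0) \<le> min k c" "psize \<rho> = psize (?low \<nu> \<mu>) + (c - (\<nu> 0 - max (\<rho> 0) (\<mu> 0)))"
       "psize \<mu> = psize (?low \<nu> \<mu>) + (k - (\<nu> 0 - max (\<rho> 0) (\<mu> 0)))"
      using d(3) hstripD(6)[OF d(1)] hstripD(6)[OF d(2)] sz
      unfolding min.bounded_iff by linarith+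
    then show ?case
      using d(1,2) unfolding z by simp
  next
    case (3 z)
    then obtain d \<kappa> \<mu> where z: "z = ((d, \<kappa>), \<mu>)" "hstrip \<kappa> \<rho>" "hstrip \<kappa> \<mu>"
      by auto
    have "a + b = c \<Longrightarrow> c - b = a" for a b c :: nat
      by simp
    then have "?low (?up d \<kappa> \<mu>) \<mu> p = \<kappa> p" for p
      by this (rule up(1)[OF z(2,3)])
    moreover have "?up d \<kappa> \<mu> 0 - max (\<rho> 0) (\<mu> 0) = d"
      by simp
    ultimately show ?case
      unfolding z fst_conv snd_conv by blast
  next
    case (4 z)
    then obtain d \<kappa> \<mu> where z: "z = ((d, \<kappa>), \<mu>)" "hstrip \<kappa> \<rho>" "hstrip \<kappa> \<mu>"
      and sz: "d \<le> k" "d \<le> c" "psize \<rho> = psize \<kappa> + (c - d)" "psize \<mu> = psize \<kappa> + (k - d)"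
      by auto
    note u = up(2,3,4)[OF z(2,3), of d]
    have "psize (?up d \<kappa> \<mu>) = psize \<rho> + k" "psize (?up d \<kappa> \<mu>) = psize \<mu> + c"
      using u(3) sz by linarith+
    then show ?case
      using u(1,2) unfolding z by simp
  qed (simp add: case_prod_unfold)
  also have "\<dots> = (\<Sum>z\<in>(SIGMA d:{..min k c}. {\<kappa>. hstrip \<kappa> \<rho> \<and> psize \<rho> = psize \<kappa> + (c - d)}).
      \<Sum>\<mu> | hstrip (snd z) \<mu> \<and> psize \<mu> = psize (snd z) + (k - fst z). f \<mu>)"
    by (rule sum.Sigma[symmetric]) auto
  also have "\<dots> = (\<Sum>d\<le>min k c. \<Sum>\<kappa> | hstrip \<kappa> \<rho> \<and> psize \<rho> = psize \<kappa> + (c - d).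
      \<Sum>\<mu> | hstrip \<kappa> \<mu> \<and> psize \<mu> = psize \<kappa> + (k - d). f \<mu>)"
    by (subst sum.Sigma) (auto simp: case_prod_unfold)
  finally show ?thesis .
qed

subsection \<open>Determinants\<close>

text \<open>Entries are a function on all of \<open>nat\<close>, so minors and shifted columns are
  mere substitutions in the column index.\<close>

definition dt :: "nat \<Rightarrow> (nat \<Rightarrow> nat \<Rightarrow> 'a::comm_ring_1) \<Rightarrow> 'a" where
  "dt n F = det (mat n n (\<lambda>(p, q). F p q))"

lemma permutes_lt_iff: "w permutes {0..<n} \<Longrightarrow> w p < n \<longleftrightarrow> p < (n :: nat)"
  using permutes_in_image[of w "{0..<n}" p] by simp

lemma dt_leibniz:
  "dt n F = (\<Sum>w | w permutes {0..<n}. signof w * (\<Prod>p = 0..<n. F p (w p)))"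
  unfolding dt_def
  by (subst det_def'[of _ n])
    (auto intro!: sum.cong prod.cong simp: permutes_lt_iff)

lemma dt_cong:
  assumes "\<And>p q. p < n \<Longrightarrow> q < n \<Longrightarrow> F p q = G p q"
  shows "dt n F = dt n G"
  unfolding dt_def by (rule arg_cong[of _ _ det]) (auto simp: assms)

lemma dt_0 [simp]: "dt 0 F = 1"
  by (simp add: dt_leibniz)

lemma dt_identical_rows:
  assumes "p < n" "p' < n" "p \<noteq> p'" "\<And>q. q < n \<Longrightarrow> F p q = F p' q"
  shows "dt n F = 0"
  unfolding dt_def by (rule det_identical_rows[of _ n p p']) (use assms in auto)

lemma dt_identical_columns:
  assumes "p < n" "p' < n" "p \<noteq> p'" "\<And>q. q < n \<Longrightarrow> F q p = F q p'"
  shows "dt n F = 0"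
  unfolding dt_def by (rule det_identical_columns[of _ n p p']) (use assms in auto)

lemma dt_transpose: "dt n (\<lambda>p q. F q p) = dt n F"
proof -
  have "dt n (\<lambda>p q. F q p) = det (transpose_mat (mat n n (\<lambda>(p, q). F p q)))"
    unfolding dt_def by (rule arg_cong[of _ _ det]) auto
  then show ?thesis
    by (simp add: dt_def det_transpose[of _ n])
qed

lemma dt_permute_rows:
  assumes "w permutes {0..<n}"
  shows "dt n (\<lambda>p q. F (w p) q) = signof w * dt n F"
proof -
  have "dt n (\<lambda>p q. F (w p) q) = det (mat n n (\<lambda>(p, q). mat n n (\<lambda>(p, q). F p q) $$ (w p, q)))"
    unfolding dt_def by (rule arg_cong[of _ _ det]) (use assms in \<open>auto simp: permutes_lt_iff\<close>)
  then show ?thesis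
    using assms by (simp add: dt_def det_permute_rows[of _ n])
qed

text \<open>Rows and columns are permuted by the same reversal, so its sign enters squared.\<close>

lemma dt_reverse: "dt n (\<lambda>p q. F (n - Suc p) (n - Suc q)) = dt n F"
proof -
  define w where "w = (\<lambda>p. if p < n then n - Suc p else p)"
  have w: "w permutes {0..<n}"
    by (rule bij_imp_permutes, rule bij_betw_byWitness[of _ w]) (auto simp: w_def)
  have "dt n (\<lambda>p q. F (n - Suc p) (n - Suc q)) = dt n (\<lambda>p q. F (w p) (w q))"
    by (rule dt_cong) (simp add: w_def)
  also have "\<dots> = signof w * dt n (\<lambda>p q. F p (w q))"
    by (rule dt_permute_rows[OF w])
  also have "dt n (\<lambda>p q. F p (w q)) = dt n (\<lambda>p q. F q (w p))"
    by (rule dt_transpose[symmetric])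
  also have "\<dots> = signof w * dt n (\<lambda>p q. F q p)"
    by (rule dt_permute_rows[OF w])
  also have "dt n (\<lambda>p q. F q p) = dt n F"
    by (rule dt_transpose)
  finally show ?thesis
    by (simp add: sign_def)
qed

lemma dt_Suc:
  "dt (Suc n) F =
    (\<Sum>c<Suc n. F n c * ((-1) ^ (n + c) * dt n (\<lambda>p q. F p (if q < c then q else Suc q))))"
proof -
  have "dt (Suc n) F = (\<Sum>c<Suc n. F n c * cofactor (mat (Suc n) (Suc n) (\<lambda>(p, q). F p q)) n c)"
    unfolding dt_def by (subst laplace_expansion_row[of _ "Suc n" n]) auto
  moreover have "mat_delete (mat (Suc n) (Suc n) (\<lambda>(p, q). F p q)) n c =
      mat n n (\<lambda>(p, q). F p (if q < c then q else Suc q))" for c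
    by (auto simp: mat_delete_def)
  ultimately show ?thesis
    by (simp add: cofactor_def dt_def)
qed

lemma up_closed_eq_interval:
  fixes U :: "nat set"
  assumes "U \<subseteq> {..<n}" "\<And>q. q \<in> U \<Longrightarrow> Suc q < n \<Longrightarrow> Suc q \<in> U"
  shows "U = {n - card U..<n}"
proof (cases "U = {}")
  case False
  have fin: "finite U"
    using assms(1) by (rule finite_subset) simp
  define u where "u = Min U"
  have u: "u \<in> U" "\<And>q. q \<in> U \<Longrightarrow> u \<le> q"
    using fin False by (auto simp: u_def)
  have "q < n \<Longrightarrow> q \<in> U" if "u \<le> q" for q
    using that by (induction q rule: dec_induct) (auto intro: u assms(2))
  then have U: "U = {u..<n}"
    using u assms(1) by auto
  moreover have "u < n"
    using u assms(1) by auto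
  ultimately have "n - card U = u"
    by simp
  then show ?thesis
    using U by simp
qed simp

text \<open>In the Leibniz term of \<open>w\<close>, shifting the rows in \<open>T\<close> is the
  same as shifting the columns in the image of \<open>T\<close>, so the sum over row shifts is a sum
  over column shifts. A set of shifted columns that is not a final segment produces two equal
  columns; the final segment leaves the minor that omits column \<open>n - t\<close>.\<close>

lemma dt_shift_rows:
  assumes "t \<le> n"
  shows "(\<Sum>T | T \<subseteq> {..<n} \<and> card T = t. dt n (\<lambda>p q. F p (q + of_bool (p \<in> T)))) =
    dt n (\<lambda>p q. F p (if q < n - t then q else Suc q))"
proof -
  let ?P = "{T. T \<subseteq> {..<n} \<and> card T = t}"
  let ?w = "{w. w permutes {0..<n}}"
  have fin: "finite ?P"
    by (rule finite_subset[of _ "Pow {..<n}"]) auto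
  have "(\<Sum>T\<in>?P. \<Prod>p = 0..<n. F p (w p + of_bool (p \<in> T))) =
      (\<Sum>U\<in>?P. \<Prod>p = 0..<n. F p (w p + of_bool (w p \<in> U)))" if "w \<in> ?w" for w
  proof (rule sum.reindex_bij_witness[where j = "image w" and i = "image (inv_into UNIV w)"])
    have w: "w permutes {0..<n}" "inj w" "bij w"
      using that permutes_bij[of w] by (auto simp: bij_is_inj)
    have v: "inv_into UNIV w permutes {0..<n}"
      using w permutes_inv by blast
    show "inv_into UNIV w ` w ` T = T" for T
      using w by (simp add: image_comp)
    show "w ` inv_into UNIV w ` U = U" for U
      using w by (simp add: image_comp bij_is_surj surj_iff[symmetric])
    show "w ` T \<in> ?P" if "T \<in> ?P" for T
      using that w by (auto simp: card_image permutes_lt_iff inj_on_subset[OF w(2)])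
    show "inv_into UNIV w ` U \<in> ?P" if "U \<in> ?P" for U
      using that v permutes_inj[OF v] by (auto simp: card_image permutes_lt_iff inj_on_subset)
    show "(\<Prod>p = 0..<n. F p (w p + of_bool (w p \<in> w ` T))) =
        (\<Prod>p = 0..<n. F p (w p + of_bool (p \<in> T)))" for T
      using w by (simp add: inj_image_mem_iff)
  qed
  then have "(\<Sum>w\<in>?w. signof w * (\<Sum>T\<in>?P. \<Prod>p = 0..<n. F p (w p + of_bool (p \<in> T)))) =
      (\<Sum>w\<in>?w. signof w * (\<Sum>U\<in>?P. \<Prod>p = 0..<n. F p (w p + of_bool (w p \<in> U))))"
    by (intro sum.cong) auto
  then have "(\<Sum>T\<in>?P. dt n (\<lambda>p q. F p (q + of_bool (p \<in> T)))) =
      (\<Sum>U\<in>?P. dt n (\<lambda>p q. F p (q + of_bool (q \<in> U))))"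
    unfolding dt_leibniz sum.swap[of _ _ ?P] sum_distrib_left[symmetric] .
  also have "\<dots> = (\<Sum>U\<in>{{n - t..<n}}. dt n (\<lambda>p q. F p (q + of_bool (q \<in> U))))"
  proof (rule sum.mono_neutral_right[OF fin])
    show "{{n - t..<n}} \<subseteq> ?P"
      using assms by auto
    show "\<forall>U\<in>?P - {{n - t..<n}}. dt n (\<lambda>p q. F p (q + of_bool (q \<in> U))) = 0"
    proof
      fix U assume "U \<in> ?P - {{n - t..<n}}"
      then obtain q where "q \<in> U" "Suc q < n" "Suc q \<notin> U"
        using up_closed_eq_interval[of U n] by blast
      \<comment> \<open>Column \<open>q\<close> moves onto column \<open>Suc q\<close>, which stays
        in place.\<close>
      then show "dt n (\<lambda>p q. F p (q + of_bool (q \<in> U))) = 0"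
        by (intro dt_identical_columns[of q n "Suc q"]) auto
    qed
  qed
  also have "\<dots> = dt n (\<lambda>p q. F p (if q < n - t then q else Suc q))"
    by (simp, rule dt_cong) auto
  finally show ?thesis .
qed

subsection \<open>Signed sums of strips\<close>

lemma psize_fun_upd:
  assumes "is_partition \<kappa>"
  shows "psize (\<kappa>(p := x)) + \<kappa> p = psize \<kappa> + x"
proof -
  obtain N where N: "\<And>k. k \<ge> N \<Longrightarrow> \<kappa> k = 0"
    using is_partition_obtain_length[OF assms] by blast
  define M where "M = N + Suc p"
  have "psize (\<kappa>(p := x)) = sum (\<kappa>(p := x)) {..<M}" "psize \<kappa> = sum \<kappa> {..<M}"
    by (rule psize_lessThan; use N in \<open>simp add: M_def\<close>)+
  moreover have "sum f {..<M} = f p + sum f ({..<M} - {p})" for f :: "nat \<Rightarrow> nat"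
    by (rule sum.remove) (auto simp: M_def)
  ultimately show ?thesis
    by (simp add: sum.cong[of "{..<M} - {p}" _ "\<kappa>(p := x)" \<kappa>])
qed

text \<open>Vertical strips confined to the first \<open>N\<close> rows are those that occur when a
  row is attached in position \<open>N\<close>; the confinement also keeps their number
  finite.\<close>

definition vstrips :: "nat \<Rightarrow> (nat \<Rightarrow> nat) \<Rightarrow> (nat \<Rightarrow> nat) set" where
  "vstrips N \<rho> = {\<kappa>. vstrip \<rho> \<kappa> \<and> (\<forall>p\<ge>N. \<kappa> p = \<rho> p)}"

abbreviation add_col :: "(nat \<Rightarrow> nat) \<Rightarrow> nat set \<Rightarrow> nat \<Rightarrow> nat" where
  "add_col \<rho> T \<equiv> \<lambda>p. \<rho> p + of_bool (p \<in> T)"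

lemma vstrips_eq_image:
  assumes "is_partition \<rho>"
  shows "vstrips N \<rho> = add_col \<rho> ` {T. T \<subseteq> {..<N} \<and> is_partition (add_col \<rho> T)}"
proof (intro Set.set_eqI iffI)
  fix \<kappa> assume k: "\<kappa> \<in> vstrips N \<rho>"
  define T where "T = {p. \<kappa> p \<noteq> \<rho> p}"
  have b: "\<rho> p \<le> \<kappa> p" "\<kappa> p \<le> Suc (\<rho> p)" for p
    using k by (auto simp: vstrips_def vstrip_def)
  have "add_col \<rho> T p = \<kappa> p" for p
    using b[of p] by (auto simp: T_def)
  then have "\<kappa> = add_col \<rho> T"
    by auto
  moreover have "T \<subseteq> {..<N}"
    using k by (auto simp: T_def vstrips_def not_le[symmetric])
  ultimately show "\<kappa> \<in> add_col \<rho> ` {T. T \<subseteq> {..<N} \<and> is_partition (add_col \<rho> T)}"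
    using k by (auto simp: vstrips_def vstrip_def)
qed (use assms in \<open>auto simp: vstrips_def vstrip_def\<close>)

lemma finite_vstrips [simp]:
  assumes "is_partition \<rho>"
  shows "finite (vstrips N \<rho>)"
  unfolding vstrips_eq_image[OF assms] by (rule finite_imageI, rule finite_subset[of _ "Pow {..<N}"]) auto

lemma psize_add_col:
  assumes "is_partition \<rho>" "T \<subseteq> {..<N}"
  shows "psize (add_col \<rho> T) = psize \<rho> + card T"
proof -
  obtain M where M: "\<And>k. k \<ge> M \<Longrightarrow> \<rho> k = 0"
    using is_partition_obtain_length[OF assms(1)] by blast
  have "psize (add_col \<rho> T) = sum (add_col \<rho> T) {..<M + N}"
    using M assms(2) by (intro psize_lessThan) auto
  also have "\<dots> = psize \<rho> + (\<Sum>p<M + N. of_bool (p \<in> T))"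
    using M by (simp add: sum.distrib psize_lessThan[of "M + N"])
  also have "(\<Sum>p<M + N. of_bool (p \<in> T)) = card ({..<M + N} \<inter> T)"
    by (simp add: sum.If_cases of_bool_def)
  also have "{..<M + N} \<inter> T = T"
    using assms(2) by auto
  finally show ?thesis .
qed

text \<open>Toggling the last row below \<open>N\<close> in which \<open>\<nu>\<close> exceeds \<open>\<rho>\<close> is a sign-reversing involution.\<close>

lemma signed_strips_cancel:
  assumes \<rho>: "is_partition \<rho>" and \<nu>: "is_partition \<nu>"
    and ex: "p0 < N" "\<rho> p0 < \<nu> p0" and last: "\<nu> N \<le> \<rho> (N - 1)"
  shows "(\<Sum>\<kappa> | \<kappa> \<in> vstrips N \<rho> \<and> hstrip \<kappa> \<nu>. (-1) ^ (psize \<kappa> + psize \<rho>) :: int) = 0"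
proof -
  let ?S = "{\<kappa>. \<kappa> \<in> vstrips N \<rho> \<and> hstrip \<kappa> \<nu>}"
  let ?A = "{p. p < N \<and> \<rho> p < \<nu> p}"
  have fin: "finite ?A" "?A \<noteq> {}"
    using ex by auto
  define p where "p = Max ?A"
  have p: "p < N" "\<rho> p < \<nu> p" and max: "\<And>q. q < N \<Longrightarrow> p < q \<Longrightarrow> \<nu> q \<le> \<rho> q"
    using Max_in[OF fin] Max_ge[OF fin(1)] by (auto simp: p_def not_less[symmetric])
  \<comment> \<open>Lowering row \<open>p\<close> to \<open>\<rho> p\<close> respects the
    interlacing with \<open>\<nu>\<close> by this inequality. It follows from the maximality of
    \<open>p\<close>, or from \<open>last\<close> when \<open>p\<close> is row
    \<open>N - 1\<close>.\<close>
  have below: "\<nu> (Suc p) \<le> \<rho> p"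
  proof (cases "Suc p < N")
    case True
    then show ?thesis
      using max[of "Suc p"] is_partition_Suc_le[OF \<rho>, of p] by simp
  next
    case False
    then have "N = Suc p"
      using p by simp
    then show ?thesis
      using last by simp
  qed
  define tog where "tog = (\<lambda>\<kappa>. \<kappa>(p := if \<kappa> p = \<rho> p then Suc (\<rho> p) else \<rho> p))"
  have S: "tog \<kappa> \<in> ?S" "tog (tog \<kappa>) = \<kappa>"
    "(-1) ^ (psize (tog \<kappa>) + psize \<rho>) = - ((-1) ^ (psize \<kappa> + psize \<rho>) :: int)" if "\<kappa> \<in> ?S" for \<kappa>
  proof -
    have k: "\<And>q. \<rho> q \<le> \<kappa> q" "\<And>q. \<kappa> q \<le> Suc (\<rho> q)" "\<And>q. \<kappa> q \<le> \<nu> q" "\<And>q. \<nu> (Suc q) \<le> \<kappa> q"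
      "\<And>q. N \<le> q \<Longrightarrow> \<kappa> q = \<rho> q" "is_partition \<kappa>"
      using that by (auto simp: vstrips_def vstrip_def hstrip_def)
    have c: "\<kappa> p = \<rho> p \<or> \<kappa> p = Suc (\<rho> p)"
      using k(1,2)[of p] by linarith
    have t: "tog \<kappa> q \<le> \<nu> q" "\<nu> (Suc q) \<le> tog \<kappa> q" "\<rho> q \<le> tog \<kappa> q" "tog \<kappa> q \<le> Suc (\<rho> q)" for q
      using k p below by (auto simp: tog_def)
    \<comment> \<open>Interlacing suffices: each row of the toggled shape is at most the same row of
      \<open>\<nu>\<close>, and each row of \<open>\<nu>\<close> after the first is at most the
      preceding row of the toggled shape.\<close>
    have "is_partition (tog \<kappa>)"
      by (rule is_partition_le[OF \<nu>]) (use t in \<open>auto simp: le_fun_def intro: order.trans\<close>)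
    then show "tog \<kappa> \<in> ?S"
      using \<nu> \<rho> t k(5) p by (auto simp: vstrips_def vstrip_def hstrip_def) (auto simp: tog_def)
    show "tog (tog \<kappa>) = \<kappa>"
      using c by (auto simp: tog_def)
    have "psize (tog \<kappa>) = Suc (psize \<kappa>) \<or> psize \<kappa> = Suc (psize (tog \<kappa>))"
      using c psize_fun_upd[OF k(6), of p "Suc (\<rho> p)"] psize_fun_upd[OF k(6), of p "\<rho> p"]
      by (auto simp: tog_def)
    then show "(-1) ^ (psize (tog \<kappa>) + psize \<rho>) = - ((-1) ^ (psize \<kappa> + psize \<rho>) :: int)"
      by auto
  qed
  have "(\<Sum>\<kappa>\<in>?S. (-1) ^ (psize \<kappa> + psize \<rho>) :: int) = (\<Sum>\<kappa>\<in>?S. - ((-1) ^ (psize \<kappa> + psize \<rho>)))"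
    by (rule sum.reindex_bij_witness[where i = tog and j = tog]) (use S in \<open>simp_all\<close>)
  then show ?thesis
    by (simp add: sum_negf)
qed

subsection \<open>Families satisfying the Pieri rule\<close>

text \<open>Only the unit and the Pieri rule are assumed, so that every consequence holds for the
  Schur functions and, once the dual Pieri rule is available, for the family precomposed with
  \<open>conj_part\<close>.\<close>

locale schur_family =
  fixes s :: "(nat \<Rightarrow> nat) \<Rightarrow> 'a::comm_ring_1"
  assumes s_zero: "s (\<lambda>_. 0) = 1"
    and pieri: "is_partition \<rho> \<Longrightarrow>
      s (row_part k) * s \<rho> = (\<Sum>\<nu> | hstrip \<rho> \<nu> \<and> psize \<nu> = psize \<rho> + k. s \<nu>)"
begin

text \<open>Jacobi-Trudi entries may have negative indices, at which a complete function is zero by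
  convention.\<close>

definition hz :: "int \<Rightarrow> 'a" where
  "hz x = (if x < 0 then 0 else s (row_part (nat x)))"

lemma hz_int [simp]: "hz (int k) = s (row_part k)"
  by (simp add: hz_def)

text \<open>The Pieri rule is applied to every summand and the sums are exchanged. A strip with more
  than \<open>m\<close> boxes contributes zero on both sides: \<open>hz\<close> has a negative
  argument, and no \<open>\<nu>\<close> of the given size contains \<open>\<kappa>\<close>.\<close>

lemma signed_strip_expansion:
  assumes \<rho>: "is_partition \<rho>"
  shows "(\<Sum>\<kappa>\<in>vstrips N \<rho>. (-1) ^ (psize \<kappa> + psize \<rho>) * hz (int m + int (psize \<rho>) - int (psize \<kappa>)) * s \<kappa>) =
    (\<Sum>\<nu> | is_partition \<nu> \<and> psize \<nu> = psize \<rho> + m.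
      of_int (\<Sum>\<kappa> | \<kappa> \<in> vstrips N \<rho> \<and> hstrip \<kappa> \<nu>. (-1) ^ (psize \<kappa> + psize \<rho>)) * s \<nu>)"
proof -
  let ?P = "{\<nu>. is_partition \<nu> \<and> psize \<nu> = psize \<rho> + m}"
  have fin: "finite ?P"
    by (rule finite_subset[OF _ finite_partitions_le[of "psize \<rho> + m"]]) auto
  have "hz (int m + int (psize \<rho>) - int (psize \<kappa>)) * s \<kappa> = (\<Sum>\<nu> | \<nu> \<in> ?P \<and> hstrip \<kappa> \<nu>. s \<nu>)"
    if "\<kappa> \<in> vstrips N \<rho>" for \<kappa>
  proof (cases "psize \<kappa> \<le> psize \<rho> + m")
    case True
    then have "int m + int (psize \<rho>) - int (psize \<kappa>) = int (m + psize \<rho> - psize \<kappa>)"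
      by simp
    then have "hz (int m + int (psize \<rho>) - int (psize \<kappa>)) * s \<kappa> =
        (\<Sum>\<nu> | hstrip \<kappa> \<nu> \<and> psize \<nu> = psize \<kappa> + (m + psize \<rho> - psize \<kappa>). s \<nu>)"
      using that by (simp only: hz_int) (rule pieri, simp add: vstrips_def vstrip_def)
    also have "\<dots> = (\<Sum>\<nu> | \<nu> \<in> ?P \<and> hstrip \<kappa> \<nu>. s \<nu>)"
      using True by (intro sum.cong) (auto simp: hstrip_def)
    finally show ?thesis .
  next
    case False
    then have "{\<nu>. \<nu> \<in> ?P \<and> hstrip \<kappa> \<nu>} = {}"
      by (auto dest: hstripD(6))
    then show ?thesis
      using False by (simp only: sum.empty) (simp add: hz_def)
  qed
  then have "(\<Sum>\<kappa>\<in>vstrips N \<rho>. (-1) ^ (psize \<kappa> + psize \<rho>) * hz (int m + int (psize \<rho>) - int (psize \<kappa>)) * s \<kappa>) =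
      (\<Sum>\<kappa>\<in>vstrips N \<rho>. \<Sum>\<nu> | \<nu> \<in> ?P \<and> hstrip \<kappa> \<nu>. (-1) ^ (psize \<kappa> + psize \<rho>) * s \<nu>)"
    by (intro sum.cong) (simp_all only: mult.assoc sum_distrib_left)
  also have "\<dots> = (\<Sum>\<nu>\<in>?P. \<Sum>\<kappa> | \<kappa> \<in> vstrips N \<rho> \<and> hstrip \<kappa> \<nu>. (-1) ^ (psize \<kappa> + psize \<rho>) * s \<nu>)"
    using assms fin by (intro sum.swap_restrict) auto
  finally show ?thesis
    by (simp add: sum_distrib_right)
qed

definition vsum :: "nat \<Rightarrow> (nat \<Rightarrow> nat) \<Rightarrow> 'a" where
  "vsum k \<rho> = (\<Sum>\<nu> | vstrip \<rho> \<nu> \<and> psize \<nu> = psize \<rho> + k. s \<nu>)"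

text \<open>For empty \<open>\<rho>\<close> this is the classical relation between complete and
  elementary functions. As \<open>k > 0\<close>, a shape \<open>\<nu>\<close> containing
  \<open>\<rho>\<close> is longer than it in some row, so toggling cancels its coefficient; a shape
  not containing \<open>\<rho>\<close> has no strip below it at all.\<close>

lemma vsum_cancel:
  assumes \<rho>: "is_partition \<rho>" and k: "k > 0"
  shows "(\<Sum>t\<le>k. (-1) ^ t * s (row_part (k - t)) * vsum t \<rho>) = 0"
proof -
  \<comment> \<open>No partition of size at most \<open>psize \<rho> + k\<close> reaches row
    \<open>N\<close>, so the confinement to \<open>N\<close> rows loses no vertical strip of at most
    \<open>k\<close> boxes.\<close>
  define N where "N = psize \<rho> + k + 1"
  let ?f = "\<lambda>\<kappa>. (-1) ^ (psize \<kappa> + psize \<rho>) * hz (int k + int (psize \<rho>) - int (psize \<kappa>)) * s \<kappa>"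
  let ?S = "{\<kappa> \<in> vstrips N \<rho>. psize \<kappa> \<le> psize \<rho> + k}"
  have "(\<Sum>\<kappa>\<in>vstrips N \<rho>. ?f \<kappa>) = 0"
    unfolding signed_strip_expansion[OF \<rho>]
  proof (intro sum.neutral ballI)
    fix \<nu> assume "\<nu> \<in> {\<nu>. is_partition \<nu> \<and> psize \<nu> = psize \<rho> + k}"
    then have \<nu>: "is_partition \<nu>" "psize \<nu> = psize \<rho> + k"
      by auto
    have "(\<Sum>\<kappa> | \<kappa> \<in> vstrips N \<rho> \<and> hstrip \<kappa> \<nu>. (-1) ^ (psize \<kappa> + psize \<rho>) :: int) = 0"
    proof (cases "\<rho> \<le> \<nu>")
      case True
      have "\<not> \<nu> \<le> \<rho>"
        using \<nu> k psize_mono[OF \<rho>, of \<nu>] by auto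
      then obtain p where p: "\<rho> p < \<nu> p"
        by (meson le_funI not_le)
      moreover have "p < N" "\<nu> N = 0"
        using p part_eq_0[OF \<nu>(1), of p] part_eq_0[OF \<nu>(1), of N] \<nu>(2)
        unfolding N_def by linarith+
      ultimately show ?thesis
        by (intro signed_strips_cancel[OF \<rho> \<nu>(1)]) auto
    next
      case False
      then have "\<not> hstrip \<kappa> \<nu>" if "\<kappa> \<in> vstrips N \<rho>" for \<kappa>
        using that vstripD(5)[of \<rho> \<kappa>] hstripD(5)[of \<kappa> \<nu>] by (auto simp: vstrips_def)
      then have "{\<kappa>. \<kappa> \<in> vstrips N \<rho> \<and> hstrip \<kappa> \<nu>} = {}"
        by auto
      then show ?thesis
        by (simp only: sum.empty)
    qed
    then show "of_int (\<Sum>\<kappa> | \<kappa> \<in> vstrips N \<rho> \<and> hstrip \<kappa> \<nu>. (-1) ^ (psize \<kappa> + psize \<rho>)) * s \<nu> = 0"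
      by simp
  qed
  also have "(\<Sum>\<kappa>\<in>vstrips N \<rho>. ?f \<kappa>) = (\<Sum>\<kappa>\<in>?S. ?f \<kappa>)"
    using \<rho> by (intro sum.mono_neutral_right) (auto simp: hz_def)
  also have "\<dots> = (\<Sum>t\<le>k. \<Sum>\<kappa>\<in>{\<kappa>\<in>?S. psize \<kappa> - psize \<rho> = t}. ?f \<kappa>)"
    using \<rho> by (intro sum.group[symmetric]) auto
  also have "\<dots> = (\<Sum>t\<le>k. (-1) ^ t * s (row_part (k - t)) * vsum t \<rho>)"
  proof (rule sum.cong[OF refl])
    fix t assume t: "t \<in> {..k}"
    have eq: "{\<kappa>\<in>?S. psize \<kappa> - psize \<rho> = t} = {\<nu>. vstrip \<rho> \<nu> \<and> psize \<nu> = psize \<rho> + t}"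
    proof -
      have "\<kappa> p = \<rho> p" if "vstrip \<rho> \<kappa>" "psize \<kappa> = psize \<rho> + t" "p \<ge> N" for \<kappa> p
        using that t part_eq_0[OF vstripD(2)[OF that(1)], of p] part_eq_0[OF \<rho>, of p] by (auto simp: N_def)
      then show ?thesis
        using t by (auto simp: vstrips_def dest: vstripD(6))
    qed
    have "?f \<kappa> = (-1) ^ t * s (row_part (k - t)) * s \<kappa>"
      if "\<kappa> \<in> {\<nu>. vstrip \<rho> \<nu> \<and> psize \<nu> = psize \<rho> + t}" for \<kappa>
    proof -
      have "int k + int (psize \<rho>) - int (psize \<kappa>) = int (k - t)"
        using that t by auto
      moreover have "(-1) ^ (psize \<kappa> + psize \<rho>) = ((-1) ^ t :: 'a)"
        using that by (simp add: minus_one_power_iff)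
      ultimately show ?thesis
        by simp
    qed
    then show "(\<Sum>\<kappa>\<in>{\<kappa>\<in>?S. psize \<kappa> - psize \<rho> = t}. ?f \<kappa>) = (-1) ^ t * s (row_part (k - t)) * vsum t \<rho>"
      unfolding eq vsum_def sum_distrib_left by (intro sum.cong) auto
  qed
  finally show ?thesis
    by simp
qed

lemma vsum_zero: "vsum k (\<lambda>_. 0) = s (col_part k)"
proof -
  have "\<nu> = col_part k" if "vstrip (\<lambda>_. 0) \<nu>" "psize \<nu> = k" for \<nu>
  proof -
    have le: "\<nu> p \<le> 1" for p
      using vstripD(4)[OF that(1), of p] by simp
    moreover have "\<nu> p = 0" if "p \<ge> k" for p
      using part_eq_0[OF vstripD(2)[OF \<open>vstrip _ \<nu>\<close>]] \<open>psize \<nu> = k\<close> that by simp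
    ultimately have "\<nu> \<le> col_part k"
      by (auto simp: le_fun_def col_part_def not_less)
    then show ?thesis
      using that by (intro psize_eqD) auto
  qed
  then have "{\<nu>. vstrip (\<lambda>_. 0) \<nu> \<and> psize \<nu> = k} = {col_part k}"
    by (auto simp: vstrip_def col_part_def[abs_def] intro: is_partition_col[unfolded col_part_def])
      (auto simp: psize_col[unfolded col_part_def])
  then show ?thesis
    by (simp add: vsum_def)
qed

text \<open>The relation \<open>vsum_cancel\<close> determines \<open>vsum k \<rho>\<close>
  recursively from smaller \<open>k\<close>, starting at \<open>s \<rho>\<close>. The same recursion
  for the empty shape, multiplied by \<open>s \<rho>\<close>, shows that the product obeys it
  too.\<close>

lemma dual_pieri:
  assumes \<rho>: "is_partition \<rho>"
  shows "s (col_part k) * s \<rho> = vsum k \<rho>"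
proof (induction k rule: less_induct)
  case (less k)
  have V0: "vsum 0 \<rho>' = s \<rho>'" if "is_partition \<rho>'" for \<rho>'
  proof -
    have "{\<nu>. vstrip \<rho>' \<nu> \<and> psize \<nu> = psize \<rho>'} = {\<rho>'}"
    proof (intro subset_antisym subsetI)
      fix \<nu> assume "\<nu> \<in> {\<nu>. vstrip \<rho>' \<nu> \<and> psize \<nu> = psize \<rho>'}"
      then show "\<nu> \<in> {\<rho>'}"
        using psize_eqD[of \<nu> \<rho>'] vstripD(2,5)[of \<rho>' \<nu>] by auto
    qed (use that in \<open>auto simp: vstrip_def\<close>)
    then show ?thesis
      by (simp add: vsum_def)
  qed
  show ?case
  proof (cases "k = 0")
    case True
    then show ?thesis
      using V0[OF \<rho>] by (simp add: s_zero col_part_def)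
  next
    case False
    have step: "(-1) ^ k * vsum k \<rho>' = - (\<Sum>t<k. (-1) ^ t * s (row_part (k - t)) * vsum t \<rho>')"
      if "is_partition \<rho>'" for \<rho>'
      using vsum_cancel[OF that, of k] False
      by (simp add: lessThan_Suc_atMost[symmetric] row_part_0 s_zero add_eq_0_iff)
    have "(-1) ^ k * vsum k \<rho> = - (\<Sum>t<k. (-1) ^ t * s (row_part (k - t)) * (vsum t (\<lambda>_. 0) * s \<rho>))"
      unfolding step[OF \<rho>] using less.IH by (simp add: vsum_zero)
    also have "\<dots> = (-1) ^ k * vsum k (\<lambda>_. 0) * s \<rho>"
      unfolding step[OF is_partition_zero] by (simp add: sum_distrib_right mult.assoc)
    finally have "(-1) ^ k * ((-1) ^ k * vsum k \<rho>) = (-1) ^ k * ((-1) ^ k * vsum k (\<lambda>_. 0) * s \<rho>)"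
      by simp
    then show ?thesis
      by (simp add: vsum_zero mult.assoc[symmetric] power_mult_distrib[symmetric])
  qed
qed

text \<open>In \<open>signed_strip_expansion\<close> every \<open>\<nu>\<close> that outgrows
  \<open>\<rho>\<close> in a row before \<open>N\<close> cancels. For the others the only possible
  strip is \<open>\<rho>\<close> itself, and \<open>hstrip \<rho> \<nu>\<close> leaves only row
  \<open>N\<close> for the \<open>m\<close> boxes.\<close>

lemma last_row_expansion:
  assumes \<rho>: "is_partition \<rho>" and N: "\<And>p. p \<ge> N \<Longrightarrow> \<rho> p = 0" and m: "N = 0 \<or> m \<le> \<rho> (N - 1)"
  shows "(\<Sum>\<kappa>\<in>vstrips N \<rho>. (-1) ^ (psize \<kappa> + psize \<rho>) * hz (int m + int (psize \<rho>) - int (psize \<kappa>)) * s \<kappa>) =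
    s (\<rho>(N := m))"
proof -
  let ?P = "{\<nu>. is_partition \<nu> \<and> psize \<nu> = psize \<rho> + m}"
  let ?c = "\<lambda>\<nu>. \<Sum>\<kappa> | \<kappa> \<in> vstrips N \<rho> \<and> hstrip \<kappa> \<nu>. (-1) ^ (psize \<kappa> + psize \<rho>) :: int"
  let ?m = "\<rho>(N := m)"
  have part: "is_partition ?m"
  proof (rule is_partitionI[of _ "Suc N"])
    show "?m (Suc p) \<le> ?m p" for p
      using m N[of "Suc p"] is_partition_Suc_le[OF \<rho>, of p] by (cases "Suc p = N") auto
  qed (use N in auto)
  have size: "psize ?m = psize \<rho> + m"
    using psize_fun_upd[OF \<rho>, of N m] N[of N] by simp
  have fin: "finite ?P"
    by (rule finite_subset[OF _ finite_partitions_le[of "psize \<rho> + m"]]) auto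
  have c: "?c \<nu> = of_bool (\<nu> = ?m)" if "\<nu> \<in> ?P" for \<nu>
  proof -
    have \<nu>: "is_partition \<nu>" "psize \<nu> = psize \<rho> + m"
      using that by auto
    show ?thesis
    proof (cases "\<exists>p<N. \<rho> p < \<nu> p")
      case True
      then obtain p where p: "p < N" "\<rho> p < \<nu> p"
        by blast
      have "\<nu> \<noteq> ?m"
        using p by auto
      moreover have "?c \<nu> = 0"
      proof (cases "\<rho> \<le> \<nu>")
        case le: True
        \<comment> \<open>Counting boxes bounds row \<open>N\<close> of \<open>\<nu>\<close> by
          \<open>m\<close>, hence by the row above it in \<open>\<rho>\<close>, as the cancellation
          demands.\<close>
        have "psize (\<rho>(N := \<nu> N)) \<le> psize \<nu>"
          using le by (intro psize_mono[OF \<nu>(1)]) (auto simp: le_fun_def)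
        then have "\<nu> N \<le> m"
          using psize_fun_upd[OF \<rho>, of N "\<nu> N"] N[of N] \<nu>(2) by simp
        then show ?thesis
          using m p by (intro signed_strips_cancel[OF \<rho> \<nu>(1) p]) auto
      next
        case False
        then have "\<not> hstrip \<kappa> \<nu>" if "\<kappa> \<in> vstrips N \<rho>" for \<kappa>
          using that vstripD(5)[of \<rho> \<kappa>] hstripD(5)[of \<kappa> \<nu>] by (auto simp: vstrips_def)
        then have "{\<kappa>. \<kappa> \<in> vstrips N \<rho> \<and> hstrip \<kappa> \<nu>} = {}"
          by auto
        then show ?thesis
          by (simp only: sum.empty)
      qed
      ultimately show ?thesis
        by simp
    next
      case False
      have "\<kappa> = \<rho>" if "\<kappa> \<in> vstrips N \<rho>" "hstrip \<kappa> \<nu>" for \<kappa>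
      proof
        fix p
        have "\<rho> p \<le> \<kappa> p"
          using that(1) by (simp add: vstrips_def vstrip_def)
        moreover have "\<kappa> p \<le> \<rho> p" if "p < N"
          using False that hstripD(3)[OF \<open>hstrip \<kappa> \<nu>\<close>, of p] by (meson le_trans not_less)
        moreover have "\<kappa> p = \<rho> p" if "\<not> p < N"
          using \<open>\<kappa> \<in> vstrips N \<rho>\<close> that by (simp add: vstrips_def)
        ultimately show "\<kappa> p = \<rho> p"
          by linarith
      qed
      moreover have "\<rho> \<in> vstrips N \<rho>"
        using \<rho> by (auto simp: vstrips_def vstrip_def)
      ultimately have eq: "{\<kappa>. \<kappa> \<in> vstrips N \<rho> \<and> hstrip \<kappa> \<nu>} = (if hstrip \<rho> \<nu> then {\<rho>} else {})"
        by auto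
      have "hstrip \<rho> \<nu> \<longleftrightarrow> \<nu> = ?m"
      proof
        assume h: "hstrip \<rho> \<nu>"
        have "\<nu> p = \<rho> p" if "p < N" for p
          using False that hstripD(3)[OF h, of p] by (meson antisym not_less)
        moreover have "\<nu> p = 0" if "p > N" for p
          using hstripD(4)[OF h, of "p - 1"] N[of "p - 1"] that by simp
        ultimately have eq: "\<nu> = \<rho>(N := \<nu> N)"
          using N by (simp add: fun_eq_iff) (metis less_imp_le linorder_neqE_nat)
        have "psize (\<rho>(N := \<nu> N)) = psize \<rho> + m"
          using \<nu>(2) eq by simp
        then have "\<nu> N = m"
          using psize_fun_upd[OF \<rho>, of N "\<nu> N"] N[of N] by simp
        then show "\<nu> = ?m"
          using eq by simp
      next
        assume "\<nu> = ?m"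
        moreover have "?m (Suc p) \<le> \<rho> p" for p
          using m is_partition_Suc_le[OF \<rho>, of p] by auto
        ultimately show "hstrip \<rho> \<nu>"
          using \<rho> part N[of N] by (auto simp: hstrip_def)
      qed
      then show ?thesis
        unfolding eq by (auto simp flip: mult_2)
    qed
  qed
  have "(\<Sum>\<nu>\<in>?P. of_int (?c \<nu>) * s \<nu>) = (\<Sum>\<nu>\<in>?P. of_bool (\<nu> = ?m) * s \<nu>)"
    by (rule sum.cong[OF refl]) (simp only: c of_int_of_bool)
  also have "\<dots> = (\<Sum>\<nu>\<in>{?m}. s \<nu>)"
    using fin part size by (intro sum.mono_neutral_cong_right) auto
  finally show ?thesis
    by (simp add: signed_strip_expansion[OF \<rho>])
qed

text \<open>Induction on the number of rows: \<open>last_row_expansion\<close> splits off row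
  \<open>N\<close>, its strips are sets \<open>T\<close> of rows shifted by one, and
  \<open>dt_shift_rows\<close> collects the sets with \<open>t\<close> elements into the minor
  omitting column \<open>N - t\<close>. The result is the expansion along the last row.
  \<open>N\<close> may exceed the number of nonzero parts.\<close>

theorem jacobi_trudi:
  assumes "is_partition \<rho>" "\<And>p. p \<ge> N \<Longrightarrow> \<rho> p = 0"
  shows "s \<rho> = dt N (\<lambda>p q. hz (int (\<rho> p) - int p + int q))"
  using assms
proof (induction N arbitrary: \<rho>)
  case 0
  then have "\<rho> = (\<lambda>_. 0)"
    by auto
  then show ?case
    by (simp add: s_zero)
next
  case (Suc N)
  define m where "m = \<rho> N"
  define \<sigma> where "\<sigma> = \<rho>(N := 0)"
  define F where "F = (\<lambda>p q. hz (int (\<rho> p) - int p + int q))"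
  have \<sigma>: "is_partition \<sigma>"
    by (rule is_partitionI[of _ N])
      (use Suc.prems is_partition_Suc_le in \<open>auto simp: \<sigma>_def\<close>)
  have \<sigma>0: "\<And>p. p \<ge> N \<Longrightarrow> \<sigma> p = 0" "N = 0 \<or> m \<le> \<sigma> (N - 1)"
    using Suc.prems is_partition_Suc_le[OF Suc.prems(1), of "N - 1"] by (auto simp: \<sigma>_def m_def)
  have row: "dt N (\<lambda>p q. hz (int (add_col \<sigma> T p) - int p + int q)) = dt N (\<lambda>p q. F p (q + of_bool (p \<in> T)))"
    for T
    by (rule dt_cong) (auto simp: F_def \<sigma>_def algebra_simps of_bool_def)
  let ?T = "{T. T \<subseteq> {..<N}}"
  have finT: "finite ?T"
    using finite_Pow_iff[of "{..<N}"] by (simp add: Pow_def)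
  have IH: "of_bool (is_partition (add_col \<sigma> T)) * s (add_col \<sigma> T) = dt N (\<lambda>p q. F p (q + of_bool (p \<in> T)))"
    if T: "T \<in> ?T" for T
  proof (cases "is_partition (add_col \<sigma> T)")
    case True
    moreover have "\<And>p. p \<ge> N \<Longrightarrow> add_col \<sigma> T p = 0"
      using T \<sigma>0 by auto
    ultimately have "s (add_col \<sigma> T) = dt N (\<lambda>p q. hz (int (add_col \<sigma> T p) - int p + int q))"
      by (rule Suc.IH)
    then show ?thesis
      using True row by simp
  next
    case False
    then obtain p where p: "\<not> add_col \<sigma> T (Suc p) \<le> add_col \<sigma> T p"
    proof -
      have "add_col \<sigma> T k = 0" if "k \<ge> N" for k
        using T \<sigma>0 that by auto
      then show thesis
        using is_partitionI[of "add_col \<sigma> T" N] False that by blast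
    qed
    \<comment> \<open>Rows \<open>p\<close> and \<open>Suc p\<close> of the determinant agree, since
      the extra box in row \<open>Suc p\<close> offsets the step of the index. Hence a
      \<open>T\<close> that yields no partition contributes zero, and the sum may run over all
      subsets.\<close>
    then have "Suc p \<in> T" "\<sigma> (Suc p) = \<sigma> p" "p \<notin> T"
      using is_partition_Suc_le[OF \<sigma>, of p] by (auto simp: of_bool_def split: if_splits)
    then have "dt N (\<lambda>p q. hz (int (add_col \<sigma> T p) - int p + int q)) = 0"
      using T by (intro dt_identical_rows[of p N "Suc p"]) auto
    then show ?thesis
      using False row by simp
  qed
  have "\<rho> = \<sigma>(N := m)"
    by (auto simp: \<sigma>_def m_def)
  then have "s \<rho> = (\<Sum>\<kappa>\<in>vstrips N \<sigma>.
      (-1) ^ (psize \<kappa> + psize \<sigma>) * hz (int m + int (psize \<sigma>) - int (psize \<kappa>)) * s \<kappa>)"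
    using last_row_expansion[OF \<sigma> \<sigma>0] by simp
  also have "\<dots> = (\<Sum>T | T \<subseteq> {..<N} \<and> is_partition (add_col \<sigma> T).
      (-1) ^ (psize (add_col \<sigma> T) + psize \<sigma>) * hz (int m + int (psize \<sigma>) - int (psize (add_col \<sigma> T))) * s (add_col \<sigma> T))"
  proof -
    have "inj_on (add_col \<sigma>) A" for A
      by (rule inj_onI) (auto simp: fun_eq_iff of_bool_def split: if_splits)
    then show ?thesis
      unfolding vstrips_eq_image[OF \<sigma>] by (subst sum.reindex) (auto simp: o_def)
  qed
  also have "\<dots> = (\<Sum>T | T \<subseteq> {..<N} \<and> is_partition (add_col \<sigma> T).
      (-1) ^ card T * hz (int m - int (card T)) * (of_bool (is_partition (add_col \<sigma> T)) * s (add_col \<sigma> T)))"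
  proof (rule sum.cong[OF refl])
    fix T assume "T \<in> {T. T \<subseteq> {..<N} \<and> is_partition (add_col \<sigma> T)}"
    moreover have "(-1) ^ (a + b + a) = ((-1) ^ b :: 'a)" for a b
      by (simp add: minus_one_power_iff)
    ultimately show "(-1) ^ (psize (add_col \<sigma> T) + psize \<sigma>) * hz (int m + int (psize \<sigma>) - int (psize (add_col \<sigma> T))) * s (add_col \<sigma> T) =
      (-1) ^ card T * hz (int m - int (card T)) * (of_bool (is_partition (add_col \<sigma> T)) * s (add_col \<sigma> T))"
      using psize_add_col[OF \<sigma>, of T N] by simp
  qed
  also have "\<dots> = (\<Sum>T\<in>?T. (-1) ^ card T * hz (int m - int (card T)) * (of_bool (is_partition (add_col \<sigma> T)) * s (add_col \<sigma> T)))"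
    by (rule sum.mono_neutral_left) (use finT in auto)
  also have "\<dots> = (\<Sum>T\<in>?T. (-1) ^ card T * hz (int m - int (card T)) * dt N (\<lambda>p q. F p (q + of_bool (p \<in> T))))"
    by (rule sum.cong) (simp_all only: IH)
  also have "\<dots> = (\<Sum>t\<le>N. \<Sum>T | T \<in> ?T \<and> card T = t.
      (-1) ^ card T * hz (int m - int (card T)) * dt N (\<lambda>p q. F p (q + of_bool (p \<in> T))))"
    using finT card_mono[of "{..<N}"] by (intro sum.group[symmetric]) auto
  also have "\<dots> = (\<Sum>t\<le>N. (-1) ^ t * hz (int m - int t) * dt N (\<lambda>p q. F p (if q < N - t then q else Suc q)))"
    by (rule sum.cong[OF refl]) (simp add: dt_shift_rows[symmetric] sum_distrib_left)
  also have "\<dots> = (\<Sum>c\<le>N. (-1) ^ (N - c) * hz (int m - int (N - c)) * dt N (\<lambda>p q. F p (if q < N - (N - c) then q else Suc q)))"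
    by (rule sum.reindex_bij_witness[of _ "\<lambda>c. N - c" "\<lambda>c. N - c"]) auto
  also have "\<dots> = (\<Sum>c<Suc N. F N c * ((-1) ^ (N + c) * dt N (\<lambda>p q. F p (if q < c then q else Suc q))))"
    unfolding lessThan_Suc_atMost
  proof (rule sum.cong[OF refl])
    fix c assume c: "c \<in> {..N}"
    have "(-1) ^ (N + c) = ((-1) ^ (N - c) :: 'a)"
      using c by (simp add: minus_one_power_iff)
    moreover have "hz (int m - int (N - c)) = F N c"
      using c by (simp add: F_def m_def of_nat_diff algebra_simps)
    ultimately show "(-1) ^ (N - c) * hz (int m - int (N - c)) * dt N (\<lambda>p q. F p (if q < N - (N - c) then q else Suc q)) =
        F N c * ((-1) ^ (N + c) * dt N (\<lambda>p q. F p (if q < c then q else Suc q)))"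
      using c by (simp add: ac_simps)
  qed
  also have "\<dots> = dt (Suc N) F"
    by (rule dt_Suc[symmetric])
  finally show ?case
    unfolding F_def .
qed

end

subsection \<open>Conjugate partitions\<close>

definition conj_part :: "(nat \<Rightarrow> nat) \<Rightarrow> nat \<Rightarrow> nat" where
  "conj_part \<nu> q = card {p. q < \<nu> p}"

lemma down_closed_mem_iff:
  fixes A :: "nat set"
  assumes "finite A" "\<And>p q. p \<in> A \<Longrightarrow> q \<le> p \<Longrightarrow> q \<in> A"
  shows "x \<in> A \<longleftrightarrow> x < card A"
proof (cases "A = {}")
  case False
  have "A = {..Max A}"
    using assms(2)[OF Max_in[OF assms(1) False]] Max_ge[OF assms(1)] by blast
  then obtain n where "A = {..<Suc n}"
    unfolding lessThan_Suc_atMost by blast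
  then show ?thesis
    by simp
qed simp

text \<open>A single box with its coordinates exchanged. Containment and strip conditions on
  conjugates are reduced to it by expressing \<open>\<le>\<close> through \<open><\<close>.\<close>

lemma less_conj_part_iff:
  assumes "is_partition \<nu>"
  shows "p < conj_part \<nu> q \<longleftrightarrow> q < \<nu> p"
proof -
  have "finite {p. q < \<nu> p}"
    using assms by (auto simp: is_partition_def intro: finite_subset[of _ "{k. \<nu> k \<noteq> 0}"])
  then have "p \<in> {p. q < \<nu> p} \<longleftrightarrow> p < card {p. q < \<nu> p}"
    by (rule down_closed_mem_iff) (use is_partition_antimono[OF assms] in \<open>auto intro: less_le_trans\<close>)
  then show ?thesis
    by (simp add: conj_part_def)
qed

lemma le_iff_all_less: "a \<le> b \<longleftrightarrow> (\<forall>x. x < a \<longrightarrow> x < (b :: nat))"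
  by (metis less_le_trans not_le order_less_irrefl)

lemma is_partition_conj [simp]:
  assumes "is_partition \<nu>"
  shows "is_partition (conj_part \<nu>)"
proof (rule is_partitionI[of _ "\<nu> 0"])
  show "conj_part \<nu> (Suc p) \<le> conj_part \<nu> p" for p
    unfolding le_iff_all_less[of "conj_part \<nu> (Suc p)"] by (simp add: less_conj_part_iff[OF assms])
  show "conj_part \<nu> k = 0" if "k \<ge> \<nu> 0" for k
    using that less_conj_part_iff[OF assms, of 0 k] by simp
qed

lemma conj_part_eqI:
  assumes "is_partition \<nu>" "\<And>p q. p < \<beta> q \<longleftrightarrow> q < \<nu> p"
  shows "conj_part \<nu> = \<beta>"
proof
  fix q
  have "p < conj_part \<nu> q \<longleftrightarrow> p < \<beta> q" for p
    using assms by (simp add: less_conj_part_iff)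
  then show "conj_part \<nu> q = \<beta> q"
    by (metis less_irrefl linorder_neqE_nat)
qed

lemma conj_conj [simp]: "is_partition \<nu> \<Longrightarrow> conj_part (conj_part \<nu>) = \<nu>"
  by (rule conj_part_eqI) (simp_all add: less_conj_part_iff)

lemma conj_part_le_iff:
  assumes "is_partition \<nu>"
  shows "conj_part \<nu> \<le> \<beta> \<longleftrightarrow> (\<forall>p q. p < \<nu> q \<longrightarrow> q < \<beta> p)"
  unfolding le_fun_def le_iff_all_less[of "conj_part _ _"] by (simp add: less_conj_part_iff[OF assms])

lemma le_conj_part_iff:
  assumes "is_partition \<nu>"
  shows "\<beta> \<le> conj_part \<nu> \<longleftrightarrow> (\<forall>p q. q < \<beta> p \<longrightarrow> p < \<nu> q)"
  by (simp add: le_fun_def le_iff_all_less[of _ "conj_part _ _"] less_conj_part_iff[OF assms])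

lemma young_diagram_eq_Sigma:
  assumes "\<And>k. k \<ge> N \<Longrightarrow> \<nu> k = 0"
  shows "young_diagram \<nu> = (SIGMA p:{..<N}. {..<\<nu> p})"
proof -
  have "p < N" if "q < \<nu> p" for p q
    using assms[of p] that by (cases "p < N") auto
  then show ?thesis
    by (auto simp: young_diagram_def)
qed

lemma young_diagram_finite_card:
  assumes "is_partition \<nu>"
  shows finite_young_diagram: "finite (young_diagram \<nu>)" and card_young_diagram: "card (young_diagram \<nu>) = psize \<nu>"
proof -
  obtain N where N: "\<And>k. k \<ge> N \<Longrightarrow> \<nu> k = 0"
    using is_partition_obtain_length[OF assms] by blast
  show "finite (young_diagram \<nu>)" "card (young_diagram \<nu>) = psize \<nu>"
    using young_diagram_eq_Sigma[of N \<nu>, OF N] psize_lessThan[of N \<nu>, OF N] by simp_all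
qed

lemma psize_conj [simp]:
  assumes "is_partition \<nu>"
  shows "psize (conj_part \<nu>) = psize \<nu>"
proof -
  have "young_diagram (conj_part \<nu>) = prod.swap ` young_diagram \<nu>"
    by (auto simp: young_diagram_def less_conj_part_iff[OF assms] image_iff)
  then have "card (young_diagram (conj_part \<nu>)) = card (young_diagram \<nu>)"
    by (simp add: card_image)
  then show ?thesis
    using assms by (simp add: card_young_diagram)
qed

text \<open>Read on boxes, \<open>conj_part \<nu> (Suc q) \<le> conj_part \<kappa> q\<close> says
  that a box \<open>(p, Suc q)\<close> of \<open>\<nu>\<close> forces the box \<open>(p, q)\<close>
  of \<open>\<kappa>\<close>: no row gains two boxes.\<close>

lemma hstrip_conj_iff:
  assumes "is_partition \<kappa>" "is_partition \<nu>"
  shows "hstrip (conj_part \<kappa>) (conj_part \<nu>) \<longleftrightarrow> vstrip \<kappa> \<nu>"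
proof -
  have "n \<le> Suc k \<longleftrightarrow> (\<forall>q. Suc q < n \<longrightarrow> q < k)" for n k :: nat
  proof
    assume "\<forall>q. Suc q < n \<longrightarrow> q < k"
    then have "\<not> Suc k < n"
      by blast
    then show "n \<le> Suc k"
      by simp
  qed auto
  then have "(\<forall>p. \<nu> p \<le> Suc (\<kappa> p)) \<longleftrightarrow> (\<forall>q p. Suc q < \<nu> p \<longrightarrow> q < \<kappa> p)"
    by blast
  moreover have "(\<forall>p. \<kappa> p \<le> \<nu> p) \<longleftrightarrow> (\<forall>q p. q < \<kappa> p \<longrightarrow> q < \<nu> p)"
    unfolding le_iff_all_less[of "\<kappa> _"] by blast
  moreover have "(\<forall>q. conj_part \<kappa> q \<le> conj_part \<nu> q) \<longleftrightarrow> (\<forall>q p. q < \<kappa> p \<longrightarrow> q < \<nu> p)"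
    by (simp add: le_iff_all_less[of "conj_part _ _"] less_conj_part_iff[OF assms(1)] less_conj_part_iff[OF assms(2)])
  moreover have "(\<forall>q. conj_part \<nu> (Suc q) \<le> conj_part \<kappa> q) \<longleftrightarrow> (\<forall>q p. Suc q < \<nu> p \<longrightarrow> q < \<kappa> p)"
    by (simp add: le_iff_all_less[of "conj_part _ _"] less_conj_part_iff[OF assms(1)] less_conj_part_iff[OF assms(2)])
  ultimately show ?thesis
    unfolding hstrip_def vstrip_def using assms by (auto simp only: is_partition_conj all_conj_distrib)
qed

lemma conj_row: "conj_part (row_part k) = col_part k"
  by (rule conj_part_eqI, rule is_partition_row) (simp add: row_part_def col_part_def)

lemma conj_zero: "conj_part (\<lambda>_. 0) = (\<lambda>_. 0)"
  by (rule conj_part_eqI) simp_all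

lemma rect_apply: "rect c d p = (if p < d then c else 0)"
  by (simp add: rect_def nth_default_def)

lemma rect_le_conj:
  assumes "is_partition \<nu>" "rect y x \<le> \<nu>"
  shows "rect x y \<le> conj_part \<nu>"
  unfolding le_conj_part_iff[OF assms(1)]
proof (intro allI impI)
  fix p q assume "q < rect x y p"
  then show "p < \<nu> q"
    using le_funD[OF assms(2), of q] by (simp add: rect_apply split: if_splits)
qed

subsection \<open>Generation by minors\<close>

text \<open>The preimage of an ideal of the quotient lies inside the symmetric series and absorbs
  only those, so it need not be an ideal among all power series; closure under subtraction is what
  it keeps.\<close>

definition add_subgroup :: "'a::ab_group_add set \<Rightarrow> bool" where
  "add_subgroup K \<longleftrightarrow> 0 \<in> K \<and> (\<forall>x\<in>K. \<forall>y\<in>K. x - y \<in> K)"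

lemma add_subgroupD:
  assumes "add_subgroup K"
  shows "0 \<in> K" "x \<in> K \<Longrightarrow> y \<in> K \<Longrightarrow> x - y \<in> K" "x \<in> K \<Longrightarrow> - x \<in> K" "x \<in> K \<Longrightarrow> y \<in> K \<Longrightarrow> x + y \<in> K"
proof -
  show d: "0 \<in> K" "\<And>x y. x \<in> K \<Longrightarrow> y \<in> K \<Longrightarrow> x - y \<in> K"
    using assms by (auto simp: add_subgroup_def)
  show m: "- x \<in> K" if "x \<in> K" for x
    using d(2)[OF d(1) that] by simp
  show "x \<in> K \<Longrightarrow> y \<in> K \<Longrightarrow> x + y \<in> K"
    using d(2)[OF _ m, of x y] by simp
qed

lemma add_subgroup_sum: "add_subgroup K \<Longrightarrow> (\<And>x. x \<in> A \<Longrightarrow> f x \<in> K) \<Longrightarrow> sum f A \<in> K"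
  by (induction A rule: infinite_finite_induct) (auto simp: add_subgroupD)

lemma add_subgroup_sign:
  fixes x :: "'a::comm_ring_1"
  shows "add_subgroup K \<Longrightarrow> x \<in> K \<Longrightarrow> (-1) ^ n * x \<in> K"
  by (simp add: minus_one_power_iff add_subgroupD)

text \<open>The columns below \<open>z\<close> vanish in the rows from \<open>j\<close> on, so they survive in every minor that
  contributes to the expansion along these rows.\<close>

lemma dt_in_of_top_minors:
  fixes F :: "nat \<Rightarrow> nat \<Rightarrow> 'a::comm_ring_1"
  assumes K: "add_subgroup K" and "z \<le> j"
    and abs: "\<And>p c x. j \<le> p \<Longrightarrow> x \<in> K \<Longrightarrow> F p c * x \<in> K"
    and zero: "\<And>p c. j \<le> p \<Longrightarrow> p < n \<Longrightarrow> c < z \<Longrightarrow> F p c = 0"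
    and minors: "\<And>k. strict_mono_on {..<j} k \<Longrightarrow> (\<And>q. q < j \<Longrightarrow> k q < n) \<Longrightarrow> (\<And>q. q < z \<Longrightarrow> k q = q) \<Longrightarrow>
      dt j (\<lambda>p q. F p (k q)) \<in> K"
    and "j \<le> t" "t \<le> n" "strict_mono_on {..<t} k" "\<And>q. q < t \<Longrightarrow> k q < n" "\<And>q. q < z \<Longrightarrow> k q = q"
  shows "dt t (\<lambda>p q. F p (k q)) \<in> K"
  using assms(6-)
proof (induction t arbitrary: k rule: dec_induct)
  case base
  then show ?case
    using minors by blast
next
  case (step t)
  have "F t (k c) * ((-1) ^ (t + c) * dt t (\<lambda>p q. F p (k (if q < c then q else Suc q)))) \<in> K"
    if "c < Suc t" for c
  proof (cases "c < z")
    case True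
    then have "F t (k c) = 0"
      using zero[of t c] step by simp
    then show ?thesis
      using K by (simp add: add_subgroupD)
  next
    case False
    have "dt t (\<lambda>p q. F p ((\<lambda>q. k (if q < c then q else Suc q)) q)) \<in> K"
    proof (rule step.IH)
      show "strict_mono_on {..<t} (\<lambda>q. k (if q < c then q else Suc q))"
        by (rule strict_mono_onI, rule strict_mono_onD[OF step.prems(2)]) auto
    qed (use step.prems False in auto)
    then show ?thesis
      using abs step.hyps(1) add_subgroup_sign[OF K] by simp
  qed
  then show ?case
    unfolding dt_Suc[of t] by (intro add_subgroup_sum[OF K]) auto
qed

text \<open>A choice of \<open>j\<close> increasing columns out of \<open>n\<close> encodes a
  partition with parts \<open>k q - q\<close>, listed in increasing order, inside a box with
  \<open>j\<close> rows and \<open>n - j\<close> columns. These are the bounds of that box.\<close>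

lemma strict_mono_on_bounds:
  fixes k :: "nat \<Rightarrow> nat"
  assumes k: "strict_mono_on {..<j} k" and n: "\<And>q. q < j \<Longrightarrow> k q < n" and q: "q < j"
  shows "q \<le> k q" "k q - q \<le> n - j"
proof -
  have step: "k q < k (Suc q)" if "Suc q < j" for q
    using that by (intro strict_mono_onD[OF k]) auto
  show "q \<le> k q"
    using q
  proof (induction q)
    case (Suc q)
    then show ?case
      using step[of q] by simp
  qed simp
  have "d < j \<Longrightarrow> k (j - Suc d) + d < n" for d
  proof (induction d)
    case 0
    then show ?case
      using n[of "j - 1"] by simp
  next
    case (Suc d)
    then have "Suc (j - Suc (Suc d)) = j - Suc d"
      by simp
    then show ?case
      using Suc step[of "j - Suc (Suc d)"] by simp
  qed
  from this[of "j - Suc q"] show "k q - q \<le> n - j"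
    using q by simp
qed

section \<open>Reduction of all shapes containing the rectangle to the generators\<close>

context schur_family
begin

text \<open>The dual Pieri rule is the Pieri rule of the conjugated family, because conjugation
  exchanges the two kinds of strips.\<close>

lemma dual_family: "schur_family (\<lambda>\<nu>. s (conj_part \<nu>))"
proof
  show "s (conj_part (\<lambda>_. 0)) = 1"
    by (simp add: conj_zero s_zero)
next
  fix \<rho> k assume \<rho>: "is_partition \<rho>"
  have "s (conj_part (row_part k)) * s (conj_part \<rho>) = vsum k (conj_part \<rho>)"
    using \<rho> by (simp add: conj_row dual_pieri)
  also have "\<dots> = (\<Sum>\<nu> | hstrip \<rho> \<nu> \<and> psize \<nu> = psize \<rho> + k. s (conj_part \<nu>))"
    unfolding vsum_def
  proof (rule sum.reindex_bij_witness[where i = conj_part and j = conj_part], goal_cases)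
    case (2 \<nu>)
    then have "vstrip (conj_part \<rho>) \<nu>" "is_partition \<nu>"
      by (auto simp: vstrip_def)
    then have "hstrip \<rho> (conj_part \<nu>)"
      using hstrip_conj_iff[of "conj_part \<rho>" \<nu>] \<rho> by simp
    then show ?case
      using 2 \<rho> \<open>is_partition \<nu>\<close> by simp
  next
    case (4 \<nu>)
    then have "hstrip \<rho> \<nu>" "is_partition \<nu>"
      by (auto simp: hstrip_def)
    then have "vstrip (conj_part \<rho>) (conj_part \<nu>)"
      using hstrip_conj_iff[of "conj_part \<rho>" "conj_part \<nu>"] \<rho> by simp
    then show ?case
      using 4 \<rho> \<open>is_partition \<nu>\<close> by simp
  qed (auto simp: hstrip_def vstrip_def)
  finally show "s (conj_part (row_part k)) * s (conj_part \<rho>) =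
    (\<Sum>\<nu> | hstrip \<rho> \<nu> \<and> psize \<nu> = psize \<rho> + k. s (conj_part \<nu>))" .
qed

text \<open>Peels off the last row \<open>N\<close> by induction on its index and on its length
  \<open>m\<close>. If \<open>\<sigma>\<close> is \<open>\<mu>\<close> without this row, every term
  of \<open>s (row_part m) * s \<sigma>\<close> other than \<open>s \<mu>\<close> has a shorter row
  \<open>N\<close>. For the conjugated family this becomes the peeling of columns.\<close>

lemma in_of_few_rows:
  assumes K: "add_subgroup K" and abs: "\<And>k x. x \<in> K \<Longrightarrow> s (row_part k) * x \<in> K"
    and \<rho>: "\<And>p. p \<ge> j \<Longrightarrow> \<rho> p = 0"
    and gens: "\<And>\<mu>. is_partition \<mu> \<Longrightarrow> \<rho> \<le> \<mu> \<Longrightarrow> (\<And>p. p \<ge> j \<Longrightarrow> \<mu> p = 0) \<Longrightarrow> s \<mu> \<in> K"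
    and \<mu>: "is_partition \<mu>" "\<rho> \<le> \<mu>"
  shows "s \<mu> \<in> K"
proof -
  have "s \<mu> \<in> K" if "is_partition \<mu>" "\<rho> \<le> \<mu>" "\<And>p. p \<ge> j + l \<Longrightarrow> \<mu> p = 0" for l \<mu>
    using that
  proof (induction l arbitrary: \<mu>)
    case 0
    then show ?case
      using gens by simp
  next
    case (Suc l)
    define N where "N = j + l"
    have "s \<mu> \<in> K" if "is_partition \<mu>" "\<rho> \<le> \<mu>" "\<And>p. p \<ge> Suc N \<Longrightarrow> \<mu> p = 0" "\<mu> N = m" for m \<mu>
      using that
    proof (induction m arbitrary: \<mu> rule: less_induct)
      case (less m)
      define \<sigma> where "\<sigma> = \<mu>(N := 0)"
      have \<sigma>: "is_partition \<sigma>" "\<rho> \<le> \<sigma>" "\<And>p. p \<ge> N \<Longrightarrow> \<sigma> p = 0"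
      proof -
        show "is_partition \<sigma>"
          by (rule is_partitionI[of _ N]) (use less.prems is_partition_Suc_le in \<open>auto simp: \<sigma>_def\<close>)
        show "\<rho> \<le> \<sigma>"
          using less.prems(2) \<rho>[of N] by (auto simp: \<sigma>_def le_fun_def N_def)
        show "\<And>p. p \<ge> N \<Longrightarrow> \<sigma> p = 0"
          using less.prems(3) by (auto simp: \<sigma>_def)
      qed
      have size: "psize \<mu> = psize \<sigma> + m"
        using psize_fun_upd[OF less.prems(1), of N 0] less.prems(4) by (simp add: \<sigma>_def)
      let ?S = "{\<nu>. hstrip \<sigma> \<nu> \<and> psize \<nu> = psize \<sigma> + m}"
      have "\<mu> (Suc p) \<le> \<sigma> p" for p
        using is_partition_Suc_le[OF less.prems(1), of p] less.prems(3) by (auto simp: \<sigma>_def)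
      then have mem: "\<mu> \<in> ?S"
        using less.prems(1) \<sigma> size by (auto simp: hstrip_def) (simp add: \<sigma>_def)
      have "s \<nu> \<in> K" if "\<nu> \<in> ?S - {\<mu>}" for \<nu>
      proof -
        have h: "hstrip \<sigma> \<nu>" "psize \<nu> = psize \<sigma> + m" "\<nu> \<noteq> \<mu>"
          using that by auto
        have le: "\<sigma>(N := \<nu> N) \<le> \<nu>"
          using hstripD(3)[OF h(1)] by (simp add: le_fun_def)
        have sz: "psize (\<sigma>(N := \<nu> N)) = psize \<sigma> + \<nu> N"
          using psize_fun_upd[OF \<sigma>(1), of N "\<nu> N"] \<sigma>(3)[of N] by simp
        have "\<nu> N \<noteq> m"
        proof
          assume "\<nu> N = m"
          then have "\<sigma>(N := \<nu> N) = \<nu>"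
            using sz h(2) by (intro psize_eqD[OF hstripD(2)[OF h(1)] le]) simp
          moreover have "\<sigma>(N := \<nu> N) = \<mu>"
            using \<open>\<nu> N = m\<close> less.prems(4) by (auto simp: \<sigma>_def)
          ultimately show False
            using h(3) by simp
        qed
        moreover have "\<nu> N \<le> m"
          using psize_mono[OF hstripD(2)[OF h(1)] le] sz h(2) by simp
        ultimately have "\<nu> N < m"
          by simp
        then show ?thesis
        proof (rule less.IH)
          show "is_partition \<nu>" "\<rho> \<le> \<nu>"
            using hstripD(2,5)[OF h(1)] \<sigma>(2) by auto
          show "\<nu> p = 0" if "p \<ge> Suc N" for p
            using hstripD(4)[OF h(1), of "p - 1"] \<sigma>(3)[of "p - 1"] that by simp
        qed simp
      qed
      then have "sum s (?S - {\<mu>}) \<in> K"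
        by (rule add_subgroup_sum[OF K])
      moreover have "s (row_part m) * s \<sigma> \<in> K"
        using Suc.IH \<sigma> by (intro abs) (auto simp: N_def)
      moreover have "s (row_part m) * s \<sigma> = s \<mu> + sum s (?S - {\<mu>})"
        unfolding pieri[OF \<sigma>(1)] using mem by (intro sum.remove) auto
      ultimately show ?case
        using add_subgroupD(2)[OF K] by (metis add_diff_cancel_right')
    qed
    then show ?case
      using Suc.prems by (simp add: N_def)
  qed
  moreover obtain M where "\<And>p. p \<ge> M \<Longrightarrow> \<mu> p = 0"
    using is_partition_obtain_length[OF \<mu>(1)] by blast
  ultimately show ?thesis
    using \<mu> by (metis le_add2 order.trans)
qed

text \<open>The first \<open>j\<close> rows of the Jacobi-Trudi matrix come from equal parts
  \<open>i\<close>, so their entries depend only on column minus row. Their minors of size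
  \<open>j\<close> are therefore again Jacobi-Trudi determinants, for \<open>i\<close> plus the
  partition encoded by the chosen columns. The lower rows only contribute complete functions as
  factors, which \<open>K\<close> absorbs.\<close>

lemma few_columns_in_of_few_rows:
  assumes K: "add_subgroup K" and abs: "\<And>k x. x \<in> K \<Longrightarrow> s (row_part k) * x \<in> K"
    and gens: "\<And>\<nu>. is_partition \<nu> \<Longrightarrow> rect i j \<le> \<nu> \<Longrightarrow> (\<And>p. p \<ge> j \<Longrightarrow> \<nu> p = 0) \<Longrightarrow>
      (\<And>p. p \<ge> i \<Longrightarrow> \<nu> p \<le> i) \<Longrightarrow> \<nu> 0 \<le> i + (r - j) \<Longrightarrow> s \<nu> \<in> K"
    and \<mu>: "is_partition \<mu>" "rect i j \<le> \<mu>" "\<mu> 0 \<le> i" "\<And>p. p \<ge> r \<Longrightarrow> \<mu> p = 0" and "j \<le> r"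
  shows "s \<mu> \<in> K"
proof -
  define F where "F = (\<lambda>p q. hz (int (\<mu> p) - int p + int q))"
  have le: "\<mu> p \<le> i" for p
    using is_partition_antimono[OF \<mu>(1), of 0 p] \<mu>(3) by simp
  have top: "\<mu> p = i" if "p < j" for p
    using le[of p] le_funD[OF \<mu>(2), of p] that by (simp add: rect_apply)
  have "dt r (\<lambda>p q. F p (id q)) \<in> K"
  \<comment> \<open>For \<open>p \<ge> j\<close> and \<open>c < j - i\<close> the index
    \<open>\<mu> p - p + c\<close> is negative, as \<open>\<mu> p \<le> i\<close>. The subtraction
    truncates: for \<open>i \<ge> j\<close> no column is forced.\<close>
  proof (rule dt_in_of_top_minors[OF K, of "j - i" j])
    show "F p c * x \<in> K" if "x \<in> K" for p c x
      using abs[OF that] K by (simp add: F_def hz_def add_subgroupD)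
    show "F p c = 0" if "j \<le> p" "c < j - i" for p c
      using le[of p] that by (simp add: F_def hz_def)
    fix k
    assume k: "strict_mono_on {..<j} k" and kn: "\<And>q. q < j \<Longrightarrow> k q < r" and kz: "\<And>q. q < j - i \<Longrightarrow> k q = q"
    note bounds = strict_mono_on_bounds[OF k kn]
    \<comment> \<open>Reading the columns from the right makes the parts decrease; the excess over
      \<open>i\<close> measures how far a column lies from the leftmost choice, whose minor belongs
      to the rectangle itself.\<close>
    define \<nu> where "\<nu> = (\<lambda>p. if p < j then i + (k (j - Suc p) - (j - Suc p)) else 0)"
    have part: "is_partition \<nu>"
    proof (rule is_partitionI[of _ j])
      show "\<nu> (Suc p) \<le> \<nu> p" for p
      proof (cases "Suc p < j")
        case True
        then have "k (j - Suc (Suc p)) < k (j - Suc p)"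
          by (intro strict_mono_onD[OF k]) auto
        then show ?thesis
          using True by (simp add: \<nu>_def)
      qed (simp add: \<nu>_def)
    qed (simp add: \<nu>_def)
    have "s \<nu> = dt j (\<lambda>p q. hz (int (\<nu> p) - int p + int q))"
      using part by (rule jacobi_trudi) (simp add: \<nu>_def)
    \<comment> \<open>The minor appears transposed and with both orders reversed, which does not
      change its value.\<close>
    also have "\<dots> = dt j (\<lambda>p q. F (j - Suc q) (k (j - Suc p)))"
    proof (rule dt_cong)
      fix p q assume pq: "p < j" "q < j"
      have "int (\<nu> p) = int i + int (k (j - Suc p)) - int (j - Suc p)"
        using pq bounds(1)[of "j - Suc p"] by (simp add: \<nu>_def)
      then have "int (\<nu> p) - int p + int q = int i - int (j - Suc q) + int (k (j - Suc p))"
        using pq by simp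
      then show "hz (int (\<nu> p) - int p + int q) = F (j - Suc q) (k (j - Suc p))"
        using pq by (simp only: F_def top[of "j - Suc q"])
    qed
    also have "\<dots> = dt j (\<lambda>p q. F (j - Suc p) (k (j - Suc q)))"
      by (rule dt_transpose)
    also have "\<dots> = dt j (\<lambda>p q. F p (k q))"
      by (rule dt_reverse)
    finally have "s \<nu> = dt j (\<lambda>p q. F p (k q))" .
    moreover have "s \<nu> \<in> K"
    proof (rule gens[OF part])
      show "rect i j \<le> \<nu>"
        by (simp add: le_fun_def rect_apply \<nu>_def)
      \<comment> \<open>For \<open>i \<le> p < j\<close> the column position
        \<open>j - Suc p\<close> is below \<open>j - i\<close>, hence one of the forced ones, and
        row \<open>p\<close> has no excess.\<close>
      show "\<nu> p \<le> i" if "p \<ge> i" for p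
        using that kz[of "j - Suc p"] by (simp add: \<nu>_def)
      show "\<nu> 0 \<le> i + (r - j)"
        using bounds(2)[of "j - 1"] by (simp add: \<nu>_def)
    qed (simp add: \<nu>_def)
    ultimately show "dt j (\<lambda>p q. F p (k q)) \<in> K"
      by simp
  qed (use \<open>j \<le> r\<close> in \<open>auto simp: strict_mono_on_def\<close>)
  then show ?thesis
    using jacobi_trudi[OF \<mu>(1,4)] by (simp add: F_def)
qed

text \<open>\<open>K\<close> stands for the preimage of the generated ideal. The two terms of
  \<open>a\<close> arise separately: \<open>r - j\<close> bounds the minors, and
  \<open>c - i\<close> is what remains once \<open>out\<close> has dealt with first rows longer than
  \<open>c\<close>.\<close>

theorem rect_generators:
  assumes K: "add_subgroup K" and abs: "\<And>\<nu> x. is_partition \<nu> \<Longrightarrow> x \<in> K \<Longrightarrow> s \<nu> * x \<in> K"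
    and out: "\<And>\<nu>. is_partition \<nu> \<Longrightarrow> \<not> \<nu> \<le> rect c r \<Longrightarrow> s \<nu> \<in> K"
    and gens: "\<And>\<nu>. is_partition \<nu> \<Longrightarrow> rect i j \<le> \<nu> \<Longrightarrow>
      \<nu> \<le> parts (replicate b (i + a) @ replicate (j - b) i) \<Longrightarrow> s \<nu> \<in> K"
    and ab: "a = min (c - i) (r - j)" "b = min i j" and "i \<le> c" "j \<le> r"
    and \<mu>: "is_partition \<mu>" "rect i j \<le> \<mu>"
  shows "s \<mu> \<in> K"
proof -
  interpret dual: schur_family "\<lambda>\<nu>. s (conj_part \<nu>)"
    by (rule dual_family)
  have bound: "parts (replicate b (i + a) @ replicate (j - b) i) p =
      (if p < b then i + a else if p < j then i else 0)" for p
    using ab(2) by (auto simp: nth_default_def nth_append)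
  \<comment> \<open>Shapes with more than \<open>r\<close> rows fall to \<open>out\<close>; the
    others fit a Jacobi-Trudi matrix of size \<open>r\<close>.\<close>
  have few_cols: "s \<mu> \<in> K" if \<mu>: "is_partition \<mu>" "rect i j \<le> \<mu>" "\<mu> 0 \<le> i" for \<mu>
  proof (cases "\<forall>p\<ge>r. \<mu> p = 0")
    case True
    show ?thesis
    proof (rule few_columns_in_of_few_rows[OF K, of i j r])
      fix \<nu>
      assume \<nu>: "is_partition \<nu>" "rect i j \<le> \<nu>" "\<And>p. p \<ge> j \<Longrightarrow> \<nu> p = 0" "\<And>p. p \<ge> i \<Longrightarrow> \<nu> p \<le> i"
        "\<nu> 0 \<le> i + (r - j)"
      show "s \<nu> \<in> K"
      proof (cases "\<nu> 0 \<le> c")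
        case le: True
        have "\<nu> p \<le> i + a" for p
          using is_partition_antimono[OF \<nu>(1), of 0 p] le \<nu>(5) ab(1) \<open>i \<le> c\<close> by auto
        then have "\<nu> \<le> parts (replicate b (i + a) @ replicate (j - b) i)"
          unfolding le_fun_def bound using \<nu>(3,4) ab(2) by (auto simp: not_less)
        then show ?thesis
          using gens \<nu> by blast
      next
        case False
        then have "\<not> \<nu> \<le> rect c r"
          by (auto simp: rect_apply dest!: le_funD[of _ _ 0] split: if_splits)
        then show ?thesis
          using out \<nu>(1) by blast
      qed
    qed (use True \<mu> \<open>j \<le> r\<close> abs in auto)
  next
    case False
    then obtain p where "p \<ge> r" "\<mu> p \<noteq> 0"
      by auto
    then have "\<not> \<mu> \<le> rect c r"
      by (auto simp: rect_apply dest!: le_funD[of _ _ p])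
    then show ?thesis
      using out \<mu>(1) by blast
  qed
  \<comment> \<open>Row peeling for the conjugated family removes the columns beyond the first
    \<open>i\<close>; the double conjugate presents \<open>s \<mu>\<close> as a member of that
    family.\<close>
  have "s (conj_part (conj_part \<mu>)) \<in> K"
  proof (rule dual.in_of_few_rows[OF K, of i "rect j i"])
    show "s (conj_part (row_part k)) * x \<in> K" if "x \<in> K" for k x
      using that abs by simp
    show "rect j i p = 0" if "p \<ge> i" for p
      using that by (simp add: rect_apply)
    show "s (conj_part \<nu>) \<in> K" if \<nu>: "is_partition \<nu>" "rect j i \<le> \<nu>" "\<And>p. p \<ge> i \<Longrightarrow> \<nu> p = 0" for \<nu>
    proof (rule few_cols)
      show "rect i j \<le> conj_part \<nu>"
        using \<nu>(1,2) by (rule rect_le_conj)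
      have "\<not> i < conj_part \<nu> 0"
        using \<nu>(3)[of i] by (simp add: less_conj_part_iff[OF \<nu>(1)])
      then show "conj_part \<nu> 0 \<le> i"
        by simp
    qed (use \<nu> in simp)
    show "is_partition (conj_part \<mu>)"
      using \<mu> by simp
    show "rect j i \<le> conj_part \<mu>"
      using \<mu> by (rule rect_le_conj)
  qed
  then show ?thesis
    using \<mu> by simp
qed

text \<open>This is \<open>rect_generators\<close> for the conjugated family with \<open>i\<close>
  and \<open>j\<close>, and \<open>c\<close> and \<open>r\<close>, exchanged: \<open>a\<close> and
  \<open>b\<close> are symmetric under the exchange, and conjugation carries the first upper bound
  to the second.\<close>

theorem rect_generators_dual:
  assumes K: "add_subgroup K" and abs: "\<And>\<nu> x. is_partition \<nu> \<Longrightarrow> x \<in> K \<Longrightarrow> s \<nu> * x \<in> K"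
    and out: "\<And>\<nu>. is_partition \<nu> \<Longrightarrow> \<not> \<nu> \<le> rect c r \<Longrightarrow> s \<nu> \<in> K"
    and gens: "\<And>\<nu>. is_partition \<nu> \<Longrightarrow> rect i j \<le> \<nu> \<Longrightarrow>
      \<nu> \<le> parts (replicate j i @ replicate a b) \<Longrightarrow> s \<nu> \<in> K"
    and ab: "a = min (c - i) (r - j)" "b = min i j" and "i \<le> c" "j \<le> r"
    and \<mu>: "is_partition \<mu>" "rect i j \<le> \<mu>"
  shows "s \<mu> \<in> K"
proof -
  interpret dual: schur_family "\<lambda>\<nu>. s (conj_part \<nu>)"
    by (rule dual_family)
  have "s (conj_part (conj_part \<mu>)) \<in> K"
  proof (rule dual.rect_generators[OF K, of r c j i b a])
    show "s (conj_part \<nu>) \<in> K" if \<nu>: "is_partition \<nu>" "\<not> \<nu> \<le> rect r c" for \<nu>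
    proof (rule out)
      have "\<not> (\<forall>p q. p < \<nu> q \<longrightarrow> q < rect c r p)"
      proof
        assume "\<forall>p q. p < \<nu> q \<longrightarrow> q < rect c r p"
        then have "\<nu> q \<le> rect r c q" for q
          unfolding le_iff_all_less[of "\<nu> q"] by (auto simp: rect_apply split: if_splits)
        then show False
          using \<nu>(2) by (simp add: le_fun_def)
      qed
      then show "\<not> conj_part \<nu> \<le> rect c r"
        by (simp add: conj_part_le_iff[OF \<nu>(1)])
    qed (use \<nu> in simp)
    show "s (conj_part \<nu>) \<in> K" if \<nu>: "is_partition \<nu>" "rect j i \<le> \<nu>"
      "\<nu> \<le> parts (replicate b (j + a) @ replicate (i - b) j)" for \<nu>
    proof (rule gens)
      have "q < parts (replicate j i @ replicate a b) p" if "p < \<nu> q" for p q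
        using less_le_trans[OF that le_funD[OF \<nu>(3), of q]] ab(2)
        by (auto simp: nth_default_def nth_append split: if_splits)
      then show "conj_part \<nu> \<le> parts (replicate j i @ replicate a b)"
        by (simp add: conj_part_le_iff[OF \<nu>(1)])
    qed (use \<nu> rect_le_conj in auto)
    show "a = min (r - j) (c - i)" "b = min j i"
      using ab by (simp_all only: min.commute)
  qed (use assms rect_le_conj in auto)
  then show ?thesis
    using \<mu> by simp
qed

end

subsection \<open>Tableaux and horizontal strips\<close>

text \<open>Counts chains of horizontal strips of sizes \<open>m 0\<close>, ...,
  \<open>m (n - 1)\<close> from the empty shape to \<open>\<nu>\<close>. This form suits inductions;
  \<open>card_tableaux\<close> identifies it with the number of tableaux.\<close>

primrec kostka :: "nat \<Rightarrow> (nat \<Rightarrow> nat) \<Rightarrow> (nat \<Rightarrow> nat) \<Rightarrow> nat" where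
  "kostka 0 \<nu> m = (if \<nu> = (\<lambda>_. 0) then 1 else 0)"
| "kostka (Suc n) \<nu> m = (\<Sum>\<kappa> | hstrip \<kappa> \<nu> \<and> psize \<nu> = psize \<kappa> + m n. kostka n \<kappa> m)"

lemma kostka_cong: "(\<And>k. k < n \<Longrightarrow> m k = m' k) \<Longrightarrow> kostka n \<nu> m = kostka n \<nu> m'"
  by (induction n arbitrary: \<nu>) auto

definition tableaux :: "(nat \<Rightarrow> nat) \<Rightarrow> (nat \<Rightarrow> nat) \<Rightarrow> (nat \<times> nat \<Rightarrow> nat) set" where
  "tableaux \<nu> m = {T \<in> ssyt \<nu>. \<forall>k. card {c \<in> young_diagram \<nu>. T c = k} = m k}"

lemma tableaux_entry:
  assumes "is_partition \<nu>" "T \<in> tableaux \<nu> m" "c \<in> young_diagram \<nu>"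
  shows "m (T c) \<noteq> 0"
proof -
  have "c \<in> {c' \<in> young_diagram \<nu>. T c' = T c}"
    using assms(3) by simp
  moreover have "finite {c' \<in> young_diagram \<nu>. T c' = T c}"
    using finite_young_diagram[OF assms(1)] by simp
  ultimately have "card {c' \<in> young_diagram \<nu>. T c' = T c} \<noteq> 0"
    by (metis card_0_eq empty_iff)
  then show ?thesis
    using assms(2) by (simp add: tableaux_def)
qed

lemma tableauxI:
  assumes "T \<in> extensional (young_diagram \<nu>)"
    and "\<And>p q q'. q < q' \<Longrightarrow> q' < \<nu> p \<Longrightarrow> T (p, q) \<le> T (p, q')"
    and "\<And>p p' q. p < p' \<Longrightarrow> q < \<nu> p' \<Longrightarrow> T (p, q) < T (p', q)"
    and "\<And>k. card {c \<in> young_diagram \<nu>. T c = k} = m k"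
  shows "T \<in> tableaux \<nu> m"
  using assms by (auto simp: tableaux_def ssyt_def young_diagram_def)

lemma tableauxD:
  assumes "T \<in> tableaux \<nu> m"
  shows "T \<in> extensional (young_diagram \<nu>)"
    and "\<And>p q q'. q \<le> q' \<Longrightarrow> q' < \<nu> p \<Longrightarrow> T (p, q) \<le> T (p, q')"
    and "\<And>p p' q. p < p' \<Longrightarrow> q < \<nu> p' \<Longrightarrow> T (p, q) < T (p', q)"
    and "\<And>k. card {c \<in> young_diagram \<nu>. T c = k} = m k"
proof -
  fix p q q' assume "q \<le> q'" "q' < \<nu> p"
  then show "T (p, q) \<le> T (p, q')"
    using assms by (cases "q = q'") (auto simp: tableaux_def ssyt_def young_diagram_def)
qed (use assms in \<open>auto simp: tableaux_def ssyt_def young_diagram_def\<close>)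

text \<open>Branching on the largest possible entry: the cells with smaller entries form a shape,
  and the cells with the largest entry form a horizontal strip on it because columns increase
  strictly.\<close>

lemma card_tableaux:
  assumes "is_partition \<nu>" "\<And>k. k \<ge> n \<Longrightarrow> m k = 0"
  shows "card (tableaux \<nu> m) = kostka n \<nu> m"
  using assms
proof (induction n arbitrary: \<nu> m)
  case 0
  show ?case
  proof (cases "\<nu> = (\<lambda>_. 0)")
    case True
    have "tableaux \<nu> m = {\<lambda>_. undefined}"
      using True 0 by (auto simp: tableaux_def ssyt_def young_diagram_def)
    then show ?thesis
      using True by simp
  next
    case False
    then obtain p where "0 < \<nu> p"
      by auto
    then have "(p, 0) \<in> young_diagram \<nu>"
      by (simp add: young_diagram_def)
    then have "tableaux \<nu> m = {}"
      using tableaux_entry[OF 0(1)] 0(2) by blast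
    then show ?thesis
      using False by simp
  qed
next
  case (Suc n)
  note \<nu> = Suc.prems(1)
  let ?m = "m(n := 0)"
  let ?B = "SIGMA \<kappa>:{\<kappa>. hstrip \<kappa> \<nu> \<and> psize \<nu> = psize \<kappa> + m n}. tableaux \<kappa> ?m"
  \<comment> \<open>Rows increase weakly, so the entries below \<open>n\<close> fill an initial
    segment of each row, whose length is \<open>low T p\<close>. The inverse \<open>g\<close> puts
    \<open>n\<close> into the cells outside the smaller shape.\<close>
  define low where "low = (\<lambda>T p. card {q. q < \<nu> p \<and> T (p, q) < n})"
  define f where "f = (\<lambda>T. (low T, restrict T (young_diagram (low T))))"
  define g where "g = (\<lambda>x. restrict (\<lambda>c. if c \<in> young_diagram (fst x) then snd x c else n) (young_diagram \<nu>))"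
  have fT: "hstrip (low T) \<nu>" "psize \<nu> = psize (low T) + m n"
    "restrict T (young_diagram (low T)) \<in> tableaux (low T) ?m" "g (f T) = T" if T: "T \<in> tableaux \<nu> m" for T
  proof -
    note TD = tableauxD[OF T]
    have le_n: "T (p, q) \<le> n" if "q < \<nu> p" for p q
      using tableaux_entry[OF \<nu> T, of "(p, q)"] Suc.prems(2)[of "T (p, q)"] that
      by (cases "T (p, q) \<le> n") (auto simp: young_diagram_def)
    have low: "q < low T p \<longleftrightarrow> q < \<nu> p \<and> T (p, q) < n" for p q
    proof -
      have "q \<in> {q. q < \<nu> p \<and> T (p, q) < n} \<longleftrightarrow> q < card {q. q < \<nu> p \<and> T (p, q) < n}"
        by (rule down_closed_mem_iff) (auto intro: le_less_trans TD(2))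
      then show ?thesis
        by (simp add: low_def)
    qed
    have young: "young_diagram (low T) = {c \<in> young_diagram \<nu>. T c < n}"
      by (auto simp: young_diagram_def low)
    have le: "low T p \<le> \<nu> p" for p
      unfolding le_iff_all_less[of "low T p"] by (simp add: low)
    \<comment> \<open>The cell below \<open>(p, q)\<close> holds at most \<open>n\<close>, so the
      cell itself holds less.\<close>
    have hs: "\<nu> (Suc p) \<le> low T p" for p
      unfolding le_iff_all_less[of "\<nu> (Suc p)"] low
      using TD(3)[of p "Suc p"] le_n[of _ "Suc p"] is_partition_Suc_le[OF \<nu>, of p]
      by (meson less_le_trans lessI)
    have part: "is_partition (low T)"
      by (rule is_partition_le[OF \<nu>]) (use le hs in \<open>auto simp: le_fun_def intro: order.trans\<close>)
    show "hstrip (low T) \<nu>"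
      using part \<nu> le hs by (simp add: hstrip_def)
    have "young_diagram \<nu> = young_diagram (low T) \<union> {c \<in> young_diagram \<nu>. T c = n}"
      unfolding young using le_n by (auto simp: young_diagram_def le_less)
    moreover have "card (young_diagram (low T) \<union> {c \<in> young_diagram \<nu>. T c = n}) =
        card (young_diagram (low T)) + card {c \<in> young_diagram \<nu>. T c = n}"
      using finite_young_diagram[OF \<nu>] finite_young_diagram[OF part]
      by (intro card_Un_disjoint) (auto simp: young)
    ultimately show "psize \<nu> = psize (low T) + m n"
      using TD(4)[of n] \<nu> part by (simp add: card_young_diagram[symmetric])
    show "restrict T (young_diagram (low T)) \<in> tableaux (low T) ?m"
    proof (rule tableauxI)
      fix p q q' assume q: "q < q'" "q' < low T p"
      then have "(p, q) \<in> young_diagram (low T)" "(p, q') \<in> young_diagram (low T)"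
        by (auto simp: young_diagram_def)
      then show "restrict T (young_diagram (low T)) (p, q) \<le> restrict T (young_diagram (low T)) (p, q')"
        using q TD(2)[of q q' p] by (simp add: low)
    next
      fix p p' q assume q: "p < p'" "q < low T p'"
      then have "(p, q) \<in> young_diagram (low T)" "(p', q) \<in> young_diagram (low T)"
        using is_partition_antimono[OF part, of p p'] by (auto simp: young_diagram_def)
      then show "restrict T (young_diagram (low T)) (p, q) < restrict T (young_diagram (low T)) (p', q)"
        using q TD(3)[of p p' q] by (simp add: low)
    next
      fix k
      have "{c \<in> young_diagram (low T). restrict T (young_diagram (low T)) c = k} =
          {c \<in> young_diagram (low T). T c = k}"
        by auto
      also have "\<dots> = (if k < n then {c \<in> young_diagram \<nu>. T c = k} else {})"
        by (auto simp: young)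
      finally have eq: "{c \<in> young_diagram (low T). restrict T (young_diagram (low T)) c = k} = \<dots>" .
      show "card {c \<in> young_diagram (low T). restrict T (young_diagram (low T)) c = k} = ?m k"
        unfolding eq using TD(4)[of k] Suc.prems(2)[of k] 
        by (cases "n < k") (auto simp: Suc_le_eq)
    qed simp
    have "g (f T) c = T c" for c
    proof (cases "c \<in> young_diagram \<nu>")
      case True
      then have "T c < n \<or> T c = n"
        using le_n by (cases c) (auto simp: young_diagram_def le_less)
      then show ?thesis
        using True by (auto simp: g_def f_def young)
    next
      case False
      then show ?thesis
        by (simp add: g_def extensional_arb[OF TD(1)])
    qed
    then show "g (f T) = T"
      by blast
  qed
  have gx: "g (\<kappa>, T) \<in> tableaux \<nu> m" "f (g (\<kappa>, T)) = (\<kappa>, T)"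
    if h: "hstrip \<kappa> \<nu>" "psize \<nu> = psize \<kappa> + m n" and T: "T \<in> tableaux \<kappa> ?m" for \<kappa> T
  proof -
    note TD = tableauxD[OF T]
    note hD = hstripD[OF h(1)]
    have sub: "young_diagram \<kappa> \<subseteq> young_diagram \<nu>"
      using hD(3) by (auto simp: young_diagram_def intro: less_le_trans)
    have lt: "T c < n" if "c \<in> young_diagram \<kappa>" for c
    proof -
      have "?m (T c) \<noteq> 0"
        using tableaux_entry[OF hD(1) T that] .
      then show ?thesis
        using Suc.prems(2)[of "T c"] by (cases "T c < n") (auto simp: not_less_eq_eq split: if_splits)
    qed
    have val: "g (\<kappa>, T) (p, q) = (if q < \<kappa> p then T (p, q) else n)" if "q < \<nu> p" for p q
      using that by (simp add: g_def young_diagram_def)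
    have lt': "T (p, q) < n" if "q < \<kappa> p" for p q
      using lt[of "(p, q)"] that by (simp add: young_diagram_def)
    show "g (\<kappa>, T) \<in> tableaux \<nu> m"
    proof (rule tableauxI)
      show "g (\<kappa>, T) \<in> extensional (young_diagram \<nu>)"
        by (simp add: g_def)
      show "g (\<kappa>, T) (p, q) \<le> g (\<kappa>, T) (p, q')" if "q < q'" "q' < \<nu> p" for p q q'
        using that TD(2)[of q q' p] lt'[of q p] by (auto simp: val)
      show "g (\<kappa>, T) (p, q) < g (\<kappa>, T) (p', q)" if "p < p'" "q < \<nu> p'" for p p' q
      proof -
        have "\<nu> p' \<le> \<nu> (Suc p)"
          using that(1) by (intro is_partition_antimono[OF \<nu>]) simp
        then have "q < \<kappa> p"
          using hD(4)[of p] that by linarith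
        moreover have "q < \<nu> p"
          using calculation hD(3)[of p] by simp
        ultimately show ?thesis
          using that TD(3)[of p p' q] lt'[of q p] by (auto simp: val)
      qed
      fix k
      have "{c \<in> young_diagram \<nu>. g (\<kappa>, T) c = k} =
          (if k = n then young_diagram \<nu> - young_diagram \<kappa> else {c \<in> young_diagram \<kappa>. T c = k})"
        using sub lt by (auto simp: g_def)
      moreover have "card (young_diagram \<nu> - young_diagram \<kappa>) = m n"
        using card_Diff_subset[OF finite_young_diagram[OF hD(1)] sub] h(2) hD(1,2)
        by (simp add: card_young_diagram)
      ultimately show "card {c \<in> young_diagram \<nu>. g (\<kappa>, T) c = k} = m k"
        using TD(4)[of k] by auto
    qed
    have "low (g (\<kappa>, T)) p = \<kappa> p" for p
    proof -
      have "{q. q < \<nu> p \<and> g (\<kappa>, T) (p, q) < n} = {..<\<kappa> p}"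
        using hD(3)[of p] lt' by (auto simp: val split: if_splits)
      then show ?thesis
        by (simp add: low_def)
    qed
    then have low: "low (g (\<kappa>, T)) = \<kappa>"
      by blast
    have "restrict (g (\<kappa>, T)) (young_diagram \<kappa>) c = T c" for c
      using sub extensional_arb[OF TD(1), of c] by (cases "c \<in> young_diagram \<kappa>") (auto simp: g_def)
    then show "f (g (\<kappa>, T)) = (\<kappa>, T)"
      unfolding f_def low by blast
  qed
  have "bij_betw f (tableaux \<nu> m) ?B"
  proof (rule bij_betw_byWitness[where f' = g])
    show "\<forall>T\<in>tableaux \<nu> m. g (f T) = T"
      using fT(4) by blast
    show "\<forall>x\<in>?B. f (g x) = x"
      using gx(2) by blast
    show "f ` tableaux \<nu> m \<subseteq> ?B"
      unfolding f_def using fT(1-3) by blast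
    show "g ` ?B \<subseteq> tableaux \<nu> m"
      using gx(1) by blast
  qed
  then have "card (tableaux \<nu> m) = card ?B"
    by (rule bij_betw_same_card)
  also have "\<dots> = (\<Sum>\<kappa> | hstrip \<kappa> \<nu> \<and> psize \<nu> = psize \<kappa> + m n. card (tableaux \<kappa> ?m))"
  proof (rule card_SigmaI)
    show "\<forall>\<kappa>\<in>{\<kappa>. hstrip \<kappa> \<nu> \<and> psize \<nu> = psize \<kappa> + m n}. finite (tableaux \<kappa> ?m)"
    proof
      fix \<kappa> assume "\<kappa> \<in> {\<kappa>. hstrip \<kappa> \<nu> \<and> psize \<nu> = psize \<kappa> + m n}"
      then have k: "is_partition \<kappa>"
        by (auto simp: hstrip_def)
      have "tableaux \<kappa> ?m \<subseteq> young_diagram \<kappa> \<rightarrow>\<^sub>E {..<Suc n}"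
      proof
        fix T assume T: "T \<in> tableaux \<kappa> ?m"
        have "T c < Suc n" if "c \<in> young_diagram \<kappa>" for c
          using tableaux_entry[OF k T that] Suc.prems(2)[of "T c"] by (cases "T c < Suc n") (auto split: if_splits)
        then show "T \<in> young_diagram \<kappa> \<rightarrow>\<^sub>E {..<Suc n}"
          using tableauxD(1)[OF T] by (auto simp: PiE_def)
      qed
      then show "finite (tableaux \<kappa> ?m)"
        using finite_young_diagram[OF k] by (auto intro: finite_subset finite_PiE)
    qed
  qed simp
  also have "\<dots> = (\<Sum>\<kappa> | hstrip \<kappa> \<nu> \<and> psize \<nu> = psize \<kappa> + m n. kostka n \<kappa> m)"
  proof (rule sum.cong[OF refl])
    fix \<kappa> assume "\<kappa> \<in> {\<kappa>. hstrip \<kappa> \<nu> \<and> psize \<nu> = psize \<kappa> + m n}"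
    then have "card (tableaux \<kappa> ?m) = kostka n \<kappa> ?m"
      using Suc.prems(2) by (intro Suc.IH) (auto simp: hstrip_def)
    also have "\<dots> = kostka n \<kappa> m"
      by (rule kostka_cong) simp
    finally show "card (tableaux \<kappa> ?m) = kostka n \<kappa> m" .
  qed
  finally show ?case
    by simp
qed

lemma schur_eq_kostka:
  assumes "is_partition \<nu>" "Poly_Mapping.keys m \<subseteq> {..<n}"
  shows "schur \<nu> m = int (kostka n \<nu> (Poly_Mapping.lookup m))"
proof -
  have "Poly_Mapping.lookup m k = 0" if "k \<ge> n" for k
    using assms(2) that by (metis in_keys_iff lessThan_iff not_le subsetD)
  then show ?thesis
    using card_tableaux[OF assms(1), of n "Poly_Mapping.lookup m"] by (simp add: schur_def tableaux_def)
qed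

subsection \<open>The Pieri rule\<close>

lemma kostka_row: "kostka n (row_part k) m = (if sum m {..<n} = k then 1 else 0)"
proof (induction n arbitrary: k)
  case 0
  have "row_part k = (\<lambda>_. 0) \<longleftrightarrow> k = 0"
    by (auto simp: row_part_def fun_eq_iff)
  then show ?case
    by auto
next
  case (Suc n)
  have "{\<kappa>. hstrip \<kappa> (row_part k) \<and> k = psize \<kappa> + m n} = (if m n \<le> k then {row_part (k - m n)} else {})"
  proof -
    have "\<kappa> = row_part (psize \<kappa>)" if "hstrip \<kappa> (row_part k)" for \<kappa>
    proof -
      have "\<kappa> p = 0" if "p \<ge> 1" for p
        using hstripD(3)[OF \<open>hstrip \<kappa> (row_part k)\<close>, of p] that by (simp add: row_part_def)
      then have "psize \<kappa> = \<kappa> 0" "\<kappa> = row_part (\<kappa> 0)"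
        by (simp_all add: psize_lessThan[of 1] row_part_def fun_eq_iff)
      then show ?thesis
        by simp
    qed
    moreover have "hstrip (row_part (k - m n)) (row_part k)"
      by (simp add: hstrip_def) (simp add: row_part_def)
    ultimately have "hstrip \<kappa> (row_part k) \<and> k = psize \<kappa> + m n \<longleftrightarrow> m n \<le> k \<and> \<kappa> = row_part (k - m n)" for \<kappa>
    proof (intro iffI)
      assume h: "hstrip \<kappa> (row_part k) \<and> k = psize \<kappa> + m n"
      then have "\<kappa> = row_part (psize \<kappa>)"
        using \<open>\<And>\<kappa>. hstrip \<kappa> (row_part k) \<Longrightarrow> \<kappa> = row_part (psize \<kappa>)\<close> by blast
      moreover have "psize \<kappa> = k - m n" "m n \<le> k"
        using h by auto
      ultimately show "m n \<le> k \<and> \<kappa> = row_part (k - m n)"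
        by simp
    qed auto
    then show ?thesis
      by auto
  qed
  then show ?case
    using Suc by auto
qed

lemma finite_bounded_functions:
  fixes m :: "nat \<Rightarrow> nat"
  shows "finite {q. (\<forall>p<n. q p \<le> m p) \<and> (\<forall>p\<ge>n. q p = 0)}"
proof (rule finite_subset)
  have "q p \<le> sum m {..<n}" if "\<forall>p<n. q p \<le> m p" "p < n" for q p
    using that member_le_sum[of p "{..<n}" m] by (auto intro: le_trans)
  then show "{q. (\<forall>p<n. q p \<le> m p) \<and> (\<forall>p\<ge>n. q p = 0)} \<subseteq>
    {f. \<forall>x. (x \<in> {..<n} \<longrightarrow> f x \<in> {..sum m {..<n}}) \<and> (x \<notin> {..<n} \<longrightarrow> f x = 0)}"
    by auto
qed (rule finite_set_of_finite_funs; simp)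

text \<open>The Pieri rule for the coefficient of \<open>m\<close> in \<open>n\<close> variables:
  \<open>q\<close> is the share of the exponents taken by the Schur function of
  \<open>\<rho>\<close>, the rest falls to the complete function. In the induction, \<open>d\<close>
  is the exponent of the last variable in the complete function; after branching and the induction
  hypothesis, an exchange of strips remains.\<close>

lemma kostka_pieri:
  assumes "is_partition \<rho>"
  shows "(\<Sum>q | (\<forall>p<n. q p \<le> m p) \<and> (\<forall>p\<ge>n. q p = 0) \<and> sum q {..<n} + k = sum m {..<n}. kostka n \<rho> q) =
    (\<Sum>\<nu> | hstrip \<rho> \<nu> \<and> psize \<nu> = psize \<rho> + k. kostka n \<nu> m)"
  using assms
proof (induction n arbitrary: \<rho> k)
  case 0
  show ?case
  proof (cases "\<rho> = (\<lambda>_. 0) \<and> k = 0")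
    case True
    have "{q :: nat \<Rightarrow> nat. \<forall>p. q p = 0} = {\<lambda>_. 0}"
      by auto
    moreover have "{\<nu>. hstrip (\<lambda>_. 0) \<nu> \<and> psize \<nu> = 0} = {\<lambda>_. 0}"
      by (auto simp: hstrip_def psize_eq_0_iff)
    ultimately show ?thesis
      using True by simp
  next
    case False
    have "(\<Sum>\<nu> | hstrip \<rho> \<nu> \<and> psize \<nu> = psize \<rho> + k. kostka 0 \<nu> m) = 0"
    proof (intro sum.neutral ballI)
      fix \<nu> assume \<nu>: "\<nu> \<in> {\<nu>. hstrip \<rho> \<nu> \<and> psize \<nu> = psize \<rho> + k}"
      then have "\<nu> \<noteq> (\<lambda>_. 0)"
        using False psize_eq_0_iff[OF 0] by auto
      then show "kostka 0 \<nu> m = 0"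
        by simp
    qed
    moreover have "(\<Sum>q | (\<forall>p<0. q p \<le> m p) \<and> (\<forall>p\<ge>0. q p = 0) \<and> sum q {..<0} + k = sum m {..<0}. kostka 0 \<rho> q) = 0"
      using False by (intro sum.neutral ballI) auto
    ultimately show ?thesis
      by simp
  qed
next
  case (Suc n)
  let ?Q = "\<lambda>n k. {q. (\<forall>p<n. q p \<le> m p) \<and> (\<forall>p\<ge>n. q p = 0) \<and> sum q {..<n} + k = sum m {..<n}}"
  have fin: "finite (?Q n k)" for n k
    by (rule finite_subset[OF _ finite_bounded_functions[of n m]]) auto
  have "(\<Sum>q\<in>?Q (Suc n) k. kostka (Suc n) \<rho> q) =
      (\<Sum>(d, q)\<in>(SIGMA d:{..min k (m n)}. ?Q n (k - d)). kostka (Suc n) \<rho> (q(n := m n - d)))"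
  proof (rule sum.reindex_bij_witness[where j = "\<lambda>q. (m n - q n, q(n := 0))" and i = "\<lambda>(d, q). q(n := m n - d)"], goal_cases)
    case (1 q)
    then have "q n \<le> m n"
      by simp
    then show ?case
      by simp
  next
    case (2 q)
    then have q: "\<And>p. p \<le> n \<Longrightarrow> q p \<le> m p" "\<And>p. p > n \<Longrightarrow> q p = 0" "sum q {..<n} + q n + k = sum m {..<n} + m n"
      by (auto simp: less_Suc_eq_le)
    have "sum q {..<n} \<le> sum m {..<n}"
      using q(1) by (intro sum_mono) auto
    moreover have "sum (q(n := 0)) {..<n} = sum q {..<n}"
      by (rule sum.cong) auto
    moreover have "q n \<le> m n"
      using q(1) by simp
    ultimately show ?case
      using q by auto
  next
    case (3 z)
    then show ?case
      by (auto simp: fun_eq_iff)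
  next
    case (4 z)
    moreover have "sum (q(n := x)) {..<n} = sum q {..<n}" for q x
      by (rule sum.cong) auto
    ultimately show ?case
      by (auto simp: less_Suc_eq)
  next
    case (5 q)
    then have "q(n := m n - (m n - q n)) = q"
      by (auto simp: fun_eq_iff)
    then show ?case
      by (simp only: case_prod_conv fun_upd_upd)
  qed
  also have "\<dots> = (\<Sum>d\<le>min k (m n). \<Sum>q\<in>?Q n (k - d). kostka (Suc n) \<rho> (q(n := m n - d)))"
    by (rule sum.Sigma[symmetric]) (use fin in blast)+
  also have "\<dots> = (\<Sum>d\<le>min k (m n). \<Sum>q\<in>?Q n (k - d).
      \<Sum>\<kappa> | hstrip \<kappa> \<rho> \<and> psize \<rho> = psize \<kappa> + (m n - d). kostka n \<kappa> q)"
  proof (intro sum.cong refl)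
    fix d q
    show "kostka (Suc n) \<rho> (q(n := m n - d)) =
      (\<Sum>\<kappa> | hstrip \<kappa> \<rho> \<and> psize \<rho> = psize \<kappa> + (m n - d). kostka n \<kappa> q)"
      unfolding kostka.simps fun_upd_same by (intro sum.cong refl kostka_cong) simp
  qed
  also have "\<dots> = (\<Sum>d\<le>min k (m n). \<Sum>\<kappa> | hstrip \<kappa> \<rho> \<and> psize \<rho> = psize \<kappa> + (m n - d).
      \<Sum>q\<in>?Q n (k - d). kostka n \<kappa> q)"
    by (rule sum.cong[OF refl], rule sum.swap)
  also have "\<dots> = (\<Sum>d\<le>min k (m n). \<Sum>\<kappa> | hstrip \<kappa> \<rho> \<and> psize \<rho> = psize \<kappa> + (m n - d).
      \<Sum>\<mu> | hstrip \<kappa> \<mu> \<and> psize \<mu> = psize \<kappa> + (k - d). kostka n \<mu> m)"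
    by (intro sum.cong refl Suc.IH) (auto simp: hstrip_def)
  also have "\<dots> = (\<Sum>\<nu> | hstrip \<rho> \<nu> \<and> psize \<nu> = psize \<rho> + k. kostka (Suc n) \<nu> m)"
    unfolding kostka.simps by (rule hstrip_exchange_sum[OF Suc.prems, symmetric])
  finally show ?case .
qed

lemma monomial_degree_eq_sum:
  "Poly_Mapping.keys m \<subseteq> {..<n} \<Longrightarrow> monomial_degree m = sum (Poly_Mapping.lookup m) {..<n}"
  by (rule monomial_degree_eq) auto

lemma obtain_monomial_bound:
  obtains n where "Poly_Mapping.keys (m :: monomial) \<subseteq> {..<n}"
  using finite_nat_iff_bounded[of "Poly_Mapping.keys m"] by auto

lemma schur_row: "schur (row_part k) m = (if monomial_degree m = k then 1 else 0)"
proof -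
  obtain n where n: "Poly_Mapping.keys m \<subseteq> {..<n}"
    by (rule obtain_monomial_bound)
  then show ?thesis
    by (simp add: schur_eq_kostka[OF is_partition_row n] kostka_row monomial_degree_eq_sum)
qed

lemma lookup_Abs_bounded:
  fixes q :: "nat \<Rightarrow> nat"
  assumes "\<And>p. p \<ge> n \<Longrightarrow> q p = 0"
  shows "Poly_Mapping.lookup (Abs_poly_mapping q) = q"
proof -
  have "p < n" if "q p \<noteq> 0" for p
    using assms[of p] that by (metis not_less)
  then have "{p. q p \<noteq> 0} \<subseteq> {..<n}"
    by auto
  then have "finite {p. q p \<noteq> 0}"
    by (rule finite_subset) simp
  then show ?thesis
    by (simp add: Abs_poly_mapping_inverse)
qed

text \<open>Only finitely many variables occur in \<open>m\<close>, so its coefficient is a matter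
  of Kostka numbers in \<open>n\<close> variables; the complete function merely selects the
  splittings whose first factor has degree \<open>k\<close>.\<close>

lemma series_pieri:
  assumes "is_partition \<rho>"
  shows "series_mult (schur (row_part k)) (schur \<rho>) m =
    (\<Sum>\<nu> | hstrip \<rho> \<nu> \<and> psize \<nu> = psize \<rho> + k. schur \<nu> m)"
proof -
  obtain n where n: "Poly_Mapping.keys m \<subseteq> {..<n}"
    by (rule obtain_monomial_bound)
  let ?m = "Poly_Mapping.lookup m"
  let ?Q = "{q. (\<forall>p<n. q p \<le> ?m p) \<and> (\<forall>p\<ge>n. q p = 0) \<and> sum q {..<n} + k = sum ?m {..<n}}"
  have m0: "?m p = 0" if "p \<ge> n" for p
    using n that by (metis in_keys_iff lessThan_iff not_le subsetD)
  have "series_mult (schur (row_part k)) (schur \<rho>) m =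
      (\<Sum>(p, q) | p + q = m \<and> monomial_degree p = k. schur \<rho> q)"
    by (rule sum.mono_neutral_cong_right) (auto simp: finite_add_pairs schur_row split: if_splits)
  also have "\<dots> = (\<Sum>q\<in>?Q. int (kostka n \<rho> q))"
  proof (rule sum.reindex_bij_witness[where j = "\<lambda>z. Poly_Mapping.lookup (snd z)" and
      i = "\<lambda>q. (m - Abs_poly_mapping q, Abs_poly_mapping q)"], goal_cases)
    case (1 z)
    then show ?case
      by (auto simp: lookup_inverse)
  next
    case (2 z)
    then obtain p q where z: "z = (p, q)" "p + q = m" "monomial_degree p = k"
      by auto
    have l: "?m i = Poly_Mapping.lookup p i + Poly_Mapping.lookup q i" for i
      using z(2) by (auto simp: lookup_add)
    have keys: "Poly_Mapping.keys p \<subseteq> {..<n}" "Poly_Mapping.keys q \<subseteq> {..<n}"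
      using n l by (auto simp: in_keys_iff subset_iff)
    have "sum ?m {..<n} = monomial_degree p + monomial_degree q"
      using z(2) n by (metis monomial_degree_add monomial_degree_eq_sum)
    then show ?case
      using z keys m0 l by (auto simp: monomial_degree_eq_sum[OF keys(2)])
  next
    case (3 q)
    then show ?case
      by (simp add: lookup_Abs_bounded[of n])
  next
    case (4 q)
    then have q: "\<And>p. p < n \<Longrightarrow> q p \<le> ?m p" "\<And>p. p \<ge> n \<Longrightarrow> q p = 0" "sum q {..<n} + k = sum ?m {..<n}"
      by auto
    have l: "Poly_Mapping.lookup (Abs_poly_mapping q) = q"
      using q(2) by (rule lookup_Abs_bounded)
    have le: "q p \<le> ?m p" for p
      using q(1,2)[of p] by (cases "p < n") auto
    have eq: "(m - Abs_poly_mapping q) + Abs_poly_mapping q = m"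
      by (rule poly_mapping_eqI) (simp add: lookup_add lookup_minus l le)
    have "Poly_Mapping.keys (Abs_poly_mapping q) \<subseteq> {..<n}"
      using q(2) l by (metis in_keys_iff lessThan_iff not_le subsetI)
    then have "monomial_degree (Abs_poly_mapping q) = sum q {..<n}"
      by (simp add: monomial_degree_eq_sum l)
    then have "monomial_degree (m - Abs_poly_mapping q) = k"
      using q(3) arg_cong[OF eq, of monomial_degree] n by (simp add: monomial_degree_add monomial_degree_eq_sum)
    then show ?case
      using eq by simp
  next
    case (5 z)
    then obtain p q where z: "z = (p, q)" "p + q = m"
      by auto
    have "Poly_Mapping.keys q \<subseteq> {..<n}"
      using n z(2) by (auto simp: in_keys_iff subset_iff lookup_add)
    then show ?case
      using z by (simp add: schur_eq_kostka[OF assms])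
  qed
  also have "\<dots> = int (\<Sum>\<nu> | hstrip \<rho> \<nu> \<and> psize \<nu> = psize \<rho> + k. kostka n \<nu> ?m)"
    unfolding kostka_pieri[OF assms, of n ?m k, symmetric] by (simp only: of_nat_sum)
  also have "\<dots> = (\<Sum>\<nu> | hstrip \<rho> \<nu> \<and> psize \<nu> = psize \<rho> + k. schur \<nu> m)"
    by (simp, rule sum.cong) (auto simp: schur_eq_kostka[OF _ n] hstrip_def)
  finally show ?thesis .
qed

subsection \<open>The ring of power series as a type\<close>

text \<open>Determinants and the locale need a ring given by a type class. All power series form
  such a type; the symmetric ones become the subset with
  \<open>ps_coeff x \<in> carrier Symm\<close>.\<close>

typedef ps = "UNIV :: power_series set" morphisms ps_coeff Ps
  by simp

lemma ps_coeff_Ps [simp]: "ps_coeff (Ps f) = f"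
  by (simp add: Ps_inverse)

lemma Ps_ps_coeff [simp]: "Ps (ps_coeff x) = x"
  by (rule ps_coeff_inverse)

lemma ps_eqI: "(\<And>m. ps_coeff x m = ps_coeff y m) \<Longrightarrow> x = y"
  by (metis ext ps_coeff_inject)

instantiation ps :: comm_ring_1
begin

definition zero_ps :: ps where "0 = Ps (\<lambda>m. 0)"

definition one_ps :: ps where "1 = Ps (\<lambda>m. if m = 0 then 1 else 0)"

definition plus_ps :: "ps \<Rightarrow> ps \<Rightarrow> ps" where "x + y = Ps (\<lambda>m. ps_coeff x m + ps_coeff y m)"

definition uminus_ps :: "ps \<Rightarrow> ps" where "- x = Ps (\<lambda>m. - ps_coeff x m)"

definition minus_ps :: "ps \<Rightarrow> ps \<Rightarrow> ps" where "x - y = Ps (\<lambda>m. ps_coeff x m - ps_coeff y m)"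

definition times_ps :: "ps \<Rightarrow> ps \<Rightarrow> ps" where "x * y = Ps (series_mult (ps_coeff x) (ps_coeff y))"

instance
proof
  fix x y z :: ps
  show "x * y * z = x * (y * z)"
    unfolding times_ps_def ps_coeff_Ps by (rule arg_cong[of _ _ Ps], rule ext, rule series_mult_assoc)
  show "x * y = y * x"
    unfolding times_ps_def by (rule arg_cong[of _ _ Ps], rule ext, rule series_mult_commute)
  show "1 * x = x"
    unfolding times_ps_def one_ps_def ps_coeff_Ps series_mult_one by simp
  show "(x + y) * z = x * z + y * z"
    unfolding times_ps_def plus_ps_def ps_coeff_Ps by (rule arg_cong[of _ _ Ps], rule ext, rule series_mult_add)
  show "(0 :: ps) \<noteq> 1"
  proof
    assume "(0 :: ps) = 1"
    then have "ps_coeff 0 0 = ps_coeff 1 0"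
      by simp
    then show False
      by (simp add: zero_ps_def one_ps_def)
  qed
qed (auto intro!: ps_eqI simp: zero_ps_def plus_ps_def uminus_ps_def minus_ps_def)

end

lemma ps_coeff_simps:
  "ps_coeff 0 m = 0" "ps_coeff (x + y) m = ps_coeff x m + ps_coeff y m"
  "ps_coeff (x - y) m = ps_coeff x m - ps_coeff y m" "ps_coeff (- x) m = - ps_coeff x m"
  by (simp_all add: zero_ps_def plus_ps_def minus_ps_def uminus_ps_def)

lemma ps_coeff_sum: "ps_coeff (sum f A) m = (\<Sum>x\<in>A. ps_coeff (f x) m)"
  by (induction A rule: infinite_finite_induct) (auto simp: ps_coeff_simps)

lemma monomial_degree_eq_0_iff: "monomial_degree m = 0 \<longleftrightarrow> m = 0"
  by (auto simp: monomial_degree_def poly_mapping_eq_iff fun_eq_iff in_keys_iff)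

interpretation schur: schur_family "\<lambda>\<nu>. Ps (schur \<nu>)"
proof
  show "Ps (schur (\<lambda>_. 0)) = 1"
    by (rule ps_eqI) (simp add: row_part_0[symmetric] schur_row one_ps_def monomial_degree_eq_0_iff)
next
  fix \<rho> k assume "is_partition \<rho>"
  then show "Ps (schur (row_part k)) * Ps (schur \<rho>) =
      (\<Sum>\<nu> | hstrip \<rho> \<nu> \<and> psize \<nu> = psize \<rho> + k. Ps (schur \<nu>))"
    by (intro ps_eqI) (simp add: times_ps_def ps_coeff_sum series_pieri)
qed

subsection \<open>Schur functions span the symmetric functions\<close>

lemma dt_in_subring:
  fixes R :: "'a::comm_ring_1 set"
  assumes R: "add_subgroup R" "1 \<in> R" and mult: "\<And>x y. x \<in> R \<Longrightarrow> y \<in> R \<Longrightarrow> x * y \<in> R"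
    and F: "\<And>p q. F p q \<in> R"
  shows "dt n F \<in> R"
  unfolding dt_leibniz
proof (rule add_subgroup_sum[OF R(1)])
  fix w
  have "prod f A \<in> R" if "\<And>x. f x \<in> R" for f and A :: "nat set"
    by (induction A rule: infinite_finite_induct) (auto simp: that R(2) mult)
  then show "signof w * (\<Prod>p = 0..<n. F p (w p)) \<in> R"
    using F by (simp add: sign_def add_subgroupD[OF R(1)])
qed

text \<open>By Jacobi-Trudi a Schur function is an integral polynomial in the complete ones. This
  serves both for the subring of symmetric series and for the ring of multipliers of a span.\<close>

lemma (in schur_family) in_subring:
  assumes R: "add_subgroup R" "1 \<in> R" and mult: "\<And>x y. x \<in> R \<Longrightarrow> y \<in> R \<Longrightarrow> x * y \<in> R"
    and row: "\<And>k. s (row_part k) \<in> R" and "is_partition \<nu>"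
  shows "s \<nu> \<in> R"
proof -
  obtain N where N: "\<And>k. k \<ge> N \<Longrightarrow> \<nu> k = 0"
    using is_partition_obtain_length[OF assms(5)] by blast
  have "dt N (\<lambda>p q. hz (int (\<nu> p) - int p + int q)) \<in> R"
    by (rule dt_in_subring[OF R mult]) (auto simp: hz_def row add_subgroupD[OF R(1)])
  then show ?thesis
    using jacobi_trudi[OF assms(5), of N] N by simp
qed

lemma carrier_Symm: "f \<in> carrier Symm \<longleftrightarrow> symmetric_series f \<and> bounded_degree f"
  by (simp add: Symm_def)

lemma mult_Symm: "f \<otimes>\<^bsub>Symm\<^esub> g = ps_coeff (Ps f * Ps g)"
  by (simp add: Symm_def times_ps_def)

lemma add_Symm: "f \<oplus>\<^bsub>Symm\<^esub> g = ps_coeff (Ps f + Ps g)"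
  by (simp add: Symm_def plus_ps_def)

lemma zero_Symm: "\<zero>\<^bsub>Symm\<^esub> = ps_coeff 0"
  by (simp add: Symm_def zero_ps_def)

lemma one_Symm: "\<one>\<^bsub>Symm\<^esub> = ps_coeff 1"
  by (simp add: Symm_def one_ps_def)

lemma uminus_in_Symm: "f \<in> carrier Symm \<Longrightarrow> ps_coeff (- Ps f) \<in> carrier Symm"
  by (auto simp: carrier_Symm uminus_ps_def symmetric_series_def bounded_degree_def)

interpretation Symm: cring Symm
  by (rule Symm_cring)

lemma a_inv_Symm:
  assumes "f \<in> carrier Symm"
  shows "\<ominus>\<^bsub>Symm\<^esub> f = ps_coeff (- Ps f)"
  using assms uminus_in_Symm[OF assms]
  by (intro Symm.minus_equality) (simp_all add: add_Symm zero_Symm)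

lemma a_minus_Symm: "f \<in> carrier Symm \<Longrightarrow> g \<in> carrier Symm \<Longrightarrow> f \<ominus>\<^bsub>Symm\<^esub> g = ps_coeff (Ps f - Ps g)"
  by (simp add: a_minus_def a_inv_Symm add_Symm)

lemma add_subgroup_symm: "add_subgroup {x. ps_coeff x \<in> carrier Symm}"
  unfolding add_subgroup_def
proof (intro conjI ballI)
  show "0 \<in> {x. ps_coeff x \<in> carrier Symm}"
    using Symm.zero_closed by (simp add: zero_Symm)
  show "x - y \<in> {x. ps_coeff x \<in> carrier Symm}"
    if "x \<in> {x. ps_coeff x \<in> carrier Symm}" "y \<in> {x. ps_coeff x \<in> carrier Symm}" for x y
    using that Symm.minus_closed[of "ps_coeff x" "ps_coeff y"] by (simp add: a_minus_Symm)
qed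

section \<open>Symmetry of Schur functions, and spanning by triangularity\<close>

lemma monomial_degree_map_key:
  assumes "bij \<pi>"
  shows "monomial_degree (Poly_Mapping.map_key \<pi> m) = monomial_degree m"
proof -
  have inj: "inj \<pi>"
    using assms by (rule bij_is_inj)
  have l: "Poly_Mapping.lookup (Poly_Mapping.map_key \<pi> m) k = Poly_Mapping.lookup m (\<pi> k)" for k
    using inj by (simp add: map_key.rep_eq)
  have "sum (Poly_Mapping.lookup m) (Poly_Mapping.keys m) =
      (\<Sum>k\<in>Poly_Mapping.keys (Poly_Mapping.map_key \<pi> m). Poly_Mapping.lookup m (\<pi> k))"
  proof (rule sum.reindex_bij_witness[where i = \<pi> and j = "inv_into UNIV \<pi>"])
    show "\<pi> (inv_into UNIV \<pi> k) = k" for k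
      using assms by (simp add: bij_is_surj surj_f_inv_f)
    then show "inv_into UNIV \<pi> k \<in> Poly_Mapping.keys (Poly_Mapping.map_key \<pi> m)" if "k \<in> Poly_Mapping.keys m" for k
      using that by (simp add: in_keys_iff l)
  qed (use inj assms in \<open>auto simp: in_keys_iff l bij_is_surj surj_f_inv_f\<close>)
  then show ?thesis
    by (simp add: monomial_degree_def l)
qed

text \<open>Symmetry is inherited from the complete functions, whose coefficients depend on the
  degree alone.\<close>

lemma schur_in_Symm:
  assumes "is_partition \<nu>"
  shows "schur \<nu> \<in> carrier Symm"
proof -
  have "Ps (schur \<nu>) \<in> {x. ps_coeff x \<in> carrier Symm}"
  proof (rule schur.in_subring[OF add_subgroup_symm _ _ _ assms])
    show "1 \<in> {x. ps_coeff x \<in> carrier Symm}"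
      using Symm.one_closed by (simp add: one_Symm)
    show "x * y \<in> {x. ps_coeff x \<in> carrier Symm}"
      if "x \<in> {x. ps_coeff x \<in> carrier Symm}" "y \<in> {x. ps_coeff x \<in> carrier Symm}" for x y
      using that Symm.m_closed[of "ps_coeff x" "ps_coeff y"] by (simp add: mult_Symm)
    show "Ps (schur (row_part k)) \<in> {x. ps_coeff x \<in> carrier Symm}" for k
      by (auto simp: carrier_Symm symmetric_series_def bounded_degree_def schur_row monomial_degree_map_key)
  qed
  then show ?thesis
    by simp
qed

text \<open>The inequalities of partial sums say that \<open>\<nu>\<close> dominates the content.
  They are inherited along the chain because shapes only grow, and at full length they become the
  equality of sizes.\<close>

lemma kostka_nonzeroD:
  assumes "kostka n \<nu> m \<noteq> 0" "is_partition \<nu>"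
  shows "psize \<nu> = sum m {..<n}" "\<And>p. p \<ge> n \<Longrightarrow> \<nu> p = 0"
    and "\<And>k. k \<le> n \<Longrightarrow> sum m {..<k} \<le> sum \<nu> {..<k}"
proof -
  have "psize \<nu> = sum m {..<n} \<and> (\<forall>p\<ge>n. \<nu> p = 0) \<and> (\<forall>k\<le>n. sum m {..<k} \<le> sum \<nu> {..<k})"
    using assms
  proof (induction n arbitrary: \<nu>)
    case 0
    then show ?case
      by (auto split: if_splits)
  next
    case (Suc n)
    from Suc.prems(1) obtain \<kappa> where "\<kappa> \<in> {\<kappa>. hstrip \<kappa> \<nu> \<and> psize \<nu> = psize \<kappa> + m n}" "kostka n \<kappa> m \<noteq> 0"
      unfolding kostka.simps by (rule sum.not_neutral_contains_not_neutral)
    then have \<kappa>: "hstrip \<kappa> \<nu>" "psize \<nu> = psize \<kappa> + m n" "kostka n \<kappa> m \<noteq> 0"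
      by auto
    note IH = Suc.IH[OF \<kappa>(3) hstripD(1)[OF \<kappa>(1)]]
    have size: "psize \<nu> = sum m {..<Suc n}"
      using IH \<kappa>(2) by simp
    have zero: "\<nu> p = 0" if "p \<ge> Suc n" for p
      using hstripD(4)[OF \<kappa>(1), of "p - 1"] IH that by (cases p) auto
    have "sum m {..<k} \<le> sum \<nu> {..<k}" if "k \<le> Suc n" for k
    proof (cases "k = Suc n")
      case True
      then show ?thesis
        using size psize_lessThan[of "Suc n" \<nu>] zero by simp
    next
      case False
      then have "sum m {..<k} \<le> sum \<kappa> {..<k}"
        using IH that by simp
      also have "\<dots> \<le> sum \<nu> {..<k}"
        using hstripD(3)[OF \<kappa>(1)] by (intro sum_mono)
      finally show ?thesis .
    qed
    then show ?case
      using size zero by blast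
  qed
  then show "psize \<nu> = sum m {..<n}" "\<And>p. p \<ge> n \<Longrightarrow> \<nu> p = 0" "\<And>k. k \<le> n \<Longrightarrow> sum m {..<k} \<le> sum \<nu> {..<k}"
    by blast+
qed

text \<open>The last strip of a chain must be exactly the last row: a smaller shape with positive
  count has no row of index \<open>n\<close>, so it lies in the truncated shape and has the same
  size.\<close>

lemma kostka_diag:
  assumes "is_partition \<nu>" "\<And>p. p \<ge> n \<Longrightarrow> \<nu> p = 0"
  shows "kostka n \<nu> \<nu> = 1"
  using assms
proof (induction n arbitrary: \<nu>)
  case 0
  then show ?case
    by auto
next
  case (Suc n)
  define \<sigma> where "\<sigma> = \<nu>(n := 0)"
  have \<sigma>0: "\<sigma> p = 0" if "p \<ge> n" for p
    using that Suc.prems(2)[of p] by (cases "p = n") (auto simp: \<sigma>_def)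
  have "\<sigma> (Suc p) \<le> \<sigma> p" for p
    using is_partition_Suc_le[OF Suc.prems(1), of p] \<sigma>0[of "Suc p"] by (cases "p = n") (auto simp: \<sigma>_def)
  then have \<sigma>: "is_partition \<sigma>"
    by (rule is_partitionI) (rule \<sigma>0)
  have size: "psize \<nu> = psize \<sigma> + \<nu> n"
    using psize_fun_upd[OF Suc.prems(1), of n 0] by (simp add: \<sigma>_def)
  have "\<nu> (Suc p) \<le> \<sigma> p" for p
    using is_partition_Suc_le[OF Suc.prems(1), of p] Suc.prems(2)[of "Suc p"] by (cases "p = n") (auto simp: \<sigma>_def)
  then have mem: "\<sigma> \<in> {\<kappa>. hstrip \<kappa> \<nu> \<and> psize \<nu> = psize \<kappa> + \<nu> n}"
    using \<sigma> Suc.prems(1) size by (simp add: hstrip_def) (simp add: \<sigma>_def)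
  have "kostka n \<kappa> \<nu> = 0" if \<kappa>: "hstrip \<kappa> \<nu>" "psize \<nu> = psize \<kappa> + \<nu> n" "\<kappa> \<noteq> \<sigma>" for \<kappa>
  proof (rule ccontr)
    assume "kostka n \<kappa> \<nu> \<noteq> 0"
    then have "\<kappa> p = 0" if "p \<ge> n" for p
      using kostka_nonzeroD(2)[OF _ hstripD(1)[OF \<kappa>(1)]] that by blast
    then have "\<kappa> \<le> \<sigma>"
      using hstripD(3)[OF \<kappa>(1)] by (auto simp: le_fun_def \<sigma>_def)
    then show False
      using psize_eqD[OF \<sigma>, of \<kappa>] size \<kappa>(2,3) by simp
  qed
  then have "kostka (Suc n) \<nu> \<nu> = (\<Sum>\<kappa>\<in>{\<sigma>}. kostka n \<kappa> \<nu>)"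
    unfolding kostka.simps using mem by (intro sum.mono_neutral_right) auto
  also have "\<dots> = kostka n \<sigma> \<sigma>"
    by (simp, rule kostka_cong) (simp add: \<sigma>_def)
  finally show ?case
    using Suc.IH[OF \<sigma> \<sigma>0] by simp
qed

text \<open>Permuting the variables sorts the exponents, so a symmetric series is determined by its
  coefficients at partitions.\<close>

lemma obtain_sorting_bij:
  obtains \<pi> \<nu> where "bij \<pi>" "is_partition \<nu>" "Poly_Mapping.lookup (Poly_Mapping.map_key \<pi> (m :: monomial)) = \<nu>"
proof -
  obtain n where n: "Poly_Mapping.keys m \<subseteq> {..<n}"
    by (rule obtain_monomial_bound)
  define xs where "xs = map (Poly_Mapping.lookup m) [0..<n]"
  have "mset (rev (sort xs)) = mset xs"
    by simp
  then obtain \<pi> where \<pi>: "\<pi> permutes {..<length xs}" "permute_list \<pi> xs = rev (sort xs)"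
    by (rule mset_eq_permutation)
  have len: "length xs = n"
    by (simp add: xs_def)
  have bij: "bij \<pi>"
    using \<pi>(1) by (rule permutes_bij)
  have l: "Poly_Mapping.lookup (Poly_Mapping.map_key \<pi> m) k = Poly_Mapping.lookup m (\<pi> k)" for k
    using bij by (simp add: map_key.rep_eq bij_is_inj)
  have lt: "Poly_Mapping.lookup m (\<pi> k) = rev (sort xs) ! k" if "k < n" for k
  proof -
    have "\<pi> k < n"
      using permutes_in_image[OF \<pi>(1), of k] that len by simp
    then show ?thesis
      using permute_list_nth[OF \<pi>(1), of k] that len \<pi>(2) by (simp add: xs_def)
  qed
  have ge: "Poly_Mapping.lookup m (\<pi> k) = 0" if "k \<ge> n" for k
  proof -
    have "\<pi> k = k"
      using \<pi>(1) that len by (simp add: permutes_def)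
    then show ?thesis
      using n that by (metis in_keys_iff lessThan_iff not_le subsetD)
  qed
  have "is_partition (\<lambda>k. Poly_Mapping.lookup m (\<pi> k))"
  proof (rule is_partitionI[of _ n])
    show "Poly_Mapping.lookup m (\<pi> (Suc p)) \<le> Poly_Mapping.lookup m (\<pi> p)" for p
    proof (cases "Suc p < n")
      case True
      then show ?thesis
        using sorted_nth_mono[of "sort xs" "n - Suc (Suc p)" "n - Suc p"] len by (simp add: lt rev_nth)
    qed (simp add: ge)
  qed (rule ge)
  then show ?thesis
    using that[OF bij] l by (metis ext)
qed

lemma add_subgroup_of_int_mult:
  fixes x :: "'a::comm_ring_1"
  assumes "add_subgroup K" "x \<in> K"
  shows "of_int c * x \<in> K"
proof -
  have "of_nat n * x \<in> K" for n
    by (induction n) (auto simp: distrib_right add_subgroupD[OF assms(1)] assms(2))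
  then show ?thesis
    by (cases c rule: int_cases2) (auto simp: add_subgroupD[OF assms(1)])
qed

text \<open>A numerical refinement of dominance: two comparable shapes of size at most
  \<open>d\<close> with equal weight have equal partial sums. It allows induction over
  \<open>nat\<close> instead of a partial order.\<close>

definition dominance_weight :: "nat \<Rightarrow> (nat \<Rightarrow> nat) \<Rightarrow> nat" where
  "dominance_weight d \<nu> = (\<Sum>k<d. sum \<nu> {..<Suc k})"

lemma lookup_Abs_partition: "is_partition \<nu> \<Longrightarrow> Poly_Mapping.lookup (Abs_poly_mapping \<nu>) = \<nu>"
  by (metis is_partition_obtain_length lookup_Abs_bounded)

lemma monomial_degree_partition: "is_partition \<nu> \<Longrightarrow> monomial_degree (Abs_poly_mapping \<nu>) = psize \<nu>"
  by (simp add: monomial_degree_def psize_def keys.rep_eq lookup_Abs_partition)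

text \<open>A nonzero coefficient makes \<open>\<nu>\<close> dominate \<open>\<mu>\<close>; the
  assumption on weights then leaves only equality.\<close>

lemma schur_triangular:
  assumes \<nu>: "is_partition \<nu>" "psize \<nu> \<le> d" and \<mu>: "is_partition \<mu>" "psize \<mu> \<le> d"
    and w: "dominance_weight d \<nu> \<le> dominance_weight d \<mu>"
  shows "schur \<nu> (Abs_poly_mapping \<mu>) = (if \<mu> = \<nu> then 1 else 0)"
proof -
  have zero: "\<nu> p = 0" "\<mu> p = 0" if "p \<ge> d" for p
    using that part_eq_0[OF \<nu>(1)] part_eq_0[OF \<mu>(1)] \<nu>(2) \<mu>(2) by auto
  have "Poly_Mapping.keys (Abs_poly_mapping \<mu>) \<subseteq> {..<d}"
    using zero(2) by (metis in_keys_iff lessThan_iff lookup_Abs_partition[OF \<mu>(1)] not_le subsetI)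
  then have eq: "schur \<nu> (Abs_poly_mapping \<mu>) = int (kostka d \<nu> \<mu>)"
    using schur_eq_kostka[OF \<nu>(1)] lookup_Abs_partition[OF \<mu>(1)] by simp
  show ?thesis
  proof (cases "\<mu> = \<nu>")
    case True
    then show ?thesis
      using eq kostka_diag[OF \<nu>(1), of d] zero by simp
  next
    case False
    have "kostka d \<nu> \<mu> = 0"
    proof (rule ccontr)
      assume nz: "kostka d \<nu> \<mu> \<noteq> 0"
      have le: "sum \<mu> {..<Suc k} \<le> sum \<nu> {..<Suc k}" if "k < d" for k
        using kostka_nonzeroD(3)[OF nz \<nu>(1), of "Suc k"] that by simp
      then have "dominance_weight d \<mu> \<le> dominance_weight d \<nu>"
        unfolding dominance_weight_def by (intro sum_mono[of "{..<d}"]) (simp only: lessThan_iff)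
      then have "dominance_weight d \<mu> = dominance_weight d \<nu>"
        using w by simp
      then have same: "sum \<mu> {..<Suc k} = sum \<nu> {..<Suc k}" if "k < d" for k
        using that sum_mono_inv[of "\<lambda>k. sum \<mu> {..<Suc k}" "{..<d}" "\<lambda>k. sum \<nu> {..<Suc k}" k] le
        by (simp only: dominance_weight_def finite_lessThan lessThan_iff)
      have "\<mu> p = \<nu> p" for p
      proof (cases "p < d")
        case True
        have "sum \<mu> {..<p} = sum \<nu> {..<p}"
          using same[of "p - 1"] True by (cases p) auto
        then show ?thesis
          using same[OF True] by simp
      next
        case False
        then show ?thesis
          using zero[of p] by simp
      qed
      then show False
        using False by blast
    qed
    then show ?thesis
      using eq False by simp
  qed
qed

text \<open>Elimination by decreasing weight: once the coefficients vanish at all partitions of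
  weight above \<open>w\<close>, subtracting multiples of the Schur functions of weight
  \<open>w\<close> makes them vanish at weight \<open>w\<close> too, and keeps symmetry and the
  degree bound. Spanning is phrased through a subgroup \<open>K\<close> so that it applies directly
  to sets of multipliers.\<close>

lemma Symm_in_of_schur:
  assumes K: "add_subgroup K" "\<And>\<nu>. is_partition \<nu> \<Longrightarrow> Ps (schur \<nu>) \<in> K" and f: "f \<in> carrier Symm"
  shows "Ps f \<in> K"
proof -
  obtain d where d: "\<And>m. f m \<noteq> 0 \<Longrightarrow> monomial_degree m \<le> d"
    using f by (auto simp: carrier_Symm bounded_degree_def)
  have main: "Ps f \<in> K" if "f \<in> carrier Symm" "\<And>m. f m \<noteq> 0 \<Longrightarrow> monomial_degree m \<le> d"
    "\<And>\<nu>. is_partition \<nu> \<Longrightarrow> psize \<nu> \<le> d \<Longrightarrow> w \<le> dominance_weight d \<nu> \<Longrightarrow> f (Abs_poly_mapping \<nu>) = 0" for w f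
    using that
  proof (induction w arbitrary: f)
    case 0
    have "f m = 0" for m
    proof (rule ccontr)
      assume nz: "f m \<noteq> 0"
      obtain \<pi> \<nu> where \<pi>: "bij \<pi>" "is_partition \<nu>" "Poly_Mapping.lookup (Poly_Mapping.map_key \<pi> m) = \<nu>"
        by (rule obtain_sorting_bij)
      then have eq: "Poly_Mapping.map_key \<pi> m = Abs_poly_mapping \<nu>"
        by (metis lookup_inverse)
      have "f (Abs_poly_mapping \<nu>) = f m"
        using 0(1) \<pi>(1) eq unfolding carrier_Symm symmetric_series_def by metis
      moreover have "psize \<nu> = monomial_degree m"
        using monomial_degree_map_key[OF \<pi>(1), of m] monomial_degree_partition[OF \<pi>(2)] eq by simp
      ultimately show False
        using nz 0(2)[OF nz] 0(3)[OF \<pi>(2)] by simp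
    qed
    then have "Ps f = 0"
      by (intro ps_eqI) (simp add: ps_coeff_simps)
    then show ?case
      using K(1) by (simp add: add_subgroupD)
  next
    case (Suc w)
    let ?A = "{\<nu>. is_partition \<nu> \<and> psize \<nu> \<le> d \<and> dominance_weight d \<nu> = w}"
    have fin: "finite ?A"
      by (rule finite_subset[OF _ finite_partitions_le[of d]]) auto
    define x where "x = (\<Sum>\<nu>\<in>?A. of_int (f (Abs_poly_mapping \<nu>)) * Ps (schur \<nu>))"
    have coeff: "ps_coeff x m = (\<Sum>\<nu>\<in>?A. f (Abs_poly_mapping \<nu>) * schur \<nu> m)" for m
    proof -
      have nat: "ps_coeff (of_nat c * y) m = int c * ps_coeff y m" for c y
        by (induction c) (auto simp: distrib_right ps_coeff_simps)
      have "ps_coeff (of_int c * y) m = c * ps_coeff y m" for c y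
        by (cases c rule: int_cases2) (simp_all add: nat ps_coeff_simps)
      then show ?thesis
        by (simp add: x_def ps_coeff_sum)
    qed
    have "x \<in> K"
      unfolding x_def using K by (intro add_subgroup_sum[OF K(1)] add_subgroup_of_int_mult) auto
    have "x \<in> {x. ps_coeff x \<in> carrier Symm}"
      unfolding x_def using schur_in_Symm
      by (intro add_subgroup_sum[OF add_subgroup_symm] add_subgroup_of_int_mult[OF add_subgroup_symm]) auto
    then have g: "ps_coeff (Ps f - x) \<in> carrier Symm"
      using Suc.prems(1) add_subgroupD(2)[OF add_subgroup_symm, of "Ps f" x] by simp
    have gc: "ps_coeff (Ps f - x) m = f m - (\<Sum>\<nu>\<in>?A. f (Abs_poly_mapping \<nu>) * schur \<nu> m)" for m
      by (simp add: coeff ps_coeff_simps)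
    have "Ps (ps_coeff (Ps f - x)) \<in> K"
    proof (rule Suc.IH[OF g])
      fix m assume nz: "ps_coeff (Ps f - x) m \<noteq> 0"
      show "monomial_degree m \<le> d"
      proof (rule ccontr)
        assume deg: "\<not> monomial_degree m \<le> d"
        obtain n where n: "Poly_Mapping.keys m \<subseteq> {..<n}"
          by (rule obtain_monomial_bound)
        have "schur \<nu> m = 0" if "\<nu> \<in> ?A" for \<nu>
        proof (rule ccontr)
          assume "schur \<nu> m \<noteq> 0"
          then have "psize \<nu> = monomial_degree m"
            using that n kostka_nonzeroD(1)[of n \<nu> "Poly_Mapping.lookup m"]
            by (simp add: schur_eq_kostka[OF _ n] monomial_degree_eq_sum)
          then show False
            using that deg by simp
        qed
        then have "ps_coeff (Ps f - x) m = f m"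
          unfolding gc by simp
        then show False
          using nz Suc.prems(2)[of m] deg by simp
      qed
    next
      fix \<mu> assume \<mu>: "is_partition \<mu>" "psize \<mu> \<le> d" "w \<le> dominance_weight d \<mu>"
      have "(\<Sum>\<nu>\<in>?A. f (Abs_poly_mapping \<nu>) * schur \<nu> (Abs_poly_mapping \<mu>)) =
          (\<Sum>\<nu>\<in>?A. if \<mu> = \<nu> then f (Abs_poly_mapping \<nu>) else 0)"
        using \<mu> by (intro sum.cong) (auto simp: schur_triangular[of _ d])
      also have "\<dots> = (if \<mu> \<in> ?A then f (Abs_poly_mapping \<mu>) else 0)"
        using fin by (simp add: sum.delta')
      \<comment> \<open>Outside \<open>?A\<close> the weight of \<open>\<mu>\<close> exceeds
        \<open>w\<close>, where \<open>f\<close> vanishes already.\<close>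
      also have "\<dots> = f (Abs_poly_mapping \<mu>)"
        using \<mu> Suc.prems(3)[OF \<mu>(1,2)] by auto
      finally show "ps_coeff (Ps f - x) (Abs_poly_mapping \<mu>) = 0"
        by (simp add: gc)
    qed
    then show ?case
      using add_subgroupD(4)[OF K(1) _ \<open>x \<in> K\<close>, of "Ps f - x"] by simp
  qed
  \<comment> \<open>Larger than every weight that occurs, which makes the vanishing condition
    vacuous at the start.\<close>
  define w where "w = Suc (Max (insert 0 (dominance_weight d ` {\<nu>. is_partition \<nu> \<and> psize \<nu> \<le> d})))"
  have "dominance_weight d \<nu> < w" if "is_partition \<nu>" "psize \<nu> \<le> d" for \<nu>
    unfolding w_def less_Suc_eq_le using that finite_partitions_le[of d] by (intro Max_ge) auto
  then have "f (Abs_poly_mapping \<nu>) = 0" if "is_partition \<nu>" "psize \<nu> \<le> d" "w \<le> dominance_weight d \<nu>" for \<nu>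
    using that by (meson leD)
  then show ?thesis
    using main[OF f d] by blast
qed

subsection \<open>The quotient ring\<close>

lemma generate_Symm_in:
  assumes K: "add_subgroup K" and S: "S \<subseteq> carrier Symm" "\<And>f. f \<in> S \<Longrightarrow> Ps f \<in> K" and f: "f \<in> int_span Symm S"
  shows "Ps f \<in> K"
  using f unfolding int_span_def
proof (induction rule: generate.induct)
  case one
  then show ?case
    using K by (simp add: zero_Symm add_subgroupD)
next
  case (incl f)
  then show ?case
    using S by simp
next
  case (inv f)
  have "inv\<^bsub>add_monoid Symm\<^esub> f = ps_coeff (- Ps f)"
    using a_inv_Symm[of f] inv S(1) by (auto simp: a_inv_def)
  then show ?case
    using inv S K by (simp add: add_subgroupD)
next
  case (eng f g)
  then show ?case
    using K by (simp add: add_Symm add_subgroupD)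
qed

lemma subgroup_int_span_Symm: "S \<subseteq> carrier Symm \<Longrightarrow> subgroup (int_span Symm S) (add_monoid Symm)"
  unfolding int_span_def by (rule group.generate_is_subgroup[OF Symm.a_group]) simp

lemma add_subgroup_of_subgroup:
  assumes "subgroup I (add_monoid Symm)"
  shows "add_subgroup {x. ps_coeff x \<in> I}"
  unfolding add_subgroup_def
proof (intro conjI ballI)
  show "0 \<in> {x. ps_coeff x \<in> I}"
    using subgroup.one_closed[OF assms] by (simp add: zero_Symm)
  fix x y assume xy: "x \<in> {x. ps_coeff x \<in> I}" "y \<in> {x. ps_coeff x \<in> I}"
  have y: "ps_coeff y \<in> carrier Symm"
    using subgroup.mem_carrier[OF assms] xy by auto
  have "ps_coeff (- y) \<in> I"
    using subgroup.m_inv_closed[OF assms, of "ps_coeff y"] xy(2) a_inv_Symm[OF y] by (simp add: a_inv_def)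
  then have "ps_coeff (x + - y) \<in> I"
    using subgroup.m_closed[OF assms, of "ps_coeff x" "ps_coeff (- y)"] xy(1) by (simp add: add_Symm)
  then show "x - y \<in> {x. ps_coeff x \<in> I}"
    by simp
qed

text \<open>The multipliers \<open>?R\<close> of the span form a subring. Pieri terms only enlarge
  shapes, so it contains the complete functions, then all Schur functions, and by spanning all
  symmetric functions. It is applied to the shapes that leave the large rectangle and to those that
  contain the small one.\<close>

lemma ideal_int_span_up_closed:
  assumes U: "\<And>\<nu>. \<nu> \<in> U \<Longrightarrow> is_partition \<nu>" "\<And>\<nu> \<mu>. \<nu> \<in> U \<Longrightarrow> is_partition \<mu> \<Longrightarrow> \<nu> \<le> \<mu> \<Longrightarrow> \<mu> \<in> U"
  shows "ideal (int_span Symm (schur ` U)) Symm"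
proof -
  let ?I = "int_span Symm (schur ` U)"
  let ?K = "{x. ps_coeff x \<in> ?I}"
  have S: "schur ` U \<subseteq> carrier Symm"
    using U(1) schur_in_Symm by auto
  have sub: "subgroup ?I (add_monoid Symm)"
    using S by (rule subgroup_int_span_Symm)
  have K: "add_subgroup ?K"
    using sub by (rule add_subgroup_of_subgroup)
  have mem: "Ps (schur \<nu>) \<in> ?K" if "\<nu> \<in> U" for \<nu>
    using that by (auto simp: int_span_def intro: generate.incl)
  let ?R = "{a. \<forall>x\<in>?K. a * x \<in> ?K}"
  have R: "add_subgroup ?R"
    using K by (auto simp: add_subgroup_def left_diff_distrib)
  have row: "Ps (schur (row_part k)) \<in> ?R" for k
  proof clarify
    fix x assume x: "ps_coeff x \<in> ?I"
    have "add_subgroup {y. Ps (schur (row_part k)) * y \<in> ?K}"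
      using K by (auto simp: add_subgroup_def right_diff_distrib)
    moreover have "Ps (schur \<nu>) \<in> {y. Ps (schur (row_part k)) * y \<in> ?K}" if "\<nu> \<in> U" for \<nu>
    proof -
      have "(\<Sum>\<mu> | hstrip \<nu> \<mu> \<and> psize \<mu> = psize \<nu> + k. Ps (schur \<mu>)) \<in> ?K"
        using that by (intro add_subgroup_sum[OF K] mem) (auto intro: U(2) hstripD(2,5))
      then show ?thesis
        using schur.pieri[OF U(1)[OF that], of k] by simp
    qed
    ultimately have "Ps (ps_coeff x) \<in> {y. Ps (schur (row_part k)) * y \<in> ?K}"
      using S x by (rule_tac generate_Symm_in) auto
    then show "ps_coeff (Ps (schur (row_part k)) * x) \<in> ?I"
      by simp
  qed
  have sch: "Ps (schur \<nu>) \<in> ?R" if "is_partition \<nu>" for \<nu>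
    by (rule schur.in_subring[OF R _ _ row that]) (auto simp: mult.assoc)
  have abs: "Ps g \<in> ?R" if "g \<in> carrier Symm" for g
    by (rule Symm_in_of_schur[OF R sch that])
  have closed: "g \<otimes>\<^bsub>Symm\<^esub> f \<in> ?I" if "f \<in> ?I" "g \<in> carrier Symm" for f g
  proof -
    have "Ps f \<in> ?K"
      using that by simp
    then show ?thesis
      using abs[OF that(2)] unfolding mult_Symm by blast
  qed
  show ?thesis
  proof (rule idealI[OF Symm.ring_axioms sub])
    show "g \<otimes>\<^bsub>Symm\<^esub> f \<in> ?I" if "f \<in> ?I" "g \<in> carrier Symm" for f g
      using that by (rule closed)
    show "f \<otimes>\<^bsub>Symm\<^esub> g \<in> ?I" if "f \<in> ?I" "g \<in> carrier Symm" for f g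
      using closed[OF that] subgroup.mem_carrier[OF sub that(1)] that(2) Symm.m_comm[of f g] by simp
  qed
qed

lemma ideal_schur_ideal: "ideal (schur_ideal r c) Symm"
proof -
  have eq: "{schur \<nu> |\<nu>. is_partition \<nu> \<and> \<not> \<nu> \<le> rect c r} = schur ` {\<nu>. is_partition \<nu> \<and> \<not> \<nu> \<le> rect c r}"
    by auto
  show ?thesis
    unfolding schur_ideal_def eq by (rule ideal_int_span_up_closed) (auto intro: order.trans)
qed

lemma ring_hom_grass: "ring_hom_ring Symm (grass_ring r c) ((+>\<^bsub>Symm\<^esub>) (schur_ideal r c))"
  unfolding grass_ring_def by (rule ideal.rcos_ring_hom_ring[OF ideal_schur_ideal])

lemma carrier_grass_ring: "carrier (grass_ring r c) = (+>\<^bsub>Symm\<^esub>) (schur_ideal r c) ` carrier Symm"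
  by (auto simp: grass_ring_def FactRing_def A_RCOSETS_def' a_r_coset_def')

lemma schur_class_in_carrier: "is_partition \<nu> \<Longrightarrow> schur_class r c \<nu> \<in> carrier (grass_ring r c)"
  by (auto simp: carrier_grass_ring schur_class_def schur_in_Symm)

lemma schur_class_eq_zero:
  assumes "is_partition \<nu>" "\<not> \<nu> \<le> rect c r"
  shows "schur_class r c \<nu> = \<zero>\<^bsub>grass_ring r c\<^esub>"
proof -
  interpret I: ideal "schur_ideal r c" Symm
    by (rule ideal_schur_ideal)
  have "schur \<nu> \<in> schur_ideal r c"
    unfolding schur_ideal_def int_span_def using assms by (intro generate.incl) auto
  then show ?thesis
    by (simp add: schur_class_def grass_ring_def FactRing_def I.a_rcos_const)
qed

text \<open>Shapes leaving the large rectangle may join the span because their classes vanish. This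
  exhibits \<open>rect_ideal\<close> as the image of an ideal of \<open>Symm\<close> under a
  surjection.\<close>

lemma rect_ideal_eq_image:
  "rect_ideal r c i j =
    (+>\<^bsub>Symm\<^esub>) (schur_ideal r c) ` int_span Symm (schur ` {\<mu>. is_partition \<mu> \<and> rect i j \<le> \<mu>})"
proof -
  let ?\<pi> = "(+>\<^bsub>Symm\<^esub>) (schur_ideal r c)"
  let ?U = "{\<mu>. is_partition \<mu> \<and> rect i j \<le> \<mu>}"
  let ?C = "schur_classes r c (rect i j) (rect c r)"
  interpret hom: ring_hom_ring Symm "grass_ring r c" ?\<pi>
    by (rule ring_hom_grass)
  interpret add_hom: group_hom "add_monoid Symm" "add_monoid (grass_ring r c)" ?\<pi>
    by (rule hom.a_group_hom)
  have "?\<pi> ` int_span Symm (schur ` ?U) = generate (add_monoid (grass_ring r c)) (?\<pi> ` schur ` ?U)"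
    unfolding int_span_def using schur_in_Symm by (intro add_hom.generate_img[symmetric]) auto
  also have "\<dots> = generate (add_monoid (grass_ring r c)) ?C"
  proof (rule subset_antisym)
    show "generate (add_monoid (grass_ring r c)) ?C \<subseteq> generate (add_monoid (grass_ring r c)) (?\<pi> ` schur ` ?U)"
      by (rule group.mono_generate[OF hom.S.a_group]) (auto simp: schur_classes_def schur_class_def)
    have "?\<pi> (schur \<mu>) \<in> generate (add_monoid (grass_ring r c)) ?C" if "\<mu> \<in> ?U" for \<mu>
    proof (cases "\<mu> \<le> rect c r")
      case True
      then show ?thesis
        using that by (intro generate.incl) (auto simp: schur_classes_def schur_class_def)
    next
      case False
      then have "?\<pi> (schur \<mu>) = \<one>\<^bsub>add_monoid (grass_ring r c)\<^esub>"
        using that schur_class_eq_zero[of \<mu> c r] by (simp add: schur_class_def)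
      then show ?thesis
        by (simp only: generate.one)
    qed
    then show "generate (add_monoid (grass_ring r c)) (?\<pi> ` schur ` ?U) \<subseteq> generate (add_monoid (grass_ring r c)) ?C"
      by (intro group.generate_subgroup_incl group.generate_is_subgroup hom.S.a_group)
        (auto simp: schur_classes_def schur_class_in_carrier)
  qed
  finally show ?thesis
    by (simp add: rect_ideal_def int_span_def)
qed

lemma ideal_rect_ideal: "ideal (rect_ideal r c i j) (grass_ring r c)"
proof -
  let ?\<pi> = "(+>\<^bsub>Symm\<^esub>) (schur_ideal r c)"
  let ?M = "int_span Symm (schur ` {\<mu>. is_partition \<mu> \<and> rect i j \<le> \<mu>})"
  interpret hom: ring_hom_ring Symm "grass_ring r c" ?\<pi>
    by (rule ring_hom_grass)
  interpret add_hom: group_hom "add_monoid Symm" "add_monoid (grass_ring r c)" ?\<pi>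
    by (rule hom.a_group_hom)
  interpret M: ideal ?M Symm
    by (rule ideal_int_span_up_closed) (auto intro: order.trans)
  show ?thesis
    unfolding rect_ideal_eq_image
  proof (rule idealI[OF hom.S.ring_axioms])
    show "subgroup (?\<pi> ` ?M) (add_monoid (grass_ring r c))"
      by (rule add_hom.subgroup_img_is_subgroup) (rule M.a_subgroup)
    fix a x assume "a \<in> ?\<pi> ` ?M" "x \<in> carrier (grass_ring r c)"
    then obtain f g where fg: "a = ?\<pi> f" "f \<in> ?M" "x = ?\<pi> g" "g \<in> carrier Symm"
      by (auto simp: carrier_grass_ring)
    have f: "f \<in> carrier Symm"
      using fg(2) by (rule M.a_Hcarr)
    show "x \<otimes>\<^bsub>grass_ring r c\<^esub> a \<in> ?\<pi> ` ?M"
      using fg f M.I_l_closed by (auto simp flip: hom.hom_mult)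
    show "a \<otimes>\<^bsub>grass_ring r c\<^esub> x \<in> ?\<pi> ` ?M"
      using fg f M.I_r_closed by (auto simp flip: hom.hom_mult)
  qed
qed

text \<open>Passes from ideals of the quotient, a ring given by its carrier, to subsets of the type
  \<open>ps\<close>, where the generator theorems apply.\<close>

lemma add_subgroup_vimage:
  assumes N: "ideal N (grass_ring r c)"
  defines "K \<equiv> {x. ps_coeff x \<in> carrier Symm \<and> schur_ideal r c +>\<^bsub>Symm\<^esub> ps_coeff x \<in> N}"
  shows "add_subgroup K" "is_partition \<nu> \<Longrightarrow> x \<in> K \<Longrightarrow> Ps (schur \<nu>) * x \<in> K"
    "is_partition \<nu> \<Longrightarrow> Ps (schur \<nu>) \<in> K \<longleftrightarrow> schur_class r c \<nu> \<in> N"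
proof -
  interpret hom: ring_hom_ring Symm "grass_ring r c" "(+>\<^bsub>Symm\<^esub>) (schur_ideal r c)"
    by (rule ring_hom_grass)
  interpret N: ideal N "grass_ring r c"
    by (rule N)
  show "add_subgroup K"
    unfolding add_subgroup_def
  proof (intro conjI ballI)
    show "0 \<in> K"
      using Symm.zero_closed N.zero_closed hom.hom_zero by (simp add: K_def zero_Symm)
    fix x y assume "x \<in> K" "y \<in> K"
    then have xy: "ps_coeff x \<in> carrier Symm" "ps_coeff y \<in> carrier Symm"
      "schur_ideal r c +>\<^bsub>Symm\<^esub> ps_coeff x \<in> N" "schur_ideal r c +>\<^bsub>Symm\<^esub> ps_coeff y \<in> N"
      by (auto simp: K_def)
    have "ps_coeff (x - y) = ps_coeff x \<oplus>\<^bsub>Symm\<^esub> (\<ominus>\<^bsub>Symm\<^esub> ps_coeff y)"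
      using xy by (simp add: a_inv_Symm add_Symm)
    then show "x - y \<in> K"
      using xy N.a_closed N.a_inv_closed by (simp add: K_def)
  qed
  show "Ps (schur \<nu>) * x \<in> K" if "is_partition \<nu>" "x \<in> K"
  proof -
    have "ps_coeff (Ps (schur \<nu>) * x) = schur \<nu> \<otimes>\<^bsub>Symm\<^esub> ps_coeff x"
      by (simp add: mult_Symm)
    then show ?thesis
      using that schur_in_Symm[OF that(1)] N.I_l_closed by (simp add: K_def)
  qed
  show "is_partition \<nu> \<Longrightarrow> Ps (schur \<nu>) \<in> K \<longleftrightarrow> schur_class r c \<nu> \<in> N"
    by (simp add: K_def schur_class_def schur_in_Symm)
qed

text \<open>The assumption \<open>gen\<close> has the form shared by both generator theorems, with
  \<open>\<beta>\<close> left open; it is used with the preimage of the generated ideal as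
  \<open>K\<close>. The bound on \<open>\<beta>\<close> places the proposed generators in
  \<open>rect_ideal\<close>.\<close>

lemma rect_ideal_eq_genideal:
  assumes \<beta>: "\<beta> \<le> rect c r"
    and gen: "\<And>K. add_subgroup K \<Longrightarrow> (\<And>\<nu> x. is_partition \<nu> \<Longrightarrow> x \<in> K \<Longrightarrow> Ps (schur \<nu>) * x \<in> K) \<Longrightarrow>
      (\<And>\<nu>. is_partition \<nu> \<Longrightarrow> \<not> \<nu> \<le> rect c r \<Longrightarrow> Ps (schur \<nu>) \<in> K) \<Longrightarrow>
      (\<And>\<nu>. is_partition \<nu> \<Longrightarrow> rect i j \<le> \<nu> \<Longrightarrow> \<nu> \<le> \<beta> \<Longrightarrow> Ps (schur \<nu>) \<in> K) \<Longrightarrow>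
      (\<And>\<mu>. is_partition \<mu> \<Longrightarrow> rect i j \<le> \<mu> \<Longrightarrow> Ps (schur \<mu>) \<in> K)"
  shows "rect_ideal r c i j = Idl\<^bsub>grass_ring r c\<^esub> (schur_classes r c (rect i j) \<beta>)"
proof -
  let ?G = "schur_classes r c (rect i j) \<beta>"
  interpret hom: ring_hom_ring Symm "grass_ring r c" "(+>\<^bsub>Symm\<^esub>) (schur_ideal r c)"
    by (rule ring_hom_grass)
  have carr: "?G \<subseteq> carrier (grass_ring r c)"
    by (auto simp: schur_classes_def schur_class_in_carrier)
  have N: "ideal (Idl\<^bsub>grass_ring r c\<^esub> ?G) (grass_ring r c)"
    using carr by (rule hom.S.genideal_ideal)
  interpret N: ideal "Idl\<^bsub>grass_ring r c\<^esub> ?G" "grass_ring r c"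
    by (rule N)
  note K = add_subgroup_vimage[OF N]
  show ?thesis
  proof (rule subset_antisym)
    have "?G \<subseteq> schur_classes r c (rect i j) (rect c r)"
      unfolding schur_classes_def using \<beta> by (blast intro: order.trans)
    also have "\<dots> \<subseteq> rect_ideal r c i j"
      unfolding rect_ideal_def int_span_def by (auto intro: generate.incl)
    finally show "Idl\<^bsub>grass_ring r c\<^esub> ?G \<subseteq> rect_ideal r c i j"
      by (rule hom.S.genideal_minimal[OF ideal_rect_ideal])
    have "schur_class r c \<mu> \<in> Idl\<^bsub>grass_ring r c\<^esub> ?G" if "is_partition \<mu>" "rect i j \<le> \<mu>" for \<mu>
      unfolding K(3)[OF that(1), symmetric]
    proof (rule gen[OF K(1) K(2) _ _ that])
      fix \<nu> assume \<nu>: "is_partition \<nu>"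
      show "Ps (schur \<nu>) \<in> {x. ps_coeff x \<in> carrier Symm \<and> schur_ideal r c +>\<^bsub>Symm\<^esub> ps_coeff x \<in> Idl\<^bsub>grass_ring r c\<^esub> ?G}"
        if "\<not> \<nu> \<le> rect c r"
        unfolding K(3)[OF \<nu>] schur_class_eq_zero[OF \<nu> that] by (rule N.zero_closed)
      show "Ps (schur \<nu>) \<in> {x. ps_coeff x \<in> carrier Symm \<and> schur_ideal r c +>\<^bsub>Symm\<^esub> ps_coeff x \<in> Idl\<^bsub>grass_ring r c\<^esub> ?G}"
        if "rect i j \<le> \<nu>" "\<nu> \<le> \<beta>"
        unfolding K(3)[OF \<nu>]
        using hom.S.genideal_self[OF carr] \<nu> that by (auto simp: schur_classes_def)
    qed
    then show "rect_ideal r c i j \<subseteq> Idl\<^bsub>grass_ring r c\<^esub> ?G"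
      unfolding rect_ideal_def int_span_def
      by (intro group.generate_subgroup_incl[OF hom.S.a_group _ N.a_subgroup]) (auto simp: schur_classes_def)
  qed
qed

theorem theorem4p8:
  fixes r n i j a b :: nat
  assumes "1 \<le> r" and "r < n"
    and "1 \<le> i" and "i \<le> n - r"
    and "1 \<le> j" and "j \<le> r"
    and "a = min (n - r - i) (r - j)"
    and "b = min i j"
  shows "ideal (schur_ideal r (n - r)) Symm \<and>
    ideal (rect_ideal r (n - r) i j) (grass_ring r (n - r)) \<and>
    rect_ideal r (n - r) i j =
      Idl\<^bsub>grass_ring r (n - r)\<^esub>
        (schur_classes r (n - r) (rect i j) (parts (replicate b (i + a) @ replicate (j - b) i))) \<and>
    rect_ideal r (n - r) i j =
      Idl\<^bsub>grass_ring r (n - r)\<^esub>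
        (schur_classes r (n - r) (rect i j) (parts (replicate j i @ replicate a b)))"
proof (intro conjI)
  show "ideal (schur_ideal r (n - r)) Symm"
    by (rule ideal_schur_ideal)
  show "ideal (rect_ideal r (n - r) i j) (grass_ring r (n - r))"
    by (rule ideal_rect_ideal)
  show "rect_ideal r (n - r) i j = Idl\<^bsub>grass_ring r (n - r)\<^esub>
      (schur_classes r (n - r) (rect i j) (parts (replicate b (i + a) @ replicate (j - b) i)))"
  proof (rule rect_ideal_eq_genideal, goal_cases)
    case 1
    \<comment> \<open>The bounding shape has at most \<open>j \<le> r\<close> rows, and
      \<open>i + a \<le> n - r\<close> by the choice of \<open>a\<close>.\<close>
    show ?case
      using assms by (auto simp: le_fun_def rect_apply nth_default_def nth_append)
  next
    case (2 K \<mu>)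
    show ?case
      by (rule schur.rect_generators[OF 2(1-4) assms(7,8,4,6) 2(5,6)])
  qed
  show "rect_ideal r (n - r) i j = Idl\<^bsub>grass_ring r (n - r)\<^esub>
      (schur_classes r (n - r) (rect i j) (parts (replicate j i @ replicate a b)))"
  proof (rule rect_ideal_eq_genideal, goal_cases)
    case 1
    have "parts (replicate j i @ replicate a b) p = (if p < j then i else if p < j + a then b else 0)" for p
      by (auto simp: nth_default_def nth_append)
    moreover have "b \<le> n - r" "j + a \<le> r"
      using assms by auto
    ultimately show ?case
      using assms(4,6) by (auto simp: le_fun_def rect_apply)
  next
    case (2 K \<mu>)
    show ?case
      by (rule schur.rect_generators_dual[OF 2(1-4) assms(7,8,4,6) 2(5,6)])
  qed
qed

end
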